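(* Let $H$ be a continuous function on $\mathbb{R}$ and let $P$ be an infinite set of primes. Assume either (i) $\phi$ and $\psi$ are permutation polynomials for $P$; or (ii) $\phi(n)=(an+b)c^n$ and $\psi(n)=(dn+e)k^n$ for integers $a,b,c,d,e,k$ with $a,c,d,k$ non-zero, and $p\nmid abcdek$ for all $p\in P$. Let $A=A(x)$, $B=B(x)$ be positive integers with $\log A/\log x\to\infty$ and $\log B/\log x\to\infty$ as $x\to\infty$. Then \[ \frac{1}{\#T_{\phi,\psi}(A,B)}\sum_{(E,E')\in T_{\phi,\psi}(A,B)}H\left(\frac{\sum_{p\in P_x}\widetilde a_E(p)\widetilde a_{E'}(p)}{\sqrt{\pi_P(x)}}\right)\to\frac{1}{\sqrt{2\pi}}\int_{-\infty}^{\infty}H(t)e^{-t^2/2}\,dt \] as $x\to\infty$.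
   Context: $E(\alpha,\beta)$ denotes the curve $y^2=x^3+\alpha x+\beta$. For an elliptic curve $E$ and prime $p$, $a_E(p)=p+1-\#E(\mathbb{F}_p)$ (trace of Frobenius) and $\widetilde a_E(p)=a_E(p)/\sqrt p$. For functions $\phi,\psi$ on $\mathbb{Z}$, $T_{\phi,\psi}(A,B)$ is the set of pairs $(E_1,E_2)$ with $E_i=E(\phi(a_i),\psi(b_i))$ elliptic curves, $|a_i|\le A$, $|b_i|\le B$ ($i=1,2$), and $E_1\not\simeq E_2$. $P_x=\{p\in P:p\le x\}$ and $\pi_P(x)=\#P_x$. A polynomial is a permutation polynomial for $P$ if it induces a permutation of $\mathbb{F}_p$ for every $p\in P$.
   Formalization: The continuous function H is additionally assumed to have polynomial growth, |H(t)| ≤ C(1+|t|)^m for some C and m; for arbitrary continuous H the claim fails, e.g. for H(t)=exp(t²/4), because of isogenous non-isomorphic pairs in T. *)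

theory Defs
  imports
    "HOL-Analysis.Analysis"
    "HOL-Computational_Algebra.Computational_Algebra"
    "HOL-Number_Theory.Number_Theory"
begin

text \<open>The pair \<open>(\<alpha>, \<beta>)\<close> stands for the curve \<open>y\<^sup>2 = x\<^sup>3 + \<alpha> x + \<beta>\<close> over the rationals.
  Rational (and not only integral) coefficients are needed because \<open>(a n + b) c\<^sup>n\<close> is
  also taken at negative \<open>n\<close>.\<close>

type_synonym curve = "rat \<times> rat"

definition is_elliptic :: "curve \<Rightarrow> bool" where
  "is_elliptic E \<longleftrightarrow> (case E of (\<alpha>, \<beta>) \<Rightarrow> 4 * \<alpha> ^ 3 + 27 * \<beta> ^ 2 \<noteq> 0)"

definition weierstrass :: "curve \<Rightarrow> rat \<Rightarrow> rat \<Rightarrow> rat" where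
  "weierstrass E x y = (case E of (\<alpha>, \<beta>) \<Rightarrow> y ^ 2 - (x ^ 3 + \<alpha> * x + \<beta>))"

text \<open>Isomorphisms over the rationals of curves in Weierstrass form are the admissible changes
  of variables \<open>(x, y) \<mapsto> (u\<^sup>2 x + r, u\<^sup>3 y + s u\<^sup>2 x + t)\<close> that carry one equation to the other.
  The rationals being infinite, equality for all values is equality of polynomials.\<close>

definition curve_iso :: "curve \<Rightarrow> curve \<Rightarrow> bool" where
  "curve_iso E E' \<longleftrightarrow> (\<exists>u r s t :: rat. u \<noteq> 0 \<and>
     (\<forall>x y. weierstrass E (u ^ 2 * x + r) (u ^ 3 * y + s * u ^ 2 * x + t)
          = u ^ 6 * weierstrass E' x y))"

text \<open>The image in \<open>\<int>/p\<int>\<close>, represented in \<open>{0..<p}\<close>, of a rational number whose denominator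
  is prime to \<open>p\<close>; the value in other cases is irrelevant.\<close>

definition rat_mod :: "nat \<Rightarrow> rat \<Rightarrow> int" where
  "rat_mod p q = (case quotient_of q of (m, n) \<Rightarrow> (m * modular_inverse (int p) n) mod int p)"

text \<open>The summand 1 is the point at infinity.\<close>

definition num_points :: "curve \<Rightarrow> nat \<Rightarrow> nat" where
  "num_points E p = (case E of (\<alpha>, \<beta>) \<Rightarrow>
     1 + card {(x, y) \<in> {0..<int p} \<times> {0..<int p}.
                 [y ^ 2 = x ^ 3 + rat_mod p \<alpha> * x + rat_mod p \<beta>] (mod int p)})"

definition frob_trace :: "curve \<Rightarrow> nat \<Rightarrow> int" where
  "frob_trace E p = int p + 1 - int (num_points E p)"

definition norm_trace :: "curve \<Rightarrow> nat \<Rightarrow> real" where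
  "norm_trace E p = real_of_int (frob_trace E p) / sqrt (real p)"

definition curve_pairs ::
    "(int \<Rightarrow> rat) \<Rightarrow> (int \<Rightarrow> rat) \<Rightarrow> nat \<Rightarrow> nat \<Rightarrow> (curve \<times> curve) set" where
  "curve_pairs \<phi> \<psi> A B =
     {(E1, E2). \<exists>a1 b1 a2 b2 :: int.
        \<bar>a1\<bar> \<le> int A \<and> \<bar>b1\<bar> \<le> int B \<and> \<bar>a2\<bar> \<le> int A \<and> \<bar>b2\<bar> \<le> int B \<and>
        E1 = (\<phi> a1, \<psi> b1) \<and> E2 = (\<phi> a2, \<psi> b2) \<and>
        is_elliptic E1 \<and> is_elliptic E2 \<and> \<not> curve_iso E1 E2}"

definition primes_upto_in :: "nat set \<Rightarrow> real \<Rightarrow> nat set" where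
  "primes_upto_in P x = {p \<in> P. real p \<le> x}"

definition permutation_poly_for :: "nat set \<Rightarrow> int poly \<Rightarrow> bool" where
  "permutation_poly_for P f \<longleftrightarrow>
     (\<forall>p\<in>P. bij_betw (\<lambda>n. poly f n mod int p) {0..<int p} {0..<int p})"

end

theory Submission
  imports Defs "HOL-Probability.Probability"
begin

text \<open>
  The proof is by the method of moments. Expanding the \<open>r\<close>-th moment of the normalised sum only
  involves \<open>r\<close> primes at a time, and modulo the product of \<open>r\<close> primes below \<open>x\<close> the coefficients
  \<open>\<phi>(a)\<close>, \<open>\<psi>(b)\<close> are equidistributed up to an error that is a power of \<open>x\<close> divided by \<open>A\<close> or \<open>B\<close>,
  which is negligible. For \<open>(a n + b) c\<^sup>n\<close> the joint equidistribution is proved by adding the primes in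
  increasing order: the largest prime \<open>q\<close> divides none of the periods \<open>p (p - 1)\<close> of the smaller ones.
  Hence every moment agrees asymptotically with that of a sum of independent variables, one for
  each prime, attached to two uniformly random Weierstrass equations over the prime field.

  For a single prime the mean and the variance of the trace over all Weierstrass equations are
  elementary character sums, so only a uniform bound \<open>|a\<^sub>E(p)| \<le> C sqrt p\<close> is needed from the arithmetic
  of curves; it is obtained by the Stepanov method, carried out with integer polynomials
  modulo \<open>p\<close>. The characteristic functions of the independent model converge to that of the
  standard normal distribution, the moment comparison transfers this to the curves, and the
  continuity theorem of Levy together with the moment bounds gives the limit for every
  continuous \<open>H\<close> of polynomial growth.
\<close>

section \<open>Integer polynomials modulo a prime\<close>

text \<open>Gaussian moments are never computed. The independent model is handled through
  exponentials: the mean of \<open>exp (t * model_sum S z)\<close> is bounded uniformly in the set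
  of primes, so moments of order 2k are at most a constant times (2k)! / t^(2k) for every t > 0. As
  t is arbitrary, Taylor remainders of characteristic functions become small, and agreement of
  moments passes to characteristic functions. The size of a trace matters only through boundedness
  of the normalised products, so any constant will do; here it is 23, and 529 = 23^2 for a product.
  The exact mean and variance come from averaging over all coefficients, which brings in singular
  equations. The Stepanov argument is arranged accordingly: the odd degree of the cubic, rather than
  squarefreeness, makes the auxiliary polynomial nonzero. A further obstacle is that pairs of curves
  form a set and not a family of indices: coinciding values of \<phi> would distort the average if
  one summed over indices. The values are therefore indexed by sets that differ from intervals in
  boundedly many points.\<close>

hide_const (open) up_ring.coeff up_ring.monom module.smult

text \<open>Pigeonhole: there are more residue vectors on \<open>I\<close> than value vectors on
  \<open>K\<close>, so two of them have equal values under \<open>L\<close> modulo \<open>p\<close>,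
  and \<open>w\<close> is their difference. \<open>L\<close> only has to respect subtraction, so
  operators on polynomials can be inserted without writing a matrix.\<close>

lemma siegel_mod:
  fixes L :: "('a \<Rightarrow> int) \<Rightarrow> 'b \<Rightarrow> int" and p :: nat
  assumes "finite I" "finite K" "card K < card I" "p \<ge> 2"
    and L: "\<And>u v k. L (\<lambda>i. u i - v i) k = L u k - L v k"
  shows "\<exists>w. (\<exists>i\<in>I. \<not> int p dvd w i) \<and> (\<forall>i. i \<notin> I \<longrightarrow> w i = 0) \<and> (\<forall>k\<in>K. int p dvd L w k)"
proof -
  let ?r = "{0..<int p}"
  define X where "X = PiE I (\<lambda>_. ?r)"
  define Z where "Z u = (\<lambda>i. if i \<in> I then u i else 0)" for u :: "'a \<Rightarrow> int"
  define F where "F u = restrict (\<lambda>k. L (Z u) k mod int p) K" for u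
  have cX: "card X = p ^ card I" using assms by (simp add: X_def card_PiE)
  have "F ` X \<subseteq> PiE K (\<lambda>_. ?r)" using assms by (auto simp: F_def)
  then have "card (F ` X) \<le> card (PiE K (\<lambda>_. ?r))"
    using assms by (intro card_mono finite_PiE) auto
  also have "\<dots> = p ^ card K" using assms by (simp add: card_PiE)
  also have "\<dots> < card X" using assms by (simp add: cX)
  finally have "\<not> inj_on F X" by (rule pigeonhole)
  then obtain u v where uv: "u \<in> X" "v \<in> X" "F u = F v" "u \<noteq> v" by (auto simp: inj_on_def)
  define w where "w i = Z u i - Z v i" for i
  obtain i where i: "i \<in> I" "u i \<noteq> v i" using uv by (metis X_def PiE_ext)
  have "u i \<in> ?r" "v i \<in> ?r" using uv i by (auto simp: X_def)
  then have "\<not> int p dvd w i"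
    using i dvd_imp_le_int[of "u i - v i" "int p"] by (auto simp: w_def Z_def)
  moreover have "int p dvd L w k" if "k \<in> K" for k
  proof -
    have "L (Z u) k mod int p = L (Z v) k mod int p" using fun_cong[OF uv(3), of k] that by (simp add: F_def)
    moreover have "L w k = L (Z u) k - L (Z v) k" unfolding w_def by (rule L)
    ultimately show ?thesis by (metis mod_eq_dvd_iff)
  qed
  ultimately show ?thesis using i by (intro exI[of _ w]) (auto simp: w_def Z_def)
qed

text \<open>Vanishing in F_p[X], expressed over the integers so that \<open>p\<close> can remain a
  variable instead of determining a type.\<close>

definition pdvd :: "nat \<Rightarrow> int poly \<Rightarrow> bool" where
  "pdvd p F \<longleftrightarrow> (\<forall>i. int p dvd coeff F i)"

lemma pdvd_iff: "pdvd p F \<longleftrightarrow> [:int p:] dvd F"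
  by (simp add: pdvd_def const_poly_dvd_iff)

lemma pdvd_add: "pdvd p F \<Longrightarrow> pdvd p G \<Longrightarrow> pdvd p (F + G)"
  and pdvd_diff: "pdvd p F \<Longrightarrow> pdvd p G \<Longrightarrow> pdvd p (F - G)"
  and pdvd_mult: "pdvd p F \<Longrightarrow> pdvd p (F * G)"
  and pdvd_mult2: "pdvd p F \<Longrightarrow> pdvd p (G * F)"
  and pdvd_0: "pdvd p 0"
  by (auto simp: pdvd_iff)

lemma pdvd_sum: "(\<And>i. i \<in> A \<Longrightarrow> pdvd p (F i)) \<Longrightarrow> pdvd p (sum F A)"
  unfolding pdvd_iff by (rule dvd_sum)

text \<open>Membership in the ideal generated by \<open>p\<close> and \<open>X\<^sup>p\<close>.\<close>

definition low :: "nat \<Rightarrow> int poly \<Rightarrow> bool" where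
  "low p F \<longleftrightarrow> (\<forall>i<p. int p dvd coeff F i)"

lemma low_add: "low p F \<Longrightarrow> low p G \<Longrightarrow> low p (F + G)"
  and low_diff: "low p F \<Longrightarrow> low p G \<Longrightarrow> low p (F - G)"
  by (auto simp: low_def)

lemma low_mult: "low p F \<Longrightarrow> low p (F * G)"
  by (auto simp: low_def coeff_mult intro!: dvd_sum)

lemma pdvd_imp_low: "pdvd p F \<Longrightarrow> low p F"
  by (auto simp: low_def pdvd_def)

lemma low_monom: "low p (monom 1 p)"
  by (auto simp: low_def)

lemma low_imp_pdvd: "low p F \<Longrightarrow> degree F < p \<Longrightarrow> pdvd p F"
  unfolding low_def pdvd_def by (metis coeff_eq_0 dvd_0_right le_less_trans not_le)

text \<open>The reduction of \<open>F\<close> modulo \<open>p\<close> is nonzero of degree \<open>n\<close>.\<close>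

definition topidx :: "nat \<Rightarrow> int poly \<Rightarrow> nat \<Rightarrow> bool" where
  "topidx p F n \<longleftrightarrow> \<not> int p dvd coeff F n \<and> (\<forall>i>n. int p dvd coeff F i)"

lemma topidx_unique: "topidx p F n \<Longrightarrow> topidx p F m \<Longrightarrow> n = m"
  by (auto simp: topidx_def) (metis linorder_neqE_nat)

lemma topidx_exists:
  assumes "\<not> pdvd p F" shows "\<exists>n \<le> degree F. topidx p F n"
proof -
  define S where "S = {i. \<not> int p dvd coeff F i}"
  have sub: "S \<subseteq> {..degree F}" by (auto simp: S_def intro: le_degree)
  have ne: "S \<noteq> {}" using assms by (auto simp: S_def pdvd_def)
  have fin: "finite S" using sub finite_subset by blast
  have "topidx p F (Max S)"
    using Max_in[OF fin ne] Max_ge[OF fin] by (fastforce simp: topidx_def S_def)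
  then show ?thesis using Max_in[OF fin ne] sub by blast
qed

text \<open>Every other product contributing to the top coefficient has a factor divisible by
  \<open>p\<close>; the remaining one is a unit modulo \<open>p\<close> because \<open>p\<close> is
  prime.\<close>

lemma topidx_mult:
  assumes p: "prime p" and F: "topidx p F n" and G: "topidx p G m"
  shows "topidx p (F * G) (n + m)"
  unfolding topidx_def
proof safe
  assume a: "int p dvd coeff (F * G) (n + m)"
  have "coeff (F * G) (n + m) = coeff F n * coeff G m + (\<Sum>i\<in>{..n+m} - {n}. coeff F i * coeff G (n + m - i))"
    unfolding coeff_mult by (subst sum.remove[of _ n]) auto
  moreover have "int p dvd (\<Sum>i\<in>{..n+m} - {n}. coeff F i * coeff G (n + m - i))"
  proof (rule dvd_sum)
    fix i assume "i \<in> {..n+m} - {n}"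
    then have "i > n \<or> n + m - i > m" by auto
    then show "int p dvd coeff F i * coeff G (n + m - i)" using F G by (auto simp: topidx_def)
  qed
  ultimately have "int p dvd coeff F n * coeff G m" using a by (simp add: dvd_add_left_iff)
  then show False using p F G by (simp add: topidx_def prime_dvd_mult_iff)
next
  fix i assume "n + m < i"
  show "int p dvd coeff (F * G) i"
    unfolding coeff_mult
  proof (rule dvd_sum)
    fix j assume "j \<in> {..i}"
    then have "j > n \<or> i - j > m" using \<open>n + m < i\<close> by auto
    then show "int p dvd coeff F j * coeff G (i - j)" using F G by (auto simp: topidx_def)
  qed
qed

lemma pdvd_mult_iff:
  assumes "prime p" shows "pdvd p (F * G) \<longleftrightarrow> pdvd p F \<or> pdvd p G"
proof
  show "pdvd p F \<or> pdvd p G" if "pdvd p (F * G)"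
    using topidx_mult[OF assms] topidx_exists that by (meson pdvd_def topidx_def)
qed (auto intro: pdvd_mult pdvd_mult2)

lemma root_mod_factor:
  assumes "int p dvd poly F s" shows "\<exists>G. pdvd p (F - [:-s, 1:] * G)"
proof -
  have "F - [:-s,1:] * synthetic_div F s = [:poly F s:]"
    using synthetic_div_correct'[of s F] by (metis add_diff_cancel_left')
  moreover have "pdvd p [:poly F s:]" using assms by (simp add: pdvd_iff)
  ultimately show ?thesis by metis
qed

lemma pdvd_linear: assumes "p \<ge> 2" shows "\<not> pdvd p [:-s, 1:]"
  using assms by (auto simp: pdvd_def intro!: exI[of _ 1])

lemma pdvd_poly: "pdvd p F \<Longrightarrow> int p dvd poly F s"
  by (auto simp: pdvd_iff elim!: dvdE)

text \<open>\<open>U\<close> is a unit at \<open>s\<close>. Evaluating at \<open>s\<close> shows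
  that \<open>F\<close> vanishes there, a factor X - s is cancelled from both terms, and the
  induction on \<open>M\<close> continues with the quotient.\<close>

lemma multiplicity_cancel:
  assumes p: "prime p" and U: "\<not> int p dvd poly U s"
  shows "pdvd p (F * U - [:-s, 1:] ^ M * W) \<Longrightarrow> \<exists>G. pdvd p (F - [:-s, 1:] ^ M * G)"
proof (induction M arbitrary: F)
  case 0
  show ?case by (intro exI[of _ F]) (simp add: pdvd_0)
next
  case (Suc M)
  have "int p dvd poly F s * poly U s" using pdvd_poly[OF Suc.prems, of s] by simp
  then have "int p dvd poly F s" using U p by (simp add: prime_dvd_mult_iff)
  then obtain F1 where F1: "pdvd p (F - [:-s,1:] * F1)" using root_mod_factor by blast
  have "[:-s,1:] * (F1 * U - [:-s,1:] ^ M * W) = (F * U - [:-s,1:] ^ Suc M * W) - (F - [:-s,1:] * F1) * U"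
    by (simp add: algebra_simps)
  then have "pdvd p ([:-s,1:] * (F1 * U - [:-s,1:] ^ M * W))"
    using Suc.prems F1 by (metis pdvd_diff pdvd_mult)
  then have "pdvd p (F1 * U - [:-s,1:] ^ M * W)"
    using p pdvd_linear prime_ge_2_nat pdvd_mult_iff by blast
  then obtain G where G: "pdvd p (F1 - [:-s,1:] ^ M * G)" using Suc.IH by blast
  have "F - [:-s,1:] ^ Suc M * G = (F - [:-s,1:] * F1) + [:-s,1:] * (F1 - [:-s,1:] ^ M * G)"
    by (simp add: algebra_simps)
  then show ?case using F1 G by (metis pdvd_add pdvd_mult2)
qed

text \<open>The powers (X - s)^M for distinct residues are pairwise coprime modulo \<open>p\<close>,
  so their product divides \<open>R\<close>; it is monic of degree \<open>M * card S\<close>, which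
  therefore cannot exceed the degree of \<open>R\<close>.\<close>

lemma card_multiple_roots:
  assumes p: "prime p" and "finite S" and "S \<subseteq> {0..<int p}"
    and R: "\<And>s. s \<in> S \<Longrightarrow> \<exists>G. pdvd p (R - [:-s, 1:] ^ M * G)"
    and nz: "\<not> pdvd p R"
  shows "M * card S \<le> degree R"
proof -
  have "\<exists>G. pdvd p (R - (\<Prod>s\<in>S. [:-s, 1:] ^ M) * G)"
    using assms(2,3) R
  proof (induction S rule: finite_induct)
    case empty
    show ?case by (intro exI[of _ R]) (simp add: pdvd_0)
  next
    case (insert s S)
    define U where "U = (\<Prod>t\<in>S. [:-t, 1:] ^ M)"
    from insert obtain G where G: "pdvd p (R - U * G)" by (auto simp: U_def)
    obtain W where W: "pdvd p (R - [:-s, 1:] ^ M * W)" using insert.prems by auto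
    have "pdvd p ((R - [:-s, 1:] ^ M * W) - (R - U * G))" using G W by (rule pdvd_diff[rotated])
    then have 1: "pdvd p (G * U - [:-s, 1:] ^ M * W)" by (simp add: mult.commute)
    have "\<not> int p dvd poly U s"
    proof
      assume "int p dvd poly U s"
      then have "int p dvd (\<Prod>t\<in>S. (s - t) ^ M)" by (simp add: U_def poly_prod)
      then obtain t where t: "t \<in> S" "int p dvd (s - t) ^ M"
        using p insert(1) by (auto simp: prime_dvd_prod_iff)
      then have "int p dvd s - t" using p prime_dvd_power by (metis prime_nat_int_transfer)
      moreover have "s \<in> {0..<int p}" "t \<in> {0..<int p}" "s \<noteq> t" using insert t by auto
      ultimately show False using dvd_imp_le_int[of "s - t" "int p"] by auto
    qed
    from multiplicity_cancel[OF p this 1] obtain H where H: "pdvd p (G - [:-s, 1:] ^ M * H)" by blast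
    have "R - (\<Prod>t\<in>insert s S. [:-t, 1:] ^ M) * H = (R - U * G) + U * (G - [:-s, 1:] ^ M * H)"
      using insert(1,2) by (simp add: U_def algebra_simps)
    then show ?case using G H by (metis pdvd_add pdvd_mult2)
  qed
  then obtain G where G: "pdvd p (R - (\<Prod>s\<in>S. [:-s, 1:] ^ M) * G)" by blast
  have top1: "topidx p (\<Prod>s\<in>S. [:-s, 1:] ^ M) (M * card S)"
    using assms(2)
  proof (induction S rule: finite_induct)
    case empty
    show ?case using prime_ge_2_nat[OF p] by (auto simp: topidx_def)
  next
    case (insert s S)
    have "topidx p ([:-s, 1:] ^ k) k" for k
    proof (induction k)
      case 0 show ?case using prime_ge_2_nat[OF p] by (auto simp: topidx_def)
    next
      case (Suc k)
      have "topidx p [:-s,1:] 1" using prime_ge_2_nat[OF p]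
        by (auto simp: topidx_def coeff_pCons split: nat.split)
      from topidx_mult[OF p this Suc] show ?case by simp
    qed
    from topidx_mult[OF p this insert.IH] show ?case using insert by (simp add: algebra_simps)
  qed
  have "\<not> pdvd p G" using G nz pdvd_add[OF G, of "(\<Prod>s\<in>S. [:-s, 1:] ^ M) * G"] pdvd_mult2 by auto
  then obtain n where n: "topidx p G n" using topidx_exists by blast
  have t: "topidx p ((\<Prod>s\<in>S. [:-s, 1:] ^ M) * G) (M * card S + n)" by (rule topidx_mult[OF p top1 n])
  have "\<not> int p dvd coeff R (M * card S + n)"
  proof
    assume a: "int p dvd coeff R (M * card S + n)"
    have "int p dvd coeff (R - (\<Prod>s\<in>S. [:-s, 1:] ^ M) * G) (M * card S + n)"
      using G by (auto simp: pdvd_def)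
    with a have "int p dvd coeff ((\<Prod>s\<in>S. [:-s, 1:] ^ M) * G) (M * card S + n)"
      unfolding coeff_diff by (rule dvd_diff_right_iff[THEN iffD1])
    then show False using t by (simp add: topidx_def)
  qed
  then have "coeff R (M * card S + n) \<noteq> 0" by auto
  then show ?thesis using le_degree by fastforce
qed

section \<open>The Stepanov method for cubic polynomials\<close>

lemma pdvd_pderiv: "pdvd p F \<Longrightarrow> pdvd p (pderiv F)"
  by (auto simp: pdvd_def coeff_pderiv)

lemma pdvd_monom_1: "p \<ge> 2 \<Longrightarrow> \<not> pdvd p (monom 1 n)"
  by (auto simp: pdvd_def intro!: exI[of _ n])

lemma pdvd_smult: "int p dvd c \<Longrightarrow> pdvd p (smult c F)"
  by (auto simp: pdvd_def)

text \<open>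
  For \<open>g = f\<^bsup>(p - 1) / 2\<^esup>\<close> one has \<open>2 f g' = - f' g\<close> modulo \<open>p\<close>, so the derivation \<open>2 f d/dX\<close> maps
  \<open>h + g k\<close> to \<open>Delta f h + g Theta f k\<close>.
\<close>

definition Delta :: "int poly \<Rightarrow> int poly \<Rightarrow> int poly" where
  "Delta f F = 2 * f * pderiv F"

definition Theta :: "int poly \<Rightarrow> int poly \<Rightarrow> int poly" where
  "Theta f F = 2 * f * pderiv F - pderiv f * F"

lemma Delta_diff: "Delta f (F - G) = Delta f F - Delta f G"
  by (simp add: Delta_def pderiv_diff algebra_simps)

lemma Delta_sum: "Delta f (sum F A) = (\<Sum>i\<in>A. Delta f (F i))"
  by (induction A rule: infinite_finite_induct) (simp_all add: Delta_def pderiv_add algebra_simps)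

lemma Theta_diff: "Theta f (F - G) = Theta f F - Theta f G"
  by (simp add: Theta_def pderiv_diff algebra_simps)

lemma Delta_iter_diff: "(Delta f ^^ l) (F - G) = (Delta f ^^ l) F - (Delta f ^^ l) G"
  by (induction l) (simp_all add: Delta_diff)

lemma Theta_iter_diff: "(Theta f ^^ l) (F - G) = (Theta f ^^ l) F - (Theta f ^^ l) G"
  by (induction l) (simp_all add: Theta_diff)

lemma pdvd_Delta: "pdvd p F \<Longrightarrow> pdvd p (Delta f F)"
  unfolding Delta_def by (intro pdvd_mult2 pdvd_pderiv)

lemma degree_pderiv_mult_le:
  fixes F G :: "int poly"
  shows "degree (G * pderiv F) \<le> degree G + degree F - 1"
proof (cases "degree F = 0")
  case True
  then have "pderiv F = 0" by (simp add: pderiv_eq_0_iff)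
  then show ?thesis by simp
next
  case False
  have "degree (G * pderiv F) \<le> degree G + degree (pderiv F)" by (rule degree_mult_le)
  then show ?thesis using False by (simp add: degree_pderiv)
qed

lemma degree_two_mult_le: "degree (2 * F :: int poly) \<le> degree F"
  using degree_smult_le[of 2 F] by (simp add: numeral_poly)

lemma degree_Delta: "degree f \<le> 3 \<Longrightarrow> degree (Delta f F) \<le> degree F + 2"
  unfolding Delta_def using degree_pderiv_mult_le[of "2 * f" F] degree_two_mult_le[of f] by linarith

lemma degree_Theta:
  assumes "degree f \<le> 3" shows "degree (Theta f F) \<le> degree F + 2"
proof -
  have "degree (pderiv f * F) \<le> degree F + 2"
    using degree_pderiv_mult_le[of F f] assms by (simp add: mult.commute)
  then show ?thesis using degree_Delta[OF assms, of F] unfolding Theta_def Delta_def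
    by (intro degree_diff_le) auto
qed

lemma degree_Delta_iter: "degree f \<le> 3 \<Longrightarrow> degree ((Delta f ^^ l) F) \<le> degree F + 2 * l"
proof (induction l)
  case (Suc l) then show ?case using degree_Delta[of f "(Delta f ^^ l) F"] by simp
qed simp

lemma degree_Theta_iter: "degree f \<le> 3 \<Longrightarrow> degree ((Theta f ^^ l) F) \<le> degree F + 2 * l"
proof (induction l)
  case (Suc l) then show ?case using degree_Theta[of f "(Theta f ^^ l) F"] by simp
qed simp

text \<open>Each application removes one factor X - s and contributes its current exponent times 2
  f(s); terms that retain a factor X - s vanish at \<open>s\<close>.\<close>

lemma poly_Delta_iter_power:
  "poly ((Delta f ^^ m) ([:-s, 1:] ^ m * G)) s = fact m * (2 * poly f s) ^ m * poly G s"
proof (induction m arbitrary: G)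
  case (Suc m)
  have "Delta f ([:-s, 1:] ^ Suc m * G)
      = [:-s, 1:] ^ m * (2 * f * (smult (int (Suc m)) G + [:-s, 1:] * pderiv G))"
    unfolding Delta_def pderiv_mult pderiv_power_Suc by (simp add: pderiv_pCons algebra_simps)
  then have "poly ((Delta f ^^ Suc m) ([:-s, 1:] ^ Suc m * G)) s =
     fact m * (2 * poly f s) ^ m * poly (2 * f * (smult (int (Suc m)) G + [:-s, 1:] * pderiv G)) s"
    unfolding funpow_Suc_right o_def using Suc.IH by simp
  then show ?case by (simp add: algebra_simps)
qed simp

lemma pdvd_Delta_iter: "pdvd p F \<Longrightarrow> pdvd p ((Delta f ^^ l) F)"
  by (induction l) (auto intro: pdvd_Delta)

text \<open>The iterates give the successive coefficients of the expansion at \<open>s\<close> up to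
  the factor m! (2 f(s))^m. This is invertible because \<open>M \<le> p\<close> keeps
  \<open>p\<close> out of the factorials with m < M.\<close>

lemma multiple_root_of_Delta_iter:
  assumes p: "prime p" and M: "M \<le> p" and f: "\<not> int p dvd 2 * poly f s"
    and R: "\<And>l. l < M \<Longrightarrow> int p dvd poly ((Delta f ^^ l) R) s"
  shows "\<exists>G. pdvd p (R - [:-s, 1:] ^ M * G)"
proof -
  have "m \<le> M \<Longrightarrow> \<exists>G. pdvd p (R - [:-s, 1:] ^ m * G)" for m
  proof (induction m)
    case 0
    show ?case by (intro exI[of _ R]) (simp add: pdvd_0)
  next
    case (Suc m)
    then obtain G where G: "pdvd p (R - [:-s, 1:] ^ m * G)" by auto
    have "int p dvd poly ((Delta f ^^ m) R - (Delta f ^^ m) ([:-s, 1:] ^ m * G)) s"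
      using pdvd_poly[OF pdvd_Delta_iter[OF G]] by (simp add: Delta_iter_diff)
    moreover have "int p dvd poly ((Delta f ^^ m) R) s" using R Suc by simp
    ultimately have "int p dvd fact m * (2 * poly f s) ^ m * poly G s"
      unfolding poly_diff poly_Delta_iter_power by (simp add: dvd_diff_right_iff)
    moreover have "\<not> int p dvd fact m"
    proof -
      have "\<not> p dvd fact m" using p Suc.prems M by (simp add: prime_dvd_fact_iff)
      then show ?thesis by (metis of_nat_dvd_iff of_nat_fact)
    qed
    moreover have "\<not> int p dvd (2 * poly f s) ^ m"
      using f p prime_dvd_power by (metis prime_nat_int_transfer)
    ultimately have "int p dvd poly G s" using p by (simp add: prime_dvd_mult_iff)
    then obtain H where H: "pdvd p (G - [:-s, 1:] * H)" using root_mod_factor by blast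
    have "R - [:-s, 1:] ^ Suc m * H = (R - [:-s, 1:] ^ m * G) + [:-s, 1:] ^ m * (G - [:-s, 1:] * H)"
      by (simp add: algebra_simps)
    then show ?case using G H by (metis pdvd_add pdvd_mult2)
  qed
  then show ?thesis by blast
qed

text \<open>With f = f(0) + X q the binomial theorem leaves only the two extreme terms modulo
  \<open>p\<close>, and (X q)^p is a multiple of X^p.\<close>

lemma frobenius_low:
  assumes p: "prime p"
  shows "low p (f ^ p - [:poly f 0 ^ p:])"
proof -
  obtain q where q: "f = [:poly f 0:] + monom 1 1 * q"
  proof
    show "f = [:poly f 0:] + monom 1 1 * synthetic_div f 0"
      using synthetic_div_correct'[of 0 f] by (simp add: monom_altdef)
  qed
  define u v where "u = [:poly f 0:]" and "v = monom 1 1 * q"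
  have "f ^ p = (\<Sum>k\<le>p. of_nat (p choose k) * u ^ k * v ^ (p - k))"
    unfolding q[folded u_def v_def] by (rule binomial_ring)
  also have "{..p} = insert 0 (insert p {0<..<p})" using prime_gt_0_nat[OF p] by auto
  also have "(\<Sum>k\<in>insert 0 (insert p {0<..<p}). of_nat (p choose k) * u ^ k * v ^ (p - k))
     = v ^ p + u ^ p + (\<Sum>k\<in>{0<..<p}. of_nat (p choose k) * u ^ k * v ^ (p - k))"
    using prime_gt_0_nat[OF p] by simp
  finally have "f ^ p - [:poly f 0 ^ p:] = v ^ p + (\<Sum>k\<in>{0<..<p}. of_nat (p choose k) * u ^ k * v ^ (p - k))"
    by (simp add: u_def poly_const_pow)
  moreover have "low p (v ^ p)"
    unfolding v_def power_mult_distrib by (simp add: monom_power low_mult low_monom)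
  moreover have "pdvd p (\<Sum>k\<in>{0<..<p}. of_nat (p choose k) * u ^ k * v ^ (p - k))"
  proof (intro pdvd_sum pdvd_mult)
    fix k assume "k \<in> {0<..<p}"
    then have "p dvd p choose k" using p by (intro dvd_choose_prime) auto
    then have "int p dvd int (p choose k)" by simp
    then have "pdvd p (smult (int (p choose k)) 1)" by (rule pdvd_smult)
    then show "pdvd p (of_nat (p choose k))" by (simp add: of_nat_poly)
  qed
  ultimately show ?thesis by (simp add: low_add pdvd_imp_low)
qed

lemma fermat_power:
  assumes p: "prime p" and c: "\<not> int p dvd c" and k: "(p - 1) dvd k"
  shows "[c ^ k = 1] (mod int p)"
proof -
  have "coprime c (int p)" using p c by (metis coprime_commute prime_imp_coprime prime_nat_int_transfer)
  then have "[c ^ totient (nat (int p)) = 1] (mod int p)" using prime_gt_1_nat[OF p]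
    by (intro residues.euler_theorem) (auto simp: residues_def)
  then have 1: "[c ^ (p - 1) = 1] (mod int p)" using p by (simp add: totient_prime)
  from k obtain t where "k = (p - 1) * t" by (elim dvdE)
  then show ?thesis using cong_pow[OF 1, of t] by (simp add: power_mult)
qed

text \<open>Singular cubics are included: the auxiliary polynomial is nonzero because the degree is
  odd and f(0) is a unit modulo \<open>p\<close>. The latter is arranged in
  \<open>weak_hasse\<close> by translating the variable.\<close>

locale stepanov =
  fixes p :: nat and f :: "int poly"
  assumes p: "prime p" and podd: "odd p"
    and fdeg: "degree f = 3" and flead: "lead_coeff f = 1" and f0: "\<not> int p dvd poly f 0"
begin

definition e where "e = (p - 1) div 2"
definition g where "g = f ^ e"

lemma p2e: "p = 2 * e + 1" using podd by (auto simp: e_def elim!: oddE)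

lemma smult_p: "smult (int p) F = smult (2 * int e) F + F"
proof -
  have "int p = 2 * int e + 1" using p2e by linarith
  then have "smult (int p) F = smult (2 * int e + 1) F" by (rule arg_cong)
  then show ?thesis by (simp add: smult_add_left)
qed

lemma p_ge: "p \<ge> 2" using p by (rule prime_ge_2_nat)

lemma e_pos: "e > 0" using p_ge p2e by simp

lemma topidx_f: "topidx p f 3"
  using fdeg flead p_ge by (auto simp: topidx_def coeff_eq_0)

text \<open>Since g = f^e and 2 e + 1 = p, the polynomial equals p f' f^e.\<close>

lemma g_deriv: "pdvd p (2 * f * pderiv g + pderiv f * g)"
proof -
  have "2 * f * pderiv g + pderiv f * g = smult (int p) (f ^ e * pderiv f)"
  proof -
    have "pderiv g = smult (int e) (f ^ (e - 1) * pderiv f)"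
      unfolding g_def pderiv_power by simp
    moreover have "f * f ^ (e - 1) = f ^ e" using e_pos by (cases e) auto
    ultimately have "2 * f * pderiv g = smult (2 * int e) (f ^ e * pderiv f)"
      by (simp add: numeral_poly mult.assoc[symmetric] mult.commute[of "int e"])
    then show ?thesis unfolding smult_p by (simp add: g_def mult.commute)
  qed
  then show ?thesis by (simp add: pdvd_smult)
qed

text \<open>Powers of X^p have derivative 0 modulo \<open>p\<close>, but on residues they take the
  values of powers of X. Hence the polynomial has large degree and many free coefficients, while its
  vanishing conditions have small degree.\<close>

definition aux where
  "aux J h k = (\<Sum>j<J. (h j + g * k j) * monom 1 (p * j))"

lemma Delta_aux:
  "pdvd p (Delta f (aux J h k) - aux J (\<lambda>j. Delta f (h j)) (\<lambda>j. Theta f (k j)))"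
proof -
  have "pdvd p (Delta f ((h j + g * k j) * monom 1 (p * j))
                  - (Delta f (h j) + g * Theta f (k j)) * monom 1 (p * j))" for j
  proof -
    have "Delta f ((h j + g * k j) * monom 1 (p * j)) - (Delta f (h j) + g * Theta f (k j)) * monom 1 (p * j)
       = (2 * f * pderiv g + pderiv f * g) * (k j * monom 1 (p * j))
         + 2 * f * (h j + g * k j) * pderiv (monom 1 (p * j))"
      by (simp add: Delta_def Theta_def pderiv_mult pderiv_add algebra_simps)
    moreover have "pdvd p (pderiv (monom 1 (p * j)))"
      by (auto simp: pderiv_monom pdvd_def)
    ultimately show ?thesis using g_deriv by (simp add: pdvd_add pdvd_mult pdvd_mult2)
  qed
  then show ?thesis unfolding aux_def Delta_sum sum_subtractf[symmetric] by (intro pdvd_sum)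
qed

lemma Delta_iter_aux:
  "pdvd p ((Delta f ^^ l) (aux J h k) - aux J (\<lambda>j. (Delta f ^^ l) (h j)) (\<lambda>j. (Theta f ^^ l) (k j)))"
proof (induction l)
  case (Suc l)
  let ?A = "aux J (\<lambda>j. (Delta f ^^ l) (h j)) (\<lambda>j. (Theta f ^^ l) (k j))"
  have "pdvd p (Delta f ((Delta f ^^ l) (aux J h k)) - Delta f ?A)"
    using pdvd_Delta[OF Suc.IH] by (simp add: Delta_diff)
  from pdvd_add[OF this Delta_aux[of J "\<lambda>j. (Delta f ^^ l) (h j)" "\<lambda>j. (Theta f ^^ l) (k j)"]]
  show ?case by simp
qed (simp add: pdvd_0)

text \<open>
  If the lowest nonzero block satisfies \<open>h + g k = 0\<close> modulo \<open>(p, X\<^sup>p)\<close>, then \<open>h\<^sup>2 f = f(0)\<^sup>p k\<^sup>2\<close> there, and this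
  holds modulo \<open>p\<close> because the degrees are below \<open>p\<close>; the parities of the degrees differ.
\<close>

lemma aux_nonzero:
  assumes D: "2 * D + 1 < p" and D0: "D > 0"
    and deg: "\<And>j. degree (h j) < D" "\<And>j. degree (k j) < D"
    and ex: "\<exists>j<J. \<not> (pdvd p (h j) \<and> pdvd p (k j))"
  shows "\<not> pdvd p (aux J h k)"
proof
  assume R: "pdvd p (aux J h k)"
  define j0 where "j0 = (LEAST j. j < J \<and> \<not> (pdvd p (h j) \<and> pdvd p (k j)))"
  have j0: "j0 < J" "\<not> (pdvd p (h j0) \<and> pdvd p (k j0))"
    using LeastI_ex[of "\<lambda>j. j < J \<and> \<not> (pdvd p (h j) \<and> pdvd p (k j))"] ex by (auto simp: j0_def)
  have less: "pdvd p (h j) \<and> pdvd p (k j)" if "j < j0" for j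
    using not_less_Least[OF that[unfolded j0_def]] that j0(1) by auto
  define t where "t j = (h j + g * k j) * monom 1 (p * j)" for j
  define T where "T = (\<Sum>j\<in>{j0<..<J}. (h j + g * k j) * monom 1 (p * (j - j0)))"
  have "aux J h k = (\<Sum>j<j0. t j) + (\<Sum>j\<in>{j0..<J}. t j)"
    unfolding aux_def t_def[symmetric] using j0(1)
    by (metis atLeast0LessThan less_imp_le sum.atLeastLessThan_concat zero_le)
  also have "(\<Sum>j\<in>{j0..<J}. t j) = t j0 + (\<Sum>j\<in>{j0<..<J}. t j)"
  proof -
    have "{j0..<J} = insert j0 {j0<..<J}" using j0(1) by auto
    then show ?thesis by simp
  qed
  also have "(\<Sum>j\<in>{j0<..<J}. t j) = monom 1 (p * j0) * T"
    unfolding T_def sum_distrib_left t_def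
  proof (rule sum.cong[OF refl])
    fix j assume "j \<in> {j0<..<J}"
    then have "p * j = p * j0 + p * (j - j0)" by (auto simp: algebra_simps)
    then have "monom 1 (p * j) = monom 1 (p * j0) * (monom 1 (p * (j - j0)) :: int poly)"
      by (simp add: mult_monom)
    then show "(h j + g * k j) * monom 1 (p * j) = monom 1 (p * j0) * ((h j + g * k j) * monom 1 (p * (j - j0)))"
      by (simp add: mult_ac)
  qed
  finally have dec: "aux J h k = (\<Sum>j<j0. t j) + monom 1 (p * j0) * (h j0 + g * k j0 + T)"
    by (simp add: t_def algebra_simps)
  have "pdvd p (\<Sum>j<j0. t j)"
    unfolding t_def by (intro pdvd_sum pdvd_mult pdvd_add pdvd_mult2) (auto simp: less)
  from pdvd_diff[OF R this] have "pdvd p (monom 1 (p * j0) * (h j0 + g * k j0 + T))"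
    unfolding dec by simp
  then have z: "pdvd p (h j0 + g * k j0 + T)"
    using p p_ge pdvd_monom_1 pdvd_mult_iff by blast
  have "low p T"
  proof -
    have "T = monom 1 p * (\<Sum>j\<in>{j0<..<J}. (h j + g * k j) * monom 1 (p * (j - j0 - 1)))"
      unfolding T_def sum_distrib_left
    proof (rule sum.cong[OF refl])
      fix j assume "j \<in> {j0<..<J}"
      then have "p * (j - j0) = p + p * (j - j0 - 1)" by (cases "j - j0") auto
      then have "monom 1 (p * (j - j0)) = monom 1 p * (monom 1 (p * (j - j0 - 1)) :: int poly)"
        by (simp add: mult_monom)
      then show "(h j + g * k j) * monom 1 (p * (j - j0)) = monom 1 p * ((h j + g * k j) * monom 1 (p * (j - j0 - 1)))"
        by (simp add: mult_ac)
    qed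
    then show ?thesis by (simp add: low_mult low_monom)
  qed
  from low_diff[OF pdvd_imp_low[OF z] this] have low: "low p (h j0 + g * k j0)" by simp
  define c where "c = poly f 0 ^ p"
  have gf: "g * g * f = f ^ p"
  proof -
    have "g * g * f = f ^ (2 * e + 1)" by (simp add: g_def power_add mult_2)
    then show ?thesis using p2e by argo
  qed
  have "h j0 * h j0 * f - [:c:] * (k j0 * k j0)
      = (h j0 + g * k j0) * ((h j0 - g * k j0) * f) + (f ^ p - [:c:]) * (k j0 * k j0)"
    unfolding gf[symmetric] by (simp only: algebra_simps)
  moreover have "low p \<dots>"
    unfolding c_def by (rule low_add[OF low_mult[OF low] low_mult[OF frobenius_low[OF p, of f]]])
  ultimately have lw: "low p (h j0 * h j0 * f - [:c:] * (k j0 * k j0))" by simp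
  \<comment> \<open>The degree is at most 2 (D - 1) + 3 = 2 D + 1, which explains the bound imposed
    on \<open>D\<close>.\<close>
  have "degree (h j0 * h j0 * f) \<le> degree (h j0) + degree (h j0) + 3"
    using degree_mult_le[of "h j0 * h j0" f] degree_mult_le[of "h j0" "h j0"] fdeg by simp
  also have "\<dots> < p" using deg(1)[of j0] D by simp
  finally have d1: "degree (h j0 * h j0 * f) < p" .
  have "degree ([:c:] * (k j0 * k j0)) \<le> degree (k j0) + degree (k j0)"
    using degree_mult_le[of "[:c:]" "k j0 * k j0"] degree_mult_le[of "k j0" "k j0"] by simp
  also have "\<dots> < p" using deg(2)[of j0] D by simp
  finally have "degree (h j0 * h j0 * f - [:c:] * (k j0 * k j0)) < p"
    using d1 by (rule degree_diff_less[rotated])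
  then have eq: "pdvd p (h j0 * h j0 * f - [:c:] * (k j0 * k j0))" using lw low_imp_pdvd by blast
  have nc: "\<not> int p dvd c" unfolding c_def using f0 p prime_dvd_power by (metis prime_nat_int_transfer)
  then have tc: "topidx p [:c:] 0" by (auto simp: topidx_def coeff_pCons split: nat.split)
  have nf: "\<not> pdvd p f" using topidx_f by (auto simp: pdvd_def topidx_def)
  have nc': "\<not> pdvd p [:c:]" using tc unfolding pdvd_def topidx_def by blast
  show False
  proof (cases "pdvd p (h j0) \<or> pdvd p (k j0)")
    case True
    \<comment> \<open>As \<open>f\<close> and \<open>c\<close> are nonzero modulo \<open>p\<close>,
      the identity makes both \<open>h j0\<close> and \<open>k j0\<close> vanish, against the choice
      of \<open>j0\<close>.\<close>
    have iff: "pdvd p (h j0 * h j0 * f) \<longleftrightarrow> pdvd p ([:c:] * (k j0 * k j0))"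
      using eq pdvd_add[OF eq, of "[:c:] * (k j0 * k j0)"] pdvd_diff[OF _ eq, of "h j0 * h j0 * f"] by auto
    then show False using True j0(2) nf nc' unfolding pdvd_mult_iff[OF p] by blast
  next
    case False
    then obtain n m where nm: "topidx p (h j0) n" "topidx p (k j0) m" using topidx_exists by blast
    have 1: "topidx p (h j0 * h j0 * f) (n + n + 3)" using nm topidx_f by (intro topidx_mult p)
    have 2: "topidx p ([:c:] * (k j0 * k j0)) (0 + (m + m))" using nm tc by (intro topidx_mult p)
    have "int p dvd coeff (h j0 * h j0 * f) i \<longleftrightarrow> int p dvd coeff ([:c:] * (k j0 * k j0)) i" for i
    proof -
      have "int p dvd coeff (h j0 * h j0 * f) i - coeff ([:c:] * (k j0 * k j0)) i"
        using eq unfolding pdvd_def coeff_diff by blast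
      then show ?thesis using dvd_diff_right_iff dvd_diff_left_iff by blast
    qed
    then have "topidx p ([:c:] * (k j0 * k j0)) (n + n + 3)" using 1 unfolding topidx_def by blast
    from topidx_unique[OF this 2] show False by presburger
  qed
qed

lemma degree_aux:
  assumes deg: "\<And>j. degree (h j) < D" "\<And>j. degree (k j) < D" "D > 0"
  shows "degree (aux J h k) < D + 3 * e + p * J"
proof -
  have "degree ((h j + g * k j) * monom 1 (p * j)) \<le> D - 1 + 3 * e + p * J" if "j < J" for j
  proof -
    have "degree g \<le> 3 * e" unfolding g_def using degree_power_le[of f e] fdeg by simp
    then have "degree (g * k j) \<le> 3 * e + (D - 1)"
      using degree_mult_le[of g "k j"] deg(2)[of j] by linarith
    moreover have "degree (h j) \<le> 3 * e + (D - 1)" using deg(1)[of j] by linarith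
    ultimately have "degree (h j + g * k j) \<le> 3 * e + (D - 1)" by (rule degree_add_le[rotated])
    moreover have "degree (monom (1::int) (p * j)) \<le> p * J"
      using that by (simp add: degree_monom_eq)
    ultimately show ?thesis using degree_mult_le[of "h j + g * k j" "monom 1 (p * j)"] by linarith
  qed
  then have "degree (aux J h k) \<le> D - 1 + 3 * e + p * J"
    unfolding aux_def by (intro degree_sum_le) auto
  then show ?thesis using deg(3) by linarith
qed

text \<open>By Euler's criterion the sets for a = 1 and a = -1 consist of the points where
  \<open>f\<close> takes nonzero square and nonsquare values.\<close>

definition level :: "int \<Rightarrow> int set" where
  "level a = {s \<in> {0..<int p}. \<not> int p dvd poly f s \<and> [poly g s = a] (mod int p)}"

lemma pow_p_cong: "[s ^ (p * j) = s ^ j] (mod int p)"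
proof -
  have "[s ^ p = s] (mod int p)"
  proof (cases "int p dvd s")
    case True
    then show ?thesis using p_ge
      by (metis cong_0_iff cong_sym cong_trans dvd_power_same dvd_trans dvd_power not_numeral_le_zero gr0I dvd_mult2 power_eq_if)
  next
    case False
    then have "[s ^ (p - 1) = 1] (mod int p)" by (rule fermat_power[OF p _ dvd_refl])
    then have "[s ^ (p - 1) * s = 1 * s] (mod int p)" by (rule cong_scalar_right)
    then show ?thesis using p_ge by (metis Suc_diff_1 gr0I lambda_one not_numeral_le_zero power_Suc2)
  qed
  then have "[(s ^ p) ^ j = s ^ j] (mod int p)" by (rule cong_pow)
  then show ?thesis by (simp add: power_mult)
qed

text \<open>
  On the level set the polynomials \<open>g\<close> and \<open>X\<^sup>p\<close> take the values \<open>a\<close> and \<open>X\<close>, so an iterated derivative of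
  the auxiliary polynomial is there given by a polynomial of much smaller degree.
\<close>

definition interp where
  "interp a J h k l = (\<Sum>j<J. ((Delta f ^^ l) (h j) + smult a ((Theta f ^^ l) (k j))) * monom 1 j)"

lemma level_multiple_root:
  assumes s: "s \<in> level a" and M: "M \<le> p" and p3: "p > 2"
    and zero: "\<And>l. l < M \<Longrightarrow> pdvd p (interp a J h k l)"
  shows "\<exists>G. pdvd p (aux J h k - [:-s, 1:] ^ M * G)"
proof (rule multiple_root_of_Delta_iter[OF p M, where f = f])
  have "\<not> int p dvd 2" using p3 by (auto dest!: zdvd_imp_le)
  then show "\<not> int p dvd 2 * poly f s" using s p by (auto simp: level_def prime_dvd_mult_iff)
next
  fix l assume l: "l < M"
  let ?h = "\<lambda>j. (Delta f ^^ l) (h j)" and ?k = "\<lambda>j. (Theta f ^^ l) (k j)"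
  have g: "[poly g s = a] (mod int p)" using s by (auto simp: level_def)
  have "[poly (aux J ?h ?k) s = (\<Sum>j<J. (poly (?h j) s + a * poly (?k j) s) * s ^ j)] (mod int p)"
    unfolding aux_def poly_sum poly_mult poly_add poly_monom mult_1_left
    by (intro cong_sum cong_mult cong_add cong_refl g pow_p_cong)
  also have "(\<Sum>j<J. (poly (?h j) s + a * poly (?k j) s) * s ^ j) = poly (interp a J h k l) s"
    by (simp add: interp_def poly_sum poly_monom)
  also have "[\<dots> = 0] (mod int p)" using pdvd_poly[OF zero[OF l], of s] by (simp add: cong_0_iff)
  finally have 1: "int p dvd poly (aux J ?h ?k) s" by (simp add: cong_0_iff)
  have "int p dvd poly ((Delta f ^^ l) (aux J h k)) s - poly (aux J ?h ?k) s"
    using pdvd_poly[OF Delta_iter_aux[of l J h k], of s] by simp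
  then show "int p dvd poly ((Delta f ^^ l) (aux J h k)) s" using 1 by (simp add: dvd_diff_left_iff)
qed

lemma degree_interp:
  assumes "\<And>j. degree (h j) < D" "\<And>j. degree (k j) < D" "D > 0" "l < M"
  shows "degree (interp a J h k l) < D + J + 2 * M"
proof -
  have "degree (((Delta f ^^ l) (h j) + smult a ((Theta f ^^ l) (k j))) * monom 1 j) \<le> D - 1 + J + 2 * M"
    if "j < J" for j
  proof -
    have "degree ((Delta f ^^ l) (h j)) \<le> D - 1 + 2 * l"
      using degree_Delta_iter[of f l "h j"] assms(1)[of j] fdeg by linarith
    moreover have "degree (smult a ((Theta f ^^ l) (k j))) \<le> D - 1 + 2 * l"
      using degree_Theta_iter[of f l "k j"] assms(2)[of j] fdeg degree_smult_le[of a "(Theta f ^^ l) (k j)"]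
      by linarith
    ultimately have "degree ((Delta f ^^ l) (h j) + smult a ((Theta f ^^ l) (k j))) \<le> D - 1 + 2 * l"
      by (rule degree_add_le)
    moreover have "degree (monom (1::int) j) = j" by (simp add: degree_monom_eq)
    ultimately show ?thesis
      using degree_mult_le[of "(Delta f ^^ l) (h j) + smult a ((Theta f ^^ l) (k j))" "monom 1 j"] that assms(4)
      by linarith
  qed
  then have "degree (interp a J h k l) \<le> D - 1 + J + 2 * M"
    unfolding interp_def by (intro degree_sum_le) auto
  then show ?thesis using assms(3) by linarith
qed

text \<open>There are 2 J D unknown coefficients, the \<open>bool\<close> index separating
  \<open>h\<close> from \<open>k\<close>, and the \<open>M\<close> polynomials \<open>interp\<close>
  have degree below D + J + 2 M. By \<open>num\<close> there are fewer equations than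
  unknowns.\<close>

lemma exists_auxiliary:
  assumes D: "D > 0" and num: "M * (D + J + 2 * M) < 2 * J * D"
  obtains h k where "\<And>j. degree (h j) < D" "\<And>j. degree (k j) < D"
    "\<exists>j<J. \<not> (pdvd p (h j) \<and> pdvd p (k j))" "\<And>l. l < M \<Longrightarrow> pdvd p (interp a J h k l)"
proof -
  define I where "I = (UNIV :: bool set) \<times> {..<J} \<times> {..<D}"
  define K where "K = {..<M} \<times> {..<D + J + 2 * M}"
  define co where "co b u j = (\<Sum>i<D. monom (u (b, j, i)) i)" for b and u :: "bool \<times> nat \<times> nat \<Rightarrow> int" and j
  define L where "L u = (\<lambda>(l, i). coeff (interp a J (co True u) (co False u) l) i)" for u
  have co_diff: "co b (\<lambda>i. u i - v i) j = co b u j - co b v j" for b u v j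
    by (simp add: co_def sum_subtractf diff_monom[symmetric])
  have "\<exists>w. (\<exists>i\<in>I. \<not> int p dvd w i) \<and> (\<forall>i. i \<notin> I \<longrightarrow> w i = 0) \<and> (\<forall>k\<in>K. int p dvd L w k)"
  proof (rule siegel_mod)
    show "card K < card I" using num by (simp add: I_def K_def card_cartesian_product mult_ac)
    show "L (\<lambda>i. u i - v i) k = L u k - L v k" for u v k
      by (simp add: L_def interp_def co_diff Delta_iter_diff Theta_iter_diff smult_diff_right
            algebra_simps sum_subtractf sum.distrib coeff_sum split: prod.splits)
  qed (auto simp: I_def K_def p_ge)
  then obtain w i where w: "i \<in> I" "\<not> int p dvd w i" "\<And>k. k \<in> K \<Longrightarrow> int p dvd L w k" by blast
  have deg: "degree (co b w j) < D" for b j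
  proof -
    have "degree (co b w j) \<le> D - 1" unfolding co_def
    proof (rule degree_sum_le)
      fix i assume "i \<in> {..<D}"
      then show "degree (monom (w (b, j, i)) i) \<le> D - 1"
        using degree_monom_le[of "w (b, j, i)" i] by simp
    qed simp
    then show ?thesis using D by linarith
  qed
  show thesis
  proof (rule that[OF deg deg])
    obtain b j n where i: "i = (b, j, n)" "j < J" "n < D" using w(1) by (auto simp: I_def)
    have "coeff (co b w j) n = w i"
      using i by (simp add: co_def coeff_sum)
    then have "\<not> pdvd p (co b w j)" using w(2) by (auto simp: pdvd_def intro!: exI[of _ n])
    then show "\<exists>j<J. \<not> (pdvd p (co True w j) \<and> pdvd p (co False w j))"
      using i(2) by (cases b) auto
  next
    fix l assume l: "l < M"
    show "pdvd p (interp a J (co True w) (co False w) l)"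
      unfolding pdvd_def
    proof
      fix n
      show "int p dvd coeff (interp a J (co True w) (co False w) l) n"
      proof (cases "n < D + J + 2 * M")
        case True
        then show ?thesis using w(3)[of "(l, n)"] l by (simp add: K_def L_def)
      next
        case False
        then have "degree (interp a J (co True w) (co False w) l) < n"
          using degree_interp[of "co True w" D "co False w" l M a J] deg D l by fastforce
        then show ?thesis by (simp add: coeff_eq_0)
      qed
    qed
  qed
qed

text \<open>With J = m + 3 and vanishing order 2 m the counting condition becomes 5 m^2 + 3 m < 3 D.
  The degree bound D + 3 e + p (m + 3) is at most p (m + 5), so the level set has at most p / 2 + 5
  p / (2 m) elements: an error of order sqrt p when m is of order sqrt p.\<close>

lemma card_level:
  assumes m: "m \<ge> 5" "4 * m\<^sup>2 \<le> p"
  shows "2 * m * card (level a) \<le> p * (m + 5)"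
proof -
  \<comment> \<open>The largest \<open>D\<close> with 2 D + 1 < p.\<close>
  define D where "D = e - 1"
  have p100: "100 \<le> p" using m power_mono[of 5 m 2] by simp
  have D: "p = 2 * D + 3" "D > 0" using p2e p100 by (auto simp: D_def)
  have "2 * m * (D + (m + 3) + 2 * (2 * m)) < 2 * (m + 3) * D"
  proof -
    have "m * m \<ge> 5 * m" using m by simp
    moreover have "4 * (m * m) \<le> 2 * D + 3" using m D by (simp add: power2_eq_square)
    ultimately have "5 * (m * m) + 3 * m < 3 * D" using m(1) by linarith
    then show ?thesis by (simp add: algebra_simps)
  qed
  from exists_auxiliary[OF D(2) this] obtain h k where hk:
    "\<And>j. degree (h j) < D" "\<And>j. degree (k j) < D"
    "\<exists>j<m + 3. \<not> (pdvd p (h j) \<and> pdvd p (k j))"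
    "\<And>l. l < 2 * m \<Longrightarrow> pdvd p (interp a (m + 3) h k l)" by metis
  have "2 * m \<le> p" using m by (metis power2_eq_square le_trans mult_le_mono mult_le_mono2 le_square numeral_le_iff semiring_norm(69) semiring_norm(71) semiring_norm(68) mult_le_mono1)
  moreover have "\<not> pdvd p (aux (m + 3) h k)"
    using D by (intro aux_nonzero[OF _ _ hk(1,2,3)]) auto
  ultimately have "2 * m * card (level a) \<le> degree (aux (m + 3) h k)"
  proof (intro card_multiple_roots[OF p] level_multiple_root)
    show "level a \<subseteq> {0..<int p}" by (auto simp: level_def)
    then show "finite (level a)" by (rule finite_subset) simp
  qed (use p100 hk(4) in auto)
  also have "\<dots> < D + 3 * e + p * (m + 3)" by (rule degree_aux[OF hk(1,2) D(2)])
  also have "\<dots> \<le> p * (m + 5)" using p2e by (simp add: D_def algebra_simps)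
  finally show ?thesis by simp
qed

end

section \<open>Traces of Weierstrass equations over a prime field\<close>

text \<open>The Legendre symbol for odd \<open>p\<close>, and 0 for \<open>p = 2\<close>.\<close>

definition nu :: "nat \<Rightarrow> int \<Rightarrow> int" where
  "nu p c = int (card {y \<in> {0..<int p}. [y\<^sup>2 = c] (mod int p)}) - 1"

text \<open>No restriction to nonsingular equations: the sums over all \<open>a, b\<close> below include the singular ones.\<close>

definition ftrace :: "nat \<Rightarrow> int \<Rightarrow> int \<Rightarrow> int" where
  "ftrace p a b = - (\<Sum>x\<in>{0..<int p}. nu p (x ^ 3 + a * x + b))"

lemma frob_trace_eq: "frob_trace (\<alpha>, \<beta>) p = ftrace p (rat_mod p \<alpha>) (rat_mod p \<beta>)"
proof -
  let ?c = "\<lambda>x. x ^ 3 + rat_mod p \<alpha> * x + rat_mod p \<beta>"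
  have "{(x, y) \<in> {0..<int p} \<times> {0..<int p}. [y\<^sup>2 = ?c x] (mod int p)}
      = Sigma {0..<int p} (\<lambda>x. {y \<in> {0..<int p}. [y\<^sup>2 = ?c x] (mod int p)})" by auto
  moreover have "card (Sigma {0..<int p} (\<lambda>x. {y \<in> {0..<int p}. [y\<^sup>2 = ?c x] (mod int p)}))
      = (\<Sum>x\<in>{0..<int p}. card {y \<in> {0..<int p}. [y\<^sup>2 = ?c x] (mod int p)})"
  proof (rule card_SigmaI)
    show "\<forall>a\<in>{0..<int p}. finite {y \<in> {0..<int p}. [y\<^sup>2 = ?c a] (mod int p)}"
      by (rule ballI, rule finite_subset[of _ "{0..<int p}"]) auto
  qed simp
  ultimately have "num_points (\<alpha>, \<beta>) p = 1 + (\<Sum>x\<in>{0..<int p}. card {y \<in> {0..<int p}. [y\<^sup>2 = ?c x] (mod int p)})"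
    unfolding num_points_def prod.case by presburger
  then show ?thesis
    by (simp add: frob_trace_def ftrace_def nu_def sum_subtractf)
qed

lemma nu_cong: "[c = d] (mod int p) \<Longrightarrow> nu p c = nu p d"
  by (simp add: nu_def cong_def)

lemma nu_mod [simp]: "nu p (c mod int p) = nu p c"
  by (rule nu_cong) simp

lemma residue_eqI:
  fixes x y :: int
  assumes "x \<in> {0..<m}" "y \<in> {0..<m}" "m dvd x - y" shows "x = y"
  using assms by (auto simp: mod_eq_dvd_iff[symmetric])

lemma bij_affine_mod:
  assumes p: "prime p" and u: "\<not> int p dvd u"
  shows "bij_betw (\<lambda>x. (u * x + s) mod int p) {0..<int p} {0..<int p}"
proof -
  have p0: "0 < int p" using prime_gt_0_nat[OF p] by simp
  have "inj_on (\<lambda>x. (u * x + s) mod int p) {0..<int p}"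
  proof (rule inj_onI)
    fix x y assume xy: "x \<in> {0..<int p}" "y \<in> {0..<int p}" "(u * x + s) mod int p = (u * y + s) mod int p"
    then have "int p dvd (u * x + s) - (u * y + s)" by (simp add: mod_eq_dvd_iff)
    then have "int p dvd u * (x - y)" by (simp add: algebra_simps)
    then have "int p dvd x - y" using p u by (simp add: prime_dvd_mult_iff)
    then show "x = y" using xy residue_eqI by blast
  qed
  moreover have "(\<lambda>x. (u * x + s) mod int p) ` {0..<int p} \<subseteq> {0..<int p}" using p0 by auto
  ultimately show ?thesis by (simp add: bij_betw_def endo_inj_surj)
qed

lemma sum_affine_mod:
  assumes "prime p" "\<not> int p dvd u" and F: "\<And>x. F (x mod int p) = F x"
  shows "(\<Sum>x\<in>{0..<int p}. F (u * x + s)) = (\<Sum>x\<in>{0..<int p}. F x)"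
proof -
  have "(\<Sum>x\<in>{0..<int p}. F (u * x + s)) = (\<Sum>x\<in>{0..<int p}. F ((u * x + s) mod int p))" by (simp add: F)
  also have "\<dots> = (\<Sum>x\<in>{0..<int p}. F x)"
    using bij_affine_mod[OF assms(1,2)] by (rule sum.reindex_bij_betw)
  finally show ?thesis .
qed

lemma sum_shift_mod:
  assumes "prime p" and F: "\<And>x. F (x mod int p) = F x"
  shows "(\<Sum>x\<in>{0..<int p}. F (x + s)) = (\<Sum>x\<in>{0..<int p}. F x)"
  using sum_affine_mod[of p 1 F s, OF assms(1) _ F] prime_ge_2_nat[OF assms(1)] by simp

text \<open>Each residue has exactly one square, so the fibres of squaring partition the
  \<open>p\<close> residues.\<close>

lemma sum_nu:
  assumes p: "prime p" shows "(\<Sum>c\<in>{0..<int p}. nu p c) = 0"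
proof -
  let ?r = "{0..<int p}"
  have p0: "0 < int p" using prime_gt_0_nat[OF p] by simp
  have "(\<Sum>c\<in>?r. card {y \<in> ?r. [y\<^sup>2 = c] (mod int p)}) = card (\<Union>c\<in>?r. {y \<in> ?r. [y\<^sup>2 = c] (mod int p)})"
  proof (rule card_UN_disjoint[symmetric])
    show "\<forall>i\<in>?r. \<forall>j\<in>?r. i \<noteq> j \<longrightarrow>
        {y \<in> ?r. [y\<^sup>2 = i] (mod int p)} \<inter> {y \<in> ?r. [y\<^sup>2 = j] (mod int p)} = {}"
    proof (intro ballI impI)
      fix i j assume "i \<in> ?r" "j \<in> ?r" "i \<noteq> j"
      then have "\<not> [i = j] (mod int p)" using residue_eqI by (auto simp: cong_iff_dvd_diff)
      then show "{y \<in> ?r. [y\<^sup>2 = i] (mod int p)} \<inter> {y \<in> ?r. [y\<^sup>2 = j] (mod int p)} = {}"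
        using cong_sym cong_trans by blast
    qed
    show "\<forall>c\<in>?r. finite {y \<in> ?r. [y\<^sup>2 = c] (mod int p)}"
      by (rule ballI, rule finite_subset[of _ ?r]) auto
  qed simp
  also have "(\<Union>c\<in>?r. {y \<in> ?r. [y\<^sup>2 = c] (mod int p)}) = ?r"
  proof (intro equalityI subsetI)
    fix y assume "y \<in> ?r"
    then show "y \<in> (\<Union>c\<in>?r. {y \<in> ?r. [y\<^sup>2 = c] (mod int p)})"
      using p0 by (intro UN_I[of "y\<^sup>2 mod int p"]) (auto simp: cong_def)
  qed auto
  finally have "(\<Sum>c\<in>?r. card {y \<in> ?r. [y\<^sup>2 = c] (mod int p)}) = p" by simp
  then have "(\<Sum>c\<in>?r. int (card {y \<in> ?r. [y\<^sup>2 = c] (mod int p)})) = int p"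
    by (simp only: of_nat_sum[symmetric])
  then show ?thesis by (simp add: nu_def sum_subtractf)
qed

text \<open>For fixed \<open>x\<close> the argument x^3 + a x + b runs through all residues together
  with \<open>b\<close>.\<close>

lemma sum_trace:
  assumes "prime p" shows "(\<Sum>b\<in>{0..<int p}. ftrace p a b) = 0"
proof -
  have "(\<Sum>b\<in>{0..<int p}. nu p (x ^ 3 + a * x + b)) = 0" for x
    using sum_shift_mod[OF assms, of "nu p" "x ^ 3 + a * x"] sum_nu[OF assms] by (simp add: algebra_simps)
  then show ?thesis
    unfolding ftrace_def sum_negf by (subst sum.swap) simp
qed

lemma nu_eq_Legendre:
  assumes p: "prime p" and p2: "p > 2"
  shows "nu p c = Legendre c (int p)"
proof -
  let ?S = "{y \<in> {0..<int p}. [y\<^sup>2 = c] (mod int p)}"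
  have p0: "0 < int p" and pp: "prime (int p)" using prime_gt_0_nat[OF p] p by auto
  have n2: "\<not> int p dvd 2" using p2 by (auto dest!: zdvd_imp_le)
  show ?thesis
  proof (cases "[c = 0] (mod int p)")
    case True
    have "?S = {0}"
    proof (intro equalityI subsetI)
      fix y assume y: "y \<in> ?S"
      then have "[y\<^sup>2 = 0] (mod int p)" using True cong_trans by blast
      then have "int p dvd y\<^sup>2" by (simp add: cong_0_iff)
      then have "int p dvd y" using pp prime_dvd_power by blast
      then show "y \<in> {0}" using y p0 residue_eqI[of y "int p" 0] by auto
    qed (use True p0 in \<open>auto simp: cong_sym_eq\<close>)
    then show ?thesis using True by (simp add: nu_def Legendre_def)
  next
    case False
    show ?thesis
    proof (cases "QuadRes (int p) c")
      case True
      then obtain z where z: "[z\<^sup>2 = c] (mod int p)" by (auto simp: QuadRes_def)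
      define u where "u = z mod int p"
      have u: "[u\<^sup>2 = c] (mod int p)" "0 \<le> u" "u < int p"
        using z p0 unfolding u_def by (auto simp: cong_def power_mod)
      have nu: "\<not> int p dvd u"
      proof
        assume "int p dvd u"
        then have "[u\<^sup>2 = 0] (mod int p)" by (simp add: cong_0_iff power2_eq_square)
        then show False using u(1) False cong_sym cong_trans by blast
      qed
      then have "u > 0" using u(2) by (cases "u = 0") auto
      have ne: "u \<noteq> int p - u"
      proof
        assume "u = int p - u"
        then have "int p dvd 2 * u" by (metis add.commute diff_add_cancel dvd_refl mult_2)
        then show False using nu n2 pp by (simp add: prime_dvd_mult_iff)
      qed
      have "?S = {u, int p - u}"
      proof (intro equalityI subsetI)
        fix y assume y: "y \<in> ?S"
        then have "[y\<^sup>2 = u\<^sup>2] (mod int p)" using u(1) cong_sym cong_trans by blast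
        then have "int p dvd (y - u) * (y + u)"
          by (simp add: cong_iff_dvd_diff power2_eq_square algebra_simps)
        then consider "int p dvd y - u" | "int p dvd y + u" using pp by (auto simp: prime_dvd_mult_iff)
        then show "y \<in> {u, int p - u}"
        proof cases
          case 1 then show ?thesis using y u residue_eqI[of y "int p" u] by auto
        next
          case 2
          then obtain t where t: "y + u = int p * t" by (elim dvdE)
          have "0 < y + u" "y + u < 2 * int p" using y u \<open>u > 0\<close> by auto
          then have "t > 0" "t < 2" using t p0 by (auto simp: zero_less_mult_iff) 
          then have "t = 1" by simp
          then show ?thesis using t by auto
        qed
      next
        fix y assume "y \<in> {u, int p - u}"
        moreover have "[(int p - u)\<^sup>2 = c] (mod int p)"
        proof -
          have "(int p - u)\<^sup>2 = u\<^sup>2 + int p * (int p - 2 * u)" by (simp add: power2_eq_square algebra_simps)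
          then have "[(int p - u)\<^sup>2 = u\<^sup>2] (mod int p)" by (simp add: cong_def)
          then show ?thesis using u(1) cong_trans by blast
        qed
        ultimately show "y \<in> ?S" using u \<open>u > 0\<close> by auto
      qed
      then have "card ?S = 2" using ne by simp
      then show ?thesis using True False by (simp add: nu_def Legendre_def)
    next
      case nq: False
      have "?S = {}" using nq by (auto simp: QuadRes_def)
      then have "card ?S = 0" by (simp only: card.empty)
      then show ?thesis using nq False by (simp add: nu_def Legendre_def)
    qed
  qed
qed

lemma nu_two: "nu 2 c = 0"
proof -
  have "{y \<in> {0..<int 2}. [y\<^sup>2 = c] (mod int 2)} = {c mod 2}"
  proof (intro equalityI subsetI)
    fix y assume "y \<in> {y \<in> {0..<int 2}. [y\<^sup>2 = c] (mod int 2)}"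
    then have "y = 0 \<or> y = 1" "y\<^sup>2 mod 2 = c mod 2" by (auto simp: cong_def)
    then show "y \<in> {c mod 2}" by auto
  next
    fix y assume "y \<in> {c mod 2}"
    moreover have "c mod 2 = 0 \<or> c mod 2 = 1" by auto
    ultimately show "y \<in> {y \<in> {0..<int 2}. [y\<^sup>2 = c] (mod int 2)}" by (auto simp: cong_def)
  qed
  then show ?thesis by (simp add: nu_def)
qed

text \<open>For x \<noteq> y the values of the cubic at x and y are jointly uniform as (a, b)
  varies, so off-diagonal terms vanish. Each of the p diagonal terms counts p values of a times p -
  1 nonzero residues.\<close>

lemma sum_trace_squared:
  assumes p: "prime p" and p2: "p > 2"
  shows "(\<Sum>a\<in>{0..<int p}. \<Sum>b\<in>{0..<int p}. (ftrace p a b)\<^sup>2) = int p * int p * (int p - 1)"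
proof -
  let ?r = "{0..<int p}"
  let ?c = "\<lambda>a b x. x ^ 3 + a * x + b"
  have p0: "0 < int p" using prime_gt_0_nat[OF p] by simp
  have nu2: "(\<Sum>c\<in>?r. nu p c * nu p c) = int p - 1"
  proof -
    have "nu p c * nu p c = (if c = 0 then 0 else 1)" if "c \<in> ?r" for c
    proof -
      have "[c = 0] (mod int p) \<longleftrightarrow> c = 0" using that by (auto simp: cong_def)
      then show ?thesis by (simp add: nu_eq_Legendre[OF p p2] Legendre_def)
    qed
    then have "(\<Sum>c\<in>?r. nu p c * nu p c) = (\<Sum>c\<in>?r. if c = 0 then 0 else 1)" by (intro sum.cong) auto
    also have "\<dots> = (\<Sum>c\<in>?r - {0}. 1)" by (rule sum.mono_neutral_cong_right) auto
    also have "\<dots> = int p - 1" using p0 by simp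
    finally show ?thesis .
  qed
  have pair: "(\<Sum>a\<in>?r. \<Sum>b\<in>?r. nu p (?c a b x) * nu p (?c a b y)) = (if x = y then int p * (int p - 1) else 0)"
    if xy: "x \<in> ?r" "y \<in> ?r" for x y
  proof -
    \<comment> \<open>Shifting \<open>b\<close> by x^3 + a x leaves \<open>a\<close> only in the
      second factor, through a (y - x).\<close>
    have step: "(\<Sum>b\<in>?r. nu p (?c a b x) * nu p (?c a b y)) =
        (\<Sum>b\<in>?r. nu p b * nu p (b + (y ^ 3 - x ^ 3 + a * (y - x))))" for a
    proof -
      have "nu p (b mod int p) * nu p (b mod int p + (y ^ 3 - x ^ 3 + a * (y - x)))
          = nu p b * nu p (b + (y ^ 3 - x ^ 3 + a * (y - x)))" for b
      proof -
        have "nu p (b mod int p + (y ^ 3 - x ^ 3 + a * (y - x))) = nu p (b + (y ^ 3 - x ^ 3 + a * (y - x)))"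
          by (rule nu_cong) (simp add: cong_def mod_simps)
        then show ?thesis by simp
      qed
      from sum_shift_mod[OF p, where s = "x ^ 3 + a * x" and
         F = "\<lambda>b. nu p b * nu p (b + (y ^ 3 - x ^ 3 + a * (y - x)))", OF this]
      show ?thesis by (simp add: algebra_simps)
    qed
    show ?thesis
    proof (cases "x = y")
      case True
      then show ?thesis unfolding step by (simp add: nu2)
    next
      case False
      have nd: "\<not> int p dvd y - x"
        using xy False residue_eqI by metis
      have "(\<Sum>a\<in>?r. nu p (b + (y ^ 3 - x ^ 3 + a * (y - x)))) = 0" for b
        using sum_affine_mod[OF p nd, of "nu p" "b + y ^ 3 - x ^ 3"] sum_nu[OF p]
        by (simp add: algebra_simps)
      then show ?thesis using False unfolding step
        by (subst sum.swap) (simp add: sum_distrib_left[symmetric])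
    qed
  qed
  have "(\<Sum>a\<in>?r. \<Sum>b\<in>?r. (ftrace p a b)\<^sup>2) =
      (\<Sum>a\<in>?r. \<Sum>b\<in>?r. \<Sum>x\<in>?r. \<Sum>y\<in>?r. nu p (?c a b x) * nu p (?c a b y))"
    by (simp add: ftrace_def power2_eq_square sum_product)
  also have "\<dots> = (\<Sum>a\<in>?r. \<Sum>x\<in>?r. \<Sum>y\<in>?r. \<Sum>b\<in>?r. nu p (?c a b x) * nu p (?c a b y))"
    by (rule sum.cong[OF refl], subst sum.swap, rule sum.cong[OF refl], rule sum.swap)
  also have "\<dots> = (\<Sum>x\<in>?r. \<Sum>y\<in>?r. \<Sum>a\<in>?r. \<Sum>b\<in>?r. nu p (?c a b x) * nu p (?c a b y))"
    by (subst sum.swap, rule sum.cong[OF refl], rule sum.swap)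
  also have "\<dots> = (\<Sum>x\<in>?r. \<Sum>y\<in>?r. if x = y then int p * (int p - 1) else 0)"
    by (intro sum.cong refl pair)
  also have "\<dots> = int p * (int p * (int p - 1))" by simp
  finally show ?thesis by simp
qed

lemma abs_nu_le:
  assumes "prime p" shows "\<bar>nu p c\<bar> \<le> 1"
proof (cases "p = 2")
  case False
  then have "nu p c = Legendre c (int p)" using assms prime_ge_2_nat[of p] by (intro nu_eq_Legendre) auto
  then show ?thesis by (simp add: Legendre_def)
qed (simp add: nu_two)

context stepanov
begin

text \<open>For a = 1 and a = -1, a times the sum is \<open>2 * card (level a)\<close> minus p plus
  the number of zeros, which is at most 3. Upper bounds for the two level sets thus bound the sum
  from both sides.\<close>

lemma sum_nu_bound:
  assumes m: "m \<ge> 5" "4 * m\<^sup>2 \<le> p"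
  shows "real m * \<bar>real_of_int (\<Sum>x\<in>{0..<int p}. nu p (poly f x))\<bar> \<le> 5 * real p + 3 * real m"
proof -
  let ?r = "{0..<int p}"
  have p100: "p > 2" using m power_mono[of 5 m 2] by simp
  have euler: "[nu p c = c ^ e] (mod int p)" for c
    using euler_criterion[of p c] p p100 unfolding nu_eq_Legendre[OF p p100] e_def
    by (simp add: nat_diff_distrib nat_div_distrib)
  define Z where "Z = {x \<in> ?r. int p dvd poly f x}"
  have Z: "card Z \<le> 3"
  proof -
    have "\<not> pdvd p f" using topidx_f by (auto simp: pdvd_def topidx_def)
    then have "1 * card Z \<le> degree f"
    proof (intro card_multiple_roots[OF p])
      show "Z \<subseteq> ?r" by (auto simp: Z_def)
      then show "finite Z" by (rule finite_subset) simp
      show "\<exists>G. pdvd p (f - [:- s, 1:] ^ 1 * G)" if "s \<in> Z" for s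
        using root_mod_factor[of p f s] that by (simp only: Z_def mem_Collect_eq power_one_right)
    qed
    then show ?thesis using fdeg by simp
  qed
  have n2: "\<not> int p dvd 2" using p100 by (auto dest!: zdvd_imp_le)
  have ind: "(\<Sum>x\<in>?r. if x \<in> S then 1 else 0) = int (card S)" if "S \<subseteq> ?r" for S
    using that by (simp add: sum.If_cases Int_absorb1)
  have half: "real m * (real_of_int a * real_of_int (\<Sum>x\<in>?r. nu p (poly f x))) \<le> 5 * real p + 3 * real m"
    if a: "a \<in> {1, - 1}" for a
  proof -
    have val: "a * nu p (poly f x) = 2 * (if x \<in> level a then 1 else 0) - 1 + (if x \<in> Z then 1 else 0)"
      if x: "x \<in> ?r" for x
    proof -
      have gx: "[poly g x = nu p (poly f x)] (mod int p)"
        using euler[of "poly f x"] by (simp add: g_def cong_sym_eq poly_power)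
      have nn: "\<not> [1 = - 1] (mod int p)" "\<not> [- 1 = 1] (mod int p)" using n2
        by (auto simp: cong_iff_dvd_diff)
      have lev: "x \<in> level a \<longleftrightarrow> \<not> int p dvd poly f x \<and> [nu p (poly f x) = a] (mod int p)"
        using x gx unfolding level_def by (auto simp: cong_sym_eq intro: cong_trans dest: cong_sym)
      have z: "nu p (poly f x) = 0 \<longleftrightarrow> int p dvd poly f x"
        unfolding nu_eq_Legendre[OF p p100] by (auto simp: Legendre_def cong_0_iff)
      have "nu p (poly f x) \<in> {-1, 0, 1}" unfolding nu_eq_Legendre[OF p p100] by (auto simp: Legendre_def)
      then show ?thesis using a z nn x unfolding lev Z_def by auto
    qed
    have "a * (\<Sum>x\<in>?r. nu p (poly f x)) = 2 * int (card (level a)) - int p + int (card Z)"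
    proof -
      have sub: "level a \<subseteq> ?r" "Z \<subseteq> ?r" by (auto simp: level_def Z_def)
      have "a * (\<Sum>x\<in>?r. nu p (poly f x))
          = (\<Sum>x\<in>?r. 2 * (if x \<in> level a then 1 else 0) - 1 + (if x \<in> Z then 1 else 0))"
        unfolding sum_distrib_left by (intro sum.cong refl val)
      also have "\<dots> = 2 * int (card (level a)) - int p + int (card Z)"
        unfolding sum.distrib sum_subtractf sum_distrib_left[symmetric] ind[OF sub(1)] ind[OF sub(2)] by simp
      finally show ?thesis .
    qed
    then have "real_of_int (a * (\<Sum>x\<in>?r. nu p (poly f x))) = real_of_int (2 * int (card (level a)) - int p + int (card Z))"
      by (rule arg_cong)
    then have E: "real_of_int a * real_of_int (\<Sum>x\<in>?r. nu p (poly f x)) = 2 * real (card (level a)) - real p + real (card Z)"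
      unfolding of_int_mult by simp
    have "real (2 * m * card (level a)) \<le> real (p * (m + 5))" using card_level[OF m] of_nat_le_iff by blast
    moreover have "real m * real (card Z) \<le> real m * 3" using Z by (intro mult_left_mono) auto
    ultimately show ?thesis unfolding E by (simp add: algebra_simps)
  qed
  show ?thesis using half[of 1] half[of "- 1"] by (simp add: abs_if)
qed

end

text \<open>With m near sqrt p / 2 one has sqrt p \<le> 4 m, so (5 p + 3 m) / m is at most 20 sqrt p
  + 3 sqrt p. For p < 100, where m could drop below 5, the trivial bound p \<le> 10 sqrt p is
  enough.\<close>

lemma weak_hasse:
  assumes p: "prime p"
  shows "\<bar>real_of_int (ftrace p a b)\<bar> \<le> 23 * sqrt (real p)"
proof -
  let ?r = "{0..<int p}"
  define f where "f = [:b, a, 0, 1:]"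
  have pf: "poly f x = x ^ 3 + a * x + b" for x
    by (simp add: f_def power3_eq_cube algebra_simps)
  have tr: "ftrace p a b = - (\<Sum>x\<in>?r. nu p (poly f x))" by (simp add: ftrace_def pf)
  have triv: "\<bar>real_of_int (ftrace p a b)\<bar> \<le> real p"
  proof -
    have "\<bar>\<Sum>x\<in>?r. nu p (poly f x)\<bar> \<le> (\<Sum>x\<in>?r. \<bar>nu p (poly f x)\<bar>)" by (rule sum_abs)
    also have "\<dots> \<le> (\<Sum>x\<in>?r. 1)" by (intro sum_mono abs_nu_le p)
    finally have "\<bar>ftrace p a b\<bar> \<le> int p" unfolding tr by simp
    then show ?thesis by (metis of_int_abs of_int_le_iff of_int_of_nat_eq)
  qed
  have sq: "real p = sqrt (real p) * sqrt (real p)" by simp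
  show ?thesis
  proof (cases "p < 100")
    case True
    have "sqrt (real p) \<le> 10" using True by (intro real_le_lsqrt) auto
    then have "real p \<le> 23 * sqrt (real p)"
      by (subst sq) (intro mult_right_mono, auto)
    then show ?thesis using triv by linarith
  next
    case False
    define m where "m = nat \<lfloor>sqrt (real p) / 2\<rfloor>"
    have s10: "sqrt (real p) \<ge> 10" using False by (intro real_le_rsqrt) auto
    have m1: "real m \<le> sqrt (real p) / 2" "sqrt (real p) / 2 < real m + 1"
      unfolding m_def using s10 by (linarith, linarith)
    have m5: "m \<ge> 5" using s10 unfolding m_def by linarith
    have "real m ^ 2 \<le> (sqrt (real p) / 2) ^ 2" using m1 by (intro power_mono) auto
    then have "real (4 * m\<^sup>2) \<le> real p" by (simp add: power_divide)
    then have m4: "4 * m\<^sup>2 \<le> p" using of_nat_le_iff by blast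
    show ?thesis
    proof (cases "\<exists>s. \<not> int p dvd poly f s")
      case False
      have "nu p (poly f x) = 0" for x
      proof -
        have "Legendre (poly f x) (int p) = 0" using False by (auto simp: Legendre_def cong_0_iff)
        then show ?thesis using nu_eq_Legendre[OF p] \<open>\<not> p < 100\<close> by simp
      qed
      then show ?thesis by (simp add: tr)
    next
      case True
      then obtain s where s: "\<not> int p dvd poly f s" by blast
      \<comment> \<open>The translation moves a point with nonzero value to 0 and permutes the
        residues, so the character sum is unchanged.\<close>
      define f' where "f' = pcompose f [:s, 1:]"
      have deg: "degree f' = 3" by (simp add: f'_def degree_pcompose f_def)
      have lead: "lead_coeff f' = 1" unfolding f'_def
        by (subst lead_coeff_comp) (auto simp: f_def)
      have pf': "poly f' x = poly f (x + s)" for x by (simp add: f'_def poly_pcompose add.commute)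
      interpret stepanov p f'
        using p False deg lead s prime_odd_nat[OF p] by unfold_locales (auto simp: pf')
      have "nu p (poly f (x mod int p)) = nu p (poly f x)" for x
        by (rule nu_cong) (auto simp: pf cong_def mod_simps power_mod intro!: mod_add_cong mod_mult_cong)
      from sum_shift_mod[OF p, of "\<lambda>x. nu p (poly f x)" s, OF this]
      have "(\<Sum>x\<in>?r. nu p (poly f' x)) = (\<Sum>x\<in>?r. nu p (poly f x))" by (simp add: pf')
      with sum_nu_bound[OF m5 m4] have "real m * \<bar>real_of_int (ftrace p a b)\<bar> \<le> 5 * real p + 3 * real m"
        by (simp add: tr)
      also have "\<dots> \<le> real m * (23 * sqrt (real p))"
      proof -
        have "sqrt (real p) \<le> 4 * real m" using m1 s10 by linarith
        then have "5 * (sqrt (real p) * sqrt (real p)) \<le> 5 * (4 * real m * sqrt (real p))"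
          by (intro mult_left_mono mult_right_mono) auto
        moreover have "3 * real m \<le> 3 * (real m * sqrt (real p))" using s10 by (simp add: mult_le_cancel_left1 del: real_sqrt_ge_1_iff)
        ultimately show ?thesis using sq by (simp add: algebra_simps)
      qed
      finally show ?thesis using m5 by (simp add: mult_le_cancel_left)
    qed
  qed
qed

section \<open>Averages and equidistribution\<close>

definition avg :: "'a set \<Rightarrow> ('a \<Rightarrow> 'b) \<Rightarrow> 'b::real_normed_field" where
  "avg S f = (\<Sum>s\<in>S. f s) / of_nat (card S)"

lemma avg_const: "finite S \<Longrightarrow> S \<noteq> {} \<Longrightarrow> avg S (\<lambda>_. c) = c"
  by (simp add: avg_def)

lemma avg_cong: "(\<And>s. s \<in> S \<Longrightarrow> f s = g s) \<Longrightarrow> avg S f = avg S g"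
  by (simp add: avg_def)

lemma avg_diff: "avg S (\<lambda>s. f s - g s) = avg S f - avg S g"
  by (simp add: avg_def sum_subtractf diff_divide_distrib)

lemma avg_add: "avg S (\<lambda>s. f s + g s) = avg S f + avg S g"
  by (simp add: avg_def sum.distrib add_divide_distrib)

lemma avg_cmult: "avg S (\<lambda>s. c * f s) = c * avg S f"
  by (simp add: avg_def sum_distrib_left)

lemma avg_sum: "avg S (\<lambda>s. \<Sum>i\<in>I. f i s) = (\<Sum>i\<in>I. avg S (f i))"
  by (simp add: avg_def sum.swap[of _ S] sum_divide_distrib)

lemma avg_mono:
  fixes f g :: "'a \<Rightarrow> real"
  shows "(\<And>s. s \<in> S \<Longrightarrow> f s \<le> g s) \<Longrightarrow> avg S f \<le> avg S g"
  by (simp add: avg_def divide_right_mono sum_mono)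

lemma norm_avg: "norm (avg S f) \<le> avg S (\<lambda>s. norm (f s))"
  by (simp add: avg_def norm_divide divide_right_mono norm_sum)

lemma norm_avg_le:
  assumes "finite S" "S \<noteq> {}" "\<And>s. s \<in> S \<Longrightarrow> norm (f s) \<le> K"
  shows "norm (avg S f) \<le> K"
  using norm_avg[of S f] avg_mono[of S "\<lambda>s. norm (f s)" "\<lambda>_. K"] avg_const[of S K] assms by fastforce

lemma avg_Times: "avg (X \<times> Y) f = avg X (\<lambda>x. avg Y (\<lambda>y. f (x, y)))"
  by (simp add: avg_def sum.cartesian_product sum_divide_distrib[symmetric]
       card_cartesian_product mult.commute)

lemma avg_reindex: "inj_on h S \<Longrightarrow> avg (h ` S) f = avg S (\<lambda>s. f (h s))"
  by (simp add: avg_def sum.reindex card_image)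

text \<open>Says that the l1 distance between the image of the uniform distribution on
  \<open>X\<close> and the uniform distribution on \<open>R\<close> is at most \<delta>. Test
  functions make products and restrictions easy; nonemptiness is included so that \<open>avg\<close>
  is a true mean.\<close>

definition equi :: "'a set \<Rightarrow> ('a \<Rightarrow> 'b) \<Rightarrow> 'b set \<Rightarrow> real \<Rightarrow> bool" where
  "equi X \<rho> R \<delta> \<longleftrightarrow> finite X \<and> X \<noteq> {} \<and> finite R \<and> R \<noteq> {} \<and> \<rho> ` X \<subseteq> R \<and>
     (\<forall>(G :: 'b \<Rightarrow> real) K. (\<forall>v\<in>R. \<bar>G v\<bar> \<le> K) \<longrightarrow> \<bar>avg X (\<lambda>x. G (\<rho> x)) - avg R G\<bar> \<le> K * \<delta>)"

text \<open>Averaging over the second factor gives a test function on the first factor with the same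
  bound.\<close>

lemma equi_prod:
  assumes X: "equi X \<rho> R \<delta>" and Y: "equi Y \<sigma> R' \<epsilon>"
  shows "equi (X \<times> Y) (map_prod \<rho> \<sigma>) (R \<times> R') (\<delta> + \<epsilon>)"
  unfolding equi_def
proof (intro conjI allI impI)
  fix G :: "_ \<Rightarrow> real" and K
  assume G: "\<forall>v\<in>R \<times> R'. \<bar>G v\<bar> \<le> K"
  have fin: "finite X" "X \<noteq> {}" "finite R'" "R' \<noteq> {}" and img: "\<rho> ` X \<subseteq> R"
    using X Y by (auto simp: equi_def)
  define H where "H v = avg R' (\<lambda>w. G (v, w))" for v
  have H: "\<bar>H v\<bar> \<le> K" if "v \<in> R" for v
    using norm_avg_le[of R' "\<lambda>w. G (v, w)" K] fin G that by (auto simp: H_def)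
  have "\<bar>avg Y (\<lambda>y. G (\<rho> x, \<sigma> y)) - H (\<rho> x)\<bar> \<le> K * \<epsilon>" if "x \<in> X" for x
    using Y G img that unfolding equi_def H_def by (auto dest!: spec[of _ "\<lambda>w. G (\<rho> x, w)"])
  then have 1: "\<bar>avg X (\<lambda>x. avg Y (\<lambda>y. G (\<rho> x, \<sigma> y)) - H (\<rho> x))\<bar> \<le> K * \<epsilon>"
    using norm_avg_le[OF fin(1,2), of "\<lambda>x. avg Y (\<lambda>y. G (\<rho> x, \<sigma> y)) - H (\<rho> x)" "K * \<epsilon>"] by auto
  have 2: "\<bar>avg X (\<lambda>x. H (\<rho> x)) - avg R H\<bar> \<le> K * \<delta>"
    using X H by (auto simp: equi_def)
  have "avg (X \<times> Y) (\<lambda>x. G (map_prod \<rho> \<sigma> x)) - avg (R \<times> R') G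
      = avg X (\<lambda>x. avg Y (\<lambda>y. G (\<rho> x, \<sigma> y)) - H (\<rho> x)) + (avg X (\<lambda>x. H (\<rho> x)) - avg R H)"
    by (simp add: avg_Times avg_diff H_def[abs_def])
  then show "\<bar>avg (X \<times> Y) (\<lambda>x. G (map_prod \<rho> \<sigma> x)) - avg (R \<times> R') G\<bar> \<le> K * (\<delta> + \<epsilon>)"
    using 1 2 by (simp add: distrib_left)
qed (use X Y in \<open>auto simp: equi_def\<close>)

lemma sum_PiE_insert:
  assumes "q \<notin> A"
  shows "(\<Sum>v\<in>PiE (insert q A) R. G v) = (\<Sum>v\<in>PiE A R. \<Sum>c\<in>R q. G (v(q := c)))"
proof -
  have "(\<Sum>v\<in>PiE (insert q A) R. G v) = (\<Sum>(c, v)\<in>R q \<times> PiE A R. G (v(q := c)))"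
    unfolding PiE_insert_eq
    by (subst sum.reindex[OF inj_combinator[OF assms]]) (auto intro!: sum.cong)
  also have "\<dots> = (\<Sum>c\<in>R q. \<Sum>v\<in>PiE A R. G (v(q := c)))" by (rule sum.cartesian_product[symmetric])
  also have "\<dots> = (\<Sum>v\<in>PiE A R. \<Sum>c\<in>R q. G (v(q := c)))" by (rule sum.swap)
  finally show ?thesis .
qed

lemma sum_PiE_restrict:
  fixes G :: "('a \<Rightarrow> 'b) \<Rightarrow> real"
  assumes "finite D" "D \<inter> Q = {}"
  shows "(\<Sum>v\<in>PiE (Q \<union> D) R. G (restrict v Q)) = real (\<Prod>q\<in>D. card (R q)) * (\<Sum>v\<in>PiE Q R. G v)"
  using assms
proof (induction D rule: finite_induct)
  case empty
  have "restrict v Q = v" if "v \<in> PiE Q R" for v using that by (simp add: PiE_restrict)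
  then show ?case by simp
next
  case (insert q D)
  have "restrict (v(q := c)) Q = restrict v Q" for v :: "'a \<Rightarrow> 'b" and c
    using insert.prems by (auto simp: restrict_def fun_eq_iff)
  then have "(\<Sum>v\<in>PiE (insert q (Q \<union> D)) R. G (restrict v Q))
      = real (card (R q)) * (\<Sum>v\<in>PiE (Q \<union> D) R. G (restrict v Q))"
    using insert by (subst sum_PiE_insert) (auto simp: sum_distrib_left)
  moreover have "(\<Sum>v\<in>PiE (Q \<union> D) R. G (restrict v Q)) = real (\<Prod>q\<in>D. card (R q)) * (\<Sum>v\<in>PiE Q R. G v)"
    using insert.prems by (intro insert.IH) auto
  ultimately show ?case
    unfolding Un_insert_right prod.insert[OF insert.hyps] by (simp only: of_nat_mult mult.assoc)
qed

text \<open>Every vector over \<open>Q\<close> has the same number of extensions to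
  \<open>S\<close>, so there is no error.\<close>

lemma equi_restrict:
  assumes S: "finite S" and Q: "Q \<subseteq> S" and R: "\<And>p. p \<in> S \<Longrightarrow> finite (R p) \<and> R p \<noteq> {}"
  shows "equi (PiE S R) (\<lambda>v. restrict v Q) (PiE Q R) 0"
proof -
  have fin: "finite Q" "finite (S - Q)" using S Q finite_subset by auto
  define c where "c = (\<Prod>q\<in>S - Q. card (R q))"
  have "c \<noteq> 0" using fin R by (auto simp: c_def)
  have eq: "Q \<union> (S - Q) = S" and disj: "(S - Q) \<inter> Q = {}" using Q by auto
  have "card (PiE S R) = c * card (PiE Q R)"
    using S fin Q prod.subset_diff[OF Q S, of "\<lambda>p. card (R p)"] by (simp add: card_PiE c_def)
  then have "avg (PiE S R) (\<lambda>v. G (restrict v Q)) = avg (PiE Q R) G" for G :: "_ \<Rightarrow> real"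
    using \<open>c \<noteq> 0\<close> sum_PiE_restrict[OF fin(2) disj, of G R] unfolding eq c_def[symmetric]
    by (simp add: avg_def)
  then show ?thesis using S Q R fin
    by (auto simp: equi_def finite_PiE PiE_eq_empty_iff subset_iff)
qed

section \<open>Joint residues modulo several primes along intervals\<close>

abbreviation residue_vectors :: "nat set \<Rightarrow> (nat \<Rightarrow> int) set" where
  "residue_vectors Q \<equiv> PiE Q (\<lambda>p. {0..<int p})"

abbreviation period :: "nat set \<Rightarrow> nat" where
  "period Q \<equiv> \<Prod>p\<in>Q. p * (p - 1)"

text \<open>
  The residues of \<open>(a n + b) c\<^sup>n\<close> modulo \<open>p\<close> have period \<open>p (p - 1)\<close>; along an arithmetic progression whose
  step is divisible by \<open>p - 1\<close> but not by \<open>p\<close> the exponential factor is constant.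
\<close>

definition equiperm :: "nat \<Rightarrow> (int \<Rightarrow> int) \<Rightarrow> bool" where
  "equiperm p F \<longleftrightarrow> (\<forall>n. F n \<in> {0..<int p}) \<and> (\<forall>n k. F (n + int (p * (p - 1)) * k) = F n) \<and>
     (\<forall>n w. int (p - 1) dvd w \<longrightarrow> \<not> int p dvd w \<longrightarrow>
        bij_betw (\<lambda>k. F (n + k * w)) {0..<int p} {0..<int p})"

lemma sum_blocks:
  fixes f :: "nat \<Rightarrow> real"
  shows "(\<Sum>i<n * k. f i) = (\<Sum>j<n. \<Sum>i<k. f (j * k + i))"
proof -
  have "(\<Sum>i<n * k. f i) = (\<Sum>j<n. \<Sum>i\<in>{j * k..<j * k + k}. f i)" by (rule sum.nat_group[symmetric])
  also have "\<dots> = (\<Sum>j<n. \<Sum>i<k. f (j * k + i))"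
  proof (rule sum.cong[OF refl])
    fix j
    show "(\<Sum>i\<in>{j * k..<j * k + k}. f i) = (\<Sum>i<k. f (j * k + i))"
      by (rule sum.reindex_bij_witness[of _ "\<lambda>i. j * k + i" "\<lambda>i. i - j * k"]) auto
  qed
  finally show ?thesis .
qed

text \<open>In the induction step, q blocks of length \<open>w\<close> repeat the components at the
  smaller primes while the component at \<open>q\<close> takes each residue once. This is where the
  multiplicity, the product of all p - 1, comes from.\<close>

lemma sum_full_period:
  fixes G :: "(nat \<Rightarrow> int) \<Rightarrow> real"
  assumes "finite Q" "\<And>p. p \<in> Q \<Longrightarrow> prime p \<and> equiperm p (F p)"
  shows "(\<Sum>i<(period Q). G (restrict (\<lambda>p. F p (m + int i)) Q)) =
     real (\<Prod>p\<in>Q. p - 1) * (\<Sum>v\<in>residue_vectors Q. G v)"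
  using assms
proof (induction Q arbitrary: m G rule: finite_linorder_max_induct)
  case empty
  show ?case by (simp add: restrict_def)
next
  case (insert q A)
  define W where "W = period A"
  \<comment> \<open>The factor \<open>W\<close> preserves the components at the smaller primes, and
    q - 1 makes the step admissible in \<open>equiperm\<close>.\<close>
  define w where "w = (q - 1) * W"
  have q: "prime q" and eq: "equiperm q (F q)" using insert.prems by auto
  have qA: "q \<notin> A" using insert.hyps by auto
  have pA: "prime p" "p < q" if "p \<in> A" for p using insert that by auto
  have nd: "\<not> int q dvd int w"
  proof
    assume "int q dvd int w"
    then have "q dvd q - 1 \<or> q dvd W" using q by (simp add: w_def prime_dvd_mult_iff)
    moreover have "\<not> q dvd q - 1" using prime_gt_1_nat[OF q] by (auto dest!: dvd_imp_le)
    ultimately have "q dvd W" by blast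
    then obtain p where p: "p \<in> A" "q dvd p * (p - 1)"
      using q insert.hyps(1) by (auto simp: W_def prime_dvd_prod_iff)
    then have "q dvd p \<or> q dvd p - 1" using q by (simp add: prime_dvd_mult_iff)
    then show False using pA[OF p(1)] prime_gt_1_nat[of p] by (auto dest!: dvd_imp_le)
  qed
  define G' where "G' v = (\<Sum>c\<in>{0..<int q}. G (v(q := c)))" for v
  have per: "F p (n + int w * k) = F p n" if "p \<in> A" for p n k
  proof -
    have "p * (p - 1) dvd W" unfolding W_def using that insert.hyps(1) by (rule dvd_prodI[rotated])
    then have "p * (p - 1) dvd w" by (simp add: w_def)
    then obtain t where t: "w = p * (p - 1) * t" by (elim dvdE)
    have "equiperm p (F p)" using insert.prems that by auto
    then have "F p (n + int (p * (p - 1)) * (int t * k)) = F p n" unfolding equiperm_def by blast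
    then show ?thesis by (simp add: t mult_ac)
  qed
  let ?v = "\<lambda>i. restrict (\<lambda>p. F p (m + int i)) A"
  have res: "restrict (\<lambda>p. F p (m + int (j * w + i))) (insert q A)
      = (?v i)(q := F q (m + int i + int j * int w))" for i j
  proof
    fix p
    show "restrict (\<lambda>p. F p (m + int (j * w + i))) (insert q A) p
      = ((?v i)(q := F q (m + int i + int j * int w))) p"
      using per[of p "m + int i" "int j"] qA by (auto simp: algebra_simps)
  qed
  have inner: "(\<Sum>j<q. G ((?v i)(q := F q (m + int i + int j * int w))))
      = G' (?v i)" for i
  proof -
    have "(\<Sum>j<q. G ((?v i)(q := F q (m + int i + int j * int w))))
        = (\<Sum>k\<in>{0..<int q}. G ((?v i)(q := F q (m + int i + k * int w))))"
      by (rule sum.reindex_bij_witness[of _ nat int]) auto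
    also have "\<dots> = G' (?v i)"
      unfolding G'_def
    proof (rule sum.reindex_bij_betw)
      have "int (q - 1) dvd int w" by (simp add: w_def)
      then show "bij_betw (\<lambda>k. F q (m + int i + k * int w)) {0..<int q} {0..<int q}"
        using eq nd unfolding equiperm_def by blast
    qed
    finally show ?thesis .
  qed
  have "period (insert q A) = q * w" using insert.hyps(1) qA by (simp add: w_def W_def)
  then have "(\<Sum>i<period (insert q A). G (restrict (\<lambda>p. F p (m + int i)) (insert q A)))
      = (\<Sum>j<q. \<Sum>i<w. G ((?v i)(q := F q (m + int i + int j * int w))))"
    by (simp only: sum_blocks res)
  also have "\<dots> = (\<Sum>i<w. G' (?v i))"
    by (subst sum.swap) (simp only: inner)
  \<comment> \<open>The range splits into q - 1 periods of length \<open>W\<close> with different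
    starting points, which is why the induction keeps \<open>m\<close> and \<open>G\<close>
    arbitrary.\<close>
  also have "\<dots> = (\<Sum>t<q - 1. \<Sum>i<W. G' (restrict (\<lambda>p. F p (m + int (t * W) + int i)) A))"
    unfolding w_def by (simp only: sum_blocks of_nat_add add.assoc)
  also have "\<dots> = (\<Sum>t<q - 1. real (\<Prod>p\<in>A. p - 1) * (\<Sum>v\<in>residue_vectors A. G' v))"
    unfolding W_def by (intro sum.cong refl insert.IH insert.prems) auto
  also have "\<dots> = real (\<Prod>p\<in>insert q A. p - 1) * (\<Sum>v\<in>residue_vectors A. G' v)"
    using insert.hyps(1) qA by simp
  also have "(\<Sum>v\<in>residue_vectors A. G' v) = (\<Sum>v\<in>residue_vectors (insert q A). G v)"
    unfolding G'_def by (rule sum_PiE_insert[OF qA, symmetric])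
  finally show ?case .
qed

text \<open>Complete periods cancel exactly; fewer than \<open>period Q\<close> terms remain, each
  at most 2 K in absolute value.\<close>

lemma sum_interval_equidistribution:
  fixes G :: "(nat \<Rightarrow> int) \<Rightarrow> real"
  assumes Q: "finite Q" "\<And>p. p \<in> Q \<Longrightarrow> prime p \<and> equiperm p (F p)"
    and K: "\<And>v. v \<in> residue_vectors Q \<Longrightarrow> \<bar>G v\<bar> \<le> K"
  shows "\<bar>\<Sum>i<L. G (restrict (\<lambda>p. F p (m + int i)) Q) - avg (residue_vectors Q) G\<bar>
     \<le> 2 * K * real (period Q)"
proof -
  let ?R = "residue_vectors Q"
  define W where "W = period Q"
  define \<mu> where "\<mu> = avg ?R G"
  have W0: "W > 0" unfolding W_def
  proof (rule prod_pos)
    fix p assume "p \<in> Q"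
    then have "p > 1" using Q(2) prime_gt_1_nat by blast
    then show "0 < p * (p - 1)" by simp
  qed
  have cR: "card ?R = (\<Prod>p\<in>Q. p)" using Q(1) by (simp add: card_PiE)
  have R: "finite ?R" "?R \<noteq> {}" using Q by (auto simp: finite_PiE PiE_eq_empty_iff dest: prime_gt_0_nat)
  have cR0: "card ?R \<noteq> 0" using R by simp
  define h where "h m i = G (restrict (\<lambda>p. F p (m + int i)) Q) - \<mu>" for m i
  have zero: "(\<Sum>i<W. h m i) = 0" for m
  proof -
    have "real W = real (\<Prod>p\<in>Q. p - 1) * real (card ?R)"
      unfolding W_def cR by (simp add: prod.distrib mult.commute)
    then have "real W * \<mu> = real (\<Prod>p\<in>Q. p - 1) * (\<Sum>v\<in>?R. G v)"
      using cR0 by (simp add: \<mu>_def avg_def)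
    then show ?thesis
      using sum_full_period[OF Q, of G m] by (simp add: h_def sum_subtractf W_def)
  qed
  have mem: "restrict (\<lambda>p. F p n) Q \<in> ?R" for n
    using Q(2) by (fastforce simp: equiperm_def)
  have hK: "\<bar>h m i\<bar> \<le> 2 * K" for m i
  proof -
    have "\<bar>\<mu>\<bar> \<le> K" unfolding \<mu>_def using norm_avg_le[OF R, of G K] K by auto
    then show ?thesis using K[OF mem[of "m + int i"]] unfolding h_def by linarith
  qed
  have "(\<Sum>i<L. h m i) = (\<Sum>i<(L div W) * W. h m i) + (\<Sum>i<L mod W. h (m + int ((L div W) * W)) i)"
  proof -
    have "(\<Sum>i<L. h m i) = (\<Sum>i<(L div W) * W. h m i) + (\<Sum>i\<in>{(L div W) * W..<L}. h m i)"
      by (metis atLeast0LessThan div_times_less_eq_dividend sum.atLeastLessThan_concat zero_le)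
    also have "(\<Sum>i\<in>{(L div W) * W..<L}. h m i) = (\<Sum>i<L mod W. h (m + int ((L div W) * W)) i)"
    proof -
      have L: "L = (L div W) * W + L mod W" by simp
      show ?thesis
        by (rule sum.reindex_bij_witness[of _ "\<lambda>i. (L div W) * W + i" "\<lambda>i. i - (L div W) * W"])
           (simp_all add: h_def add_ac, (use L in linarith)+)
    qed
    finally show ?thesis .
  qed
  also have "(\<Sum>i<(L div W) * W. h m i) = 0"
  proof -
    have "h m (j * W + i) = h (m + int (j * W)) i" for i j by (simp add: h_def add_ac)
    then show ?thesis by (simp add: sum_blocks zero)
  qed
  finally have "\<bar>\<Sum>i<L. h m i\<bar> \<le> (\<Sum>i<L mod W. \<bar>h (m + int ((L div W) * W)) i\<bar>)" by simp
  also have "\<dots> \<le> (\<Sum>i<L mod W. 2 * K)" by (intro sum_mono hK)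
  also have "\<dots> = real (L mod W) * (2 * K)" by simp
  also have "\<dots> \<le> real W * (2 * K)"
  proof (rule mult_right_mono)
    show "real (L mod W) \<le> real W" using W0 by (simp add: less_imp_le)
    show "0 \<le> 2 * K" using hK[of 0 0] by linarith
  qed
  finally show ?thesis by (simp add: h_def \<mu>_def W_def mult_ac)
qed

text \<open>Passing from the interval \<open>J\<close> to the index set \<open>N\<close> changes the
  sum by at most \<open>K0\<close> terms of size 2 K; injectivity on \<open>N\<close> then turns
  indices into distinct values.\<close>

lemma equi_image:
  fixes \<phi> :: "int \<Rightarrow> 'a" and rm :: "nat \<Rightarrow> 'a \<Rightarrow> int"
  assumes Q: "finite Q" "\<And>p. p \<in> Q \<Longrightarrow> prime p \<and> equiperm p (\<lambda>n. rm p (\<phi> n))"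
    and N: "finite N" "N \<noteq> {}" "inj_on \<phi> N"
    and K0: "card (N - J) + card (J - N) \<le> K0" and J: "J = (\<lambda>i. m + int i) ` {..<L}"
  shows "equi (\<phi> ` N) (\<lambda>\<alpha>. restrict (\<lambda>p. rm p \<alpha>) Q) (residue_vectors Q)
     ((2 * real (period Q) + 2 * real K0) / real (card (\<phi> ` N)))"
  unfolding equi_def
proof (intro conjI allI impI)
  let ?R = "residue_vectors Q"
  let ?W = "real (period Q)"
  show R: "finite ?R" "?R \<noteq> {}" using Q by (auto simp: finite_PiE PiE_eq_empty_iff dest: prime_gt_0_nat)
  have mem: "restrict (\<lambda>p. rm p (\<phi> n)) Q \<in> ?R" for n
    using Q(2) by (fastforce simp: equiperm_def)
  then show "(\<lambda>\<alpha>. restrict (\<lambda>p. rm p \<alpha>) Q) ` \<phi> ` N \<subseteq> ?R" by blast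
  fix G :: "_ \<Rightarrow> real" and K
  assume G: "\<forall>v\<in>?R. \<bar>G v\<bar> \<le> K"
  define h where "h n = G (restrict (\<lambda>p. rm p (\<phi> n)) Q) - avg ?R G" for n
  have hK: "\<bar>h n\<bar> \<le> 2 * K" for n
  proof -
    have "\<bar>avg ?R G\<bar> \<le> K" using norm_avg_le[OF R, of G K] G by auto
    moreover have "\<bar>G (restrict (\<lambda>p. rm p (\<phi> n)) Q)\<bar> \<le> K" using G mem by blast
    ultimately show ?thesis unfolding h_def by linarith
  qed
  have finJ: "finite J" by (simp add: J)
  have "(\<Sum>n\<in>J. h n) = (\<Sum>i<L. h (m + int i))" unfolding J by (subst sum.reindex) (auto simp: inj_on_def)
  then have sJ: "\<bar>\<Sum>n\<in>J. h n\<bar> \<le> 2 * K * ?W"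
    using sum_interval_equidistribution[OF Q, of G K m L] G by (simp add: h_def)
  have small: "\<bar>\<Sum>n\<in>D. h n\<bar> \<le> real (card D) * (2 * K)" for D
    using sum_abs[of h D] sum_bounded_above[of D "\<lambda>n. \<bar>h n\<bar>" "2 * K"] hK by (meson order_trans)
  have "(\<Sum>n\<in>N. h n) = (\<Sum>n\<in>J. h n) + (\<Sum>n\<in>N - J. h n) - (\<Sum>n\<in>J - N. h n)"
    using sum.Int_Diff[OF N(1), of h J] sum.Int_Diff[OF finJ, of h N] by (simp add: Int_commute)
  then have "\<bar>\<Sum>n\<in>N. h n\<bar> \<le> 2 * K * ?W + real (card (N - J)) * (2 * K) + real (card (J - N)) * (2 * K)"
    using sJ small[of "N - J"] small[of "J - N"] by linarith
  also have "\<dots> = 2 * K * ?W + real (card (N - J) + card (J - N)) * (2 * K)" by (simp add: algebra_simps)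
  also have "\<dots> \<le> 2 * K * ?W + real K0 * (2 * K)"
    using K0 hK[of 0] by (intro add_left_mono mult_right_mono) auto
  finally have b: "\<bar>\<Sum>n\<in>N. h n\<bar> \<le> K * (2 * ?W + 2 * real K0)" by (simp add: algebra_simps)
  have "avg (\<phi> ` N) (\<lambda>\<alpha>. G (restrict (\<lambda>p. rm p \<alpha>) Q)) - avg ?R G = avg N h"
    unfolding h_def avg_diff avg_const[OF N(1,2)] avg_reindex[OF N(3)] by simp
  also have "\<bar>\<dots>\<bar> \<le> K * (2 * ?W + 2 * real K0) / real (card N)"
    unfolding avg_def using b by (simp add: abs_divide divide_right_mono)
  finally show "\<bar>avg (\<phi> ` N) (\<lambda>\<alpha>. G (restrict (\<lambda>p. rm p \<alpha>) Q)) - avg ?R G\<bar>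
     \<le> K * ((2 * ?W + 2 * real K0) / real (card (\<phi> ` N)))"
    using N by (simp add: card_image)
qed (use N in auto)

section \<open>Equidistribution of the coefficient families\<close>

text \<open>The fraction m / d may be unreduced: if \<open>p\<close> divided the reduced denominator
  it would divide the reduced numerator too, against coprimality. Negative powers can thus be
  treated without cancelling.\<close>

lemma rat_mod_char:
  assumes p: "prime p" and q: "q * of_int d = of_int m" and d: "\<not> int p dvd d"
  shows "[rat_mod p q * d = m] (mod int p)"
proof -
  obtain m' d' where md: "quotient_of q = (m', d')" by (cases "quotient_of q")
  have cop: "coprime m' d'" and d0: "d' > 0" using quotient_of_coprime[OF md] quotient_of_denom_pos[OF md] by auto
  have "q = of_int m' / of_int d'" using md by (rule quotient_of_div)
  then have m': "of_int m' = q * of_int d'" using d0 by simp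
  have "of_int m' * of_int d = q * of_int d * of_int d'" unfolding m' by (simp only: mult_ac)
  then have "of_int m' * of_int d = (of_int (m * d') :: rat)" unfolding q by simp
  then have eq: "m' * d = m * d'" by (simp only: of_int_mult[symmetric] of_int_eq_iff)
  have nd': "\<not> int p dvd d'"
  proof
    assume a: "int p dvd d'"
    then have "int p dvd m' * d" unfolding eq by simp
    then have "int p dvd m'" using p d by (simp add: prime_dvd_mult_iff)
    then have "int p dvd 1" using a cop by (metis coprime_common_divisor)
    then show False using prime_gt_1_nat[OF p] by simp
  qed
  then have c: "coprime d' (int p)" using p by (metis coprime_commute prime_imp_coprime prime_nat_int_transfer)
  have "rat_mod p q = (m' * modular_inverse (int p) d') mod int p" by (simp add: rat_mod_def md)
  then have "[rat_mod p q * d' = m' * (modular_inverse (int p) d' * d')] (mod int p)"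
    by (simp add: cong_def mod_simps mult_ac)
  also have "[m' * (modular_inverse (int p) d' * d') = m' * 1] (mod int p)"
    by (intro cong_scalar_left cong_modular_inverse2 c)
  finally have "[rat_mod p q * d' * d = m' * d] (mod int p)" by (simp add: cong_scalar_right)
  then have "[(rat_mod p q * d) * d' = m * d'] (mod int p)" unfolding eq by (simp add: mult_ac)
  then show ?thesis using c by (rule cong_mult_rcancel[THEN iffD1, rotated])
qed

lemma rat_mod_range: "p > 0 \<Longrightarrow> rat_mod p q \<in> {0..<int p}"
  by (auto simp: rat_mod_def split: prod.splits)

lemma rat_mod_eqI:
  assumes p: "prime p" and q: "q * of_int d = of_int m" and d: "\<not> int p dvd d"
    and r: "[r * d = m] (mod int p)"
  shows "rat_mod p q = r mod int p"
proof -
  have "[rat_mod p q * d = r * d] (mod int p)"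
    using rat_mod_char[OF p q d] r cong_sym cong_trans by blast
  moreover have "coprime d (int p)" using p d by (metis coprime_commute prime_imp_coprime prime_nat_int_transfer)
  ultimately have "[rat_mod p q = r] (mod int p)" by (simp add: cong_mult_rcancel)
  then show ?thesis using rat_mod_range[of p q] prime_gt_0_nat[OF p] by (simp add: cong_def)
qed

lemma rat_mod_of_int: "prime p \<Longrightarrow> rat_mod p (of_int m) = m mod int p"
  using prime_gt_1_nat[of p] by (intro rat_mod_eqI[of p _ 1 m]) auto

lemma poly_cong_int:
  fixes f :: "int poly"
  assumes "[x = y] (mod m)" shows "[poly f x = poly f y] (mod m)"
proof (induction f)
  case (pCons a f)
  then show ?case unfolding poly_pCons by (intro cong_add cong_mult cong_refl assms)
qed simp

lemma equiperm_poly: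
  assumes p: "prime p" and bij: "bij_betw (\<lambda>n. poly f n mod int p) {0..<int p} {0..<int p}"
  shows "equiperm p (\<lambda>n. rat_mod p (of_int (poly f n)))"
  unfolding equiperm_def rat_mod_of_int[OF p]
proof (intro conjI allI impI)
  fix n w :: int
  show "poly f n mod int p \<in> {0..<int p}" using prime_gt_0_nat[OF p] by simp
  show "poly f (n + int (p * (p - 1)) * k) mod int p = poly f n mod int p" for k
    unfolding cong_def[symmetric] by (intro poly_cong_int) (simp add: cong_iff_dvd_diff)
  assume "int (p - 1) dvd w" "\<not> int p dvd w"
  have "bij_betw ((\<lambda>n. poly f n mod int p) \<circ> (\<lambda>k. (w * k + n) mod int p)) {0..<int p} {0..<int p}"
    by (rule bij_betw_trans[OF bij_affine_mod[OF p] bij]) fact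
  moreover have "poly f ((w * k + n) mod int p) mod int p = poly f (n + k * w) mod int p" for k
    unfolding cong_def[symmetric] by (intro poly_cong_int) (simp add: cong_def add.commute mult.commute)
  ultimately show "bij_betw (\<lambda>k. poly f (n + k * w) mod int p) {0..<int p} {0..<int p}"
    by (simp add: o_def)
qed

text \<open>Fermat's theorem replaces the exponent by its residue modulo p - 1. For negative
  \<open>n\<close> the value is a fraction whose denominator is a power of c, prime to
  \<open>p\<close>.\<close>

lemma rat_mod_linear_exp:
  assumes p: "prime p" and c: "\<not> int p dvd c"
  shows "rat_mod p (of_int u * of_int c powi n) = (u * c ^ nat (n mod int (p - 1))) mod int p"
proof -
  have p1: "int (p - 1) > 0" using prime_gt_1_nat[OF p] by simp
  define e where "e = nat (n mod int (p - 1))"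
  have e: "int e = n mod int (p - 1)" using p1 by (simp add: e_def)
  have c0: "of_int c \<noteq> (0::rat)" using c by auto
  have npow: "\<not> int p dvd c ^ k" for k using p c prime_dvd_power by (metis prime_nat_int_transfer)
  show ?thesis
  proof (cases "n \<ge> 0")
    case True
    have q: "of_int u * of_int c powi n = (of_int (u * c ^ nat n) :: rat)"
      using True by (simp add: power_int_def)
    have "int (nat n) = int e + int (p - 1) * (n div int (p - 1))" using True e by simp
    moreover have "n div int (p - 1) \<ge> 0" using True p1 by (simp add: pos_imp_zdiv_nonneg_iff)
    ultimately have "nat n = e + (p - 1) * nat (n div int (p - 1))"
      by (metis int_nat_eq nat_int of_nat_add of_nat_mult)
    then have "[c ^ nat n = c ^ e] (mod int p)"
      using cong_scalar_left[OF fermat_power[OF p c], of "(p - 1) * nat (n div int (p - 1))" "c ^ e"]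
      by (simp add: power_add)
    then show ?thesis unfolding q rat_mod_of_int[OF p] e_def[symmetric]
      using cong_scalar_left by (auto simp: cong_def intro: mod_mult_cong)
  next
    case False
    let ?k = "nat (- n)"
    have q: "of_int u * of_int c powi n * of_int (c ^ ?k) = (of_int u :: rat)"
      using False c0 by (simp add: power_int_def field_simps)
    have "int (p - 1) dvd int (e + ?k)"
    proof -
      have "int (e + ?k) = n mod int (p - 1) - n" using False e by simp
      also have "\<dots> = int (p - 1) * (- (n div int (p - 1)))"
        by (simp add: minus_mult_div_eq_mod[symmetric])
      finally show ?thesis by simp
    qed
    then have "(p - 1) dvd e + ?k" by (simp only: of_nat_dvd_iff)
    then have "[c ^ (e + ?k) = 1] (mod int p)" by (rule fermat_power[OF p c])
    then have "[u * c ^ (e + ?k) = u * 1] (mod int p)" by (rule cong_scalar_left)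
    then have "[u * c ^ e * c ^ ?k = u] (mod int p)" by (simp add: power_add mult_ac)
    from rat_mod_eqI[OF p q npow this] show ?thesis by (simp add: e_def)
  qed
qed

text \<open>Along n + k w the exponent is constant modulo p - 1, so the value is affine in
  \<open>k\<close> with slope a w c^e, a unit modulo \<open>p\<close>.\<close>

lemma equiperm_linear_exp:
  assumes p: "prime p" and a: "\<not> int p dvd a" and c: "\<not> int p dvd c"
  shows "equiperm p (\<lambda>n. rat_mod p (of_int (a * n + b) * of_int c powi n))"
  unfolding equiperm_def rat_mod_linear_exp[OF p c]
proof (intro conjI allI impI)
  fix n w :: int
  show "(a * n + b) * c ^ nat (n mod int (p - 1)) mod int p \<in> {0..<int p}" using prime_gt_0_nat[OF p] by simp
  show "(a * (n + int (p * (p - 1)) * k) + b) * c ^ nat ((n + int (p * (p - 1)) * k) mod int (p - 1)) mod int p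
      = (a * n + b) * c ^ nat (n mod int (p - 1)) mod int p" for k
  proof -
    have "(n + int (p * (p - 1)) * k) mod int (p - 1) = n mod int (p - 1)" by (simp add: mod_eq_dvd_iff)
    moreover have "[a * (n + int (p * (p - 1)) * k) + b = a * n + b] (mod int p)"
      by (simp add: cong_iff_dvd_diff algebra_simps)
    ultimately show ?thesis by (metis cong_def cong_scalar_right)
  qed
  assume w: "int (p - 1) dvd w" "\<not> int p dvd w"
  define e where "e = nat (n mod int (p - 1))"
  have "\<not> int p dvd a * w * c ^ e"
  proof
    assume "int p dvd a * w * c ^ e"
    then have "int p dvd c ^ e" using p a w by (simp add: prime_dvd_mult_iff)
    then show False using p c prime_dvd_power by (metis prime_nat_int_transfer)
  qed
  from bij_affine_mod[OF p this, of "(a * n + b) * c ^ e"]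
  have "bij_betw (\<lambda>k. (a * w * c ^ e * k + (a * n + b) * c ^ e) mod int p) {0..<int p} {0..<int p}" .
  moreover have "(a * (n + k * w) + b) * c ^ nat ((n + k * w) mod int (p - 1)) mod int p
      = (a * w * c ^ e * k + (a * n + b) * c ^ e) mod int p" for k
  proof -
    have "(n + k * w) mod int (p - 1) = n mod int (p - 1)" using w(1) by (simp add: mod_eq_dvd_iff)
    then show ?thesis by (simp add: e_def algebra_simps)
  qed
  ultimately show "bij_betw (\<lambda>k. (a * (n + k * w) + b) * c ^ nat ((n + k * w) mod int (p - 1)) mod int p) {0..<int p} {0..<int p}"
    by simp
qed

section \<open>Injective indexing of the value sets\<close>

text \<open>
  Curves are counted without multiplicity, so the values of \<open>\<phi>\<close> have to be indexed injectively. This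
  is possible up to boundedly many exceptions by an interval, although \<open>\<phi>\<close> may be two-to-one:
  for instance \<open>(2 n + 1) (- 1)\<^sup>n\<close> is invariant under \<open>n \<mapsto> - 1 - n\<close>.
\<close>

definition almost_injective :: "(int \<Rightarrow> 'a) \<Rightarrow> bool" where
  "almost_injective \<phi> \<longleftrightarrow> (\<exists>K0::nat. \<forall>A::nat. \<exists>N m L. N \<subseteq> {- int A..int A} \<and> inj_on \<phi> N \<and>
     \<phi> ` N = \<phi> ` {- int A..int A} \<and>
     card (N - (\<lambda>i. m + int i) ` {..<L}) + card ((\<lambda>i. m + int i) ` {..<L} - N) \<le> K0 \<and> A \<le> card N + K0)"

lemma extend_inj_on:
  assumes "X0 \<subseteq> X" "inj_on \<phi> X0"
  obtains N where "X0 \<subseteq> N" "N \<subseteq> X" "inj_on \<phi> N" "\<phi> ` N = \<phi> ` X"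
proof -
  have "\<phi> ` X - \<phi> ` X0 \<subseteq> \<phi> ` X" by blast
  then obtain U where U: "U \<subseteq> X" "inj_on \<phi> U" "\<phi> ` X - \<phi> ` X0 = \<phi> ` U"
    unfolding subset_image_inj by blast
  show thesis
  proof (rule that[of "X0 \<union> U"])
    show "inj_on \<phi> (X0 \<union> U)" using assms U by (auto simp: inj_on_Un)
    show "\<phi> ` (X0 \<union> U) = \<phi> ` X" using assms U by (auto simp: image_Un)
  qed (use assms U in auto)
qed

lemma int_interval_image: "(\<lambda>i. m + int i) ` {..<L} = {m..<m + int L}"
proof (intro equalityI subsetI)
  fix x assume "x \<in> {m..<m + int L}"
  then show "x \<in> (\<lambda>i. m + int i) ` {..<L}" by (intro image_eqI[of _ _ "nat (x - m)"]) auto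
qed auto

text \<open>All indices outside \<open>B\<close> can be kept as representatives, so at most
  \<open>card B\<close> indices of the interval are dropped.\<close>

lemma almost_injectiveI_finite:
  assumes B: "finite B" and inj: "inj_on \<phi> (- B)"
  shows "almost_injective \<phi>"
  unfolding almost_injective_def int_interval_image
proof (intro exI[of _ "card B"] allI)
  fix A :: nat
  let ?X = "{- int A..int A}"
  have "inj_on \<phi> (?X - B)" using inj by (rule inj_on_subset) auto
  then obtain N where N: "?X - B \<subseteq> N" "N \<subseteq> ?X" "inj_on \<phi> N" "\<phi> ` N = \<phi> ` ?X"
    using extend_inj_on[of "?X - B" ?X \<phi>] by blast
  have J: "{- int A..<- int A + int (2 * A + 1)} = ?X" by auto
  have finN: "finite N" using N(2) finite_subset by blast
  have "N - ?X = {}" using N by blast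
  moreover have "card (?X - N) \<le> card B" using N B by (intro card_mono) auto
  moreover have "A \<le> card N + card B"
  proof -
    have "card ?X \<le> card (N \<union> B)" using N B finN by (intro card_mono) auto
    also have "\<dots> \<le> card N + card B" by (rule card_Un_le)
    finally show ?thesis by simp
  qed
  ultimately show "\<exists>N m L. N \<subseteq> ?X \<and> inj_on \<phi> N \<and> \<phi> ` N = \<phi> ` ?X \<and>
      card (N - {m..<m + int L}) + card ({m..<m + int L} - N) \<le> card B \<and> A \<le> card N + card B"
    using N J by (intro exI[of _ N] exI[of _ "- int A"] exI[of _ "2 * A + 1"]) (simp only: J, simp)
qed

text \<open>For odd \<open>s\<close> the reflection fixes no integer, and the half \<open>J\<close>
  beyond s / 2 represents each of its values once. Further representatives are needed only where the
  mirror image leaves the interval, which concerns at most |s| indices at the left end.\<close>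

lemma almost_injectiveI_reflection:
  fixes s :: int
  assumes s: "odd s" and refl: "\<And>n. \<phi> (s - n) = \<phi> n" and coll: "\<And>m n. \<phi> m = \<phi> n \<Longrightarrow> m = n \<or> m = s - n"
  shows "almost_injective \<phi>"
  unfolding almost_injective_def int_interval_image
proof (intro exI[of _ "nat \<bar>s\<bar> + 1"] allI)
  fix A :: nat
  let ?X = "{- int A..int A}"
  \<comment> \<open>For odd \<open>s\<close> the second argument is the least integer above s /
    2.\<close>
  define lo where "lo = max (- int A) (s div 2 + 1)"
  define J where "J = {lo..int A}"
  have "inj_on \<phi> J"
  proof (rule inj_onI)
    fix m n assume mn: "m \<in> J" "n \<in> J" "\<phi> m = \<phi> n"
    then have "2 * m > s" "2 * n > s" using s by (auto simp: J_def lo_def)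
    then show "m = n" using coll[OF mn(3)] by auto
  qed
  moreover have "J \<subseteq> ?X" by (auto simp: J_def lo_def)
  ultimately obtain N where N: "J \<subseteq> N" "N \<subseteq> ?X" "inj_on \<phi> N" "\<phi> ` N = \<phi> ` ?X"
    using extend_inj_on[of J ?X \<phi>] by blast
  have finN: "finite N" using N(2) finite_subset by blast
  have "N - J \<subseteq> {- int A..<s - int A}"
  proof
    fix n assume n: "n \<in> N - J"
    then have nX: "n \<in> ?X" using N by blast
    then have "n < lo" using n by (auto simp: J_def)
    then have n2: "2 * n < s" using nX s by (auto simp: lo_def max_def split: if_splits elim!: oddE)
    \<comment> \<open>Otherwise n and its mirror image in \<open>J\<close> would be two
      representatives of the same value.\<close>
    have "s - n > int A"
    proof (rule ccontr)
      assume "\<not> s - n > int A"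
      then have "s - n \<in> J" using n2 nX s by (auto simp: J_def lo_def)
      then have "s - n \<in> N" using N by blast
      then have "s - n = n" using N(3) refl[of n] n by (auto simp: inj_on_def)
      then show False using n2 by simp
    qed
    then show "n \<in> {- int A..<s - int A}" using nX by auto
  qed
  then have "card (N - J) \<le> card {- int A..<s - int A}" by (intro card_mono) auto
  then have c1: "card (N - J) \<le> nat \<bar>s\<bar>" by simp
  have c2: "J - N = {}" using N by blast
  have "card J \<le> card N" using N finN by (intro card_mono)
  then have c3: "A \<le> card N + (nat \<bar>s\<bar> + 1)" by (simp add: J_def lo_def)
  have J: "{lo..<lo + int (nat (int A - lo + 1))} = J" by (auto simp: J_def)
  show "\<exists>N m L. N \<subseteq> ?X \<and> inj_on \<phi> N \<and> \<phi> ` N = \<phi> ` ?X \<and>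
      card (N - {m..<m + int L}) + card ({m..<m + int L} - N) \<le> nat \<bar>s\<bar> + 1 \<and> A \<le> card N + (nat \<bar>s\<bar> + 1)"
    using N c1 c2 c3 by (intro exI[of _ N] exI[of _ lo] exI[of _ "nat (int A - lo + 1)"]) (simp only: J, simp)
qed

text \<open>A collision of m and n would contradict the permutation property at a prime of
  \<open>P\<close> exceeding |m - n|; the infinitude of \<open>P\<close> provides one.\<close>

lemma almost_injective_poly:
  fixes f :: "int poly"
  assumes P: "infinite P" "\<And>p. p \<in> P \<Longrightarrow> bij_betw (\<lambda>n. poly f n mod int p) {0..<int p} {0..<int p}"
  shows "almost_injective (\<lambda>n. of_int (poly f n) :: rat)"
proof (rule almost_injectiveI_finite[of "{}"])
  show "inj_on (\<lambda>n. of_int (poly f n) :: rat) (- {})"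
  proof (rule inj_onI, rule ccontr)
    fix m n :: int assume mn: "of_int (poly f m) = (of_int (poly f n) :: rat)" "m \<noteq> n"
    then have eq: "poly f m = poly f n" by simp
    obtain p where p: "p \<in> P" "p > nat \<bar>m - n\<bar>"
      using P(1) by (metis infinite_nat_iff_unbounded)
    have p0: "int p > 0" using p by simp
    have "poly f (m mod int p) mod int p = poly f m mod int p" "poly f (n mod int p) mod int p = poly f n mod int p"
      unfolding cong_def[symmetric] by (intro poly_cong_int, simp)+
    then have "poly f (m mod int p) mod int p = poly f (n mod int p) mod int p" using eq by simp
    then have "m mod int p = n mod int p"
      using inj_onD[OF bij_betw_imp_inj_on[OF P(2)[OF p(1)]], of "m mod int p" "n mod int p"] p0 by simp
    then have "int p dvd m - n" by (simp add: mod_eq_dvd_iff)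
    then show False using dvd_imp_le_int[of "m - n" "int p"] mn(2) p by auto
  qed
qed simp

text \<open>For c = 1 the map is affine. For c = -1 every collision is a reflection about one fixed
  centre. For |c| \<ge> 2 exponential growth outruns the linear factor, so the larger index of a
  collision lies in a finite set.\<close>

lemma almost_injective_linear_exp:
  fixes a b c :: int
  assumes a: "a \<noteq> 0" and c: "c \<noteq> 0"
  shows "almost_injective (\<lambda>n. of_int (a * n + b) * of_int c powi n :: rat)" (is "almost_injective ?f")
proof -
  have coll: "(a * n + b) * c ^ nat (n - m) = a * m + b" if "?f n = ?f m" "m \<le> n" for m n
  proof -
    have c0: "of_int c \<noteq> (0::rat)" using c by simp
    have "of_int c powi n = (of_int c powi m * of_int c ^ nat (n - m) :: rat)"
      using that(2) c0 power_int_add[of "of_int c :: rat" m "n - m"] by (simp add: power_int_def[of _ "n - m"])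
    then have "of_int (a * n + b) * of_int c ^ nat (n - m) * of_int c powi m = (of_int (a * m + b) * of_int c powi m :: rat)"
      using that(1) by (simp add: mult_ac)
    then have "of_int (a * n + b) * of_int c ^ nat (n - m) = (of_int (a * m + b) :: rat)"
      using c0 by simp
    then show ?thesis by (simp only: of_int_mult[symmetric] of_int_power[symmetric] of_int_eq_iff)
  qed
  consider "c = 1" | "c = - 1" | "\<bar>c\<bar> \<ge> 2" using c by linarith
  then show ?thesis
  proof cases
    case 1
    have "inj_on ?f (- {})" using a 1 by (auto simp: inj_on_def)
    then show ?thesis by (intro almost_injectiveI_finite[of "{}"]) auto
  next
    case 2
    \<comment> \<open>Indices of equal parity carry the same sign and must coincide; opposite parity
      forces a (n + m) = -2 b.\<close>
    have c2: "even (n - m) \<and> n = m \<or> odd (n - m) \<and> a * (n + m) + 2 * b = 0" if "?f n = ?f m" "m \<le> n" for m n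
    proof (cases "even (n - m)")
      case True
      then have "c ^ nat (n - m) = 1" using 2 that(2) by (simp add: even_nat_iff)
      then show ?thesis using coll[OF that] a True by simp
    next
      case False
      then have "c ^ nat (n - m) = - 1" using 2 that(2) by (simp add: even_nat_iff)
      then show ?thesis using coll[OF that] False by (simp add: algebra_simps)
    qed
    show ?thesis
    proof (cases "inj ?f")
      case True
      then show ?thesis by (intro almost_injectiveI_finite[of "{}"]) (auto simp: Compl_eq_Diff_UNIV)
    next
      case False
      then obtain x y where xy: "?f x = ?f y" "x < y" unfolding inj_def by (metis linorder_neqE)
      \<comment> \<open>One collision fixes the centre: a s = -2 b determines the sum of the two
        indices in every other collision.\<close>
      define s where "s = x + y"
      have s: "odd s" "a * s + 2 * b = 0" using c2[of y x] xy by (auto simp: s_def add.commute)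
      show ?thesis
      proof (rule almost_injectiveI_reflection[OF s(1)])
        fix n :: int
        have "(- 1 :: rat) powi (s - n) = - ((- 1) powi n)"
          using s(1) by (simp add: power_int_minus_one_minus power_int_def minus_one_power_iff even_nat_iff)
        moreover have "a * (s - n) + b = - (a * n + b)" using s(2) by (simp add: algebra_simps)
        ultimately have "?f (s - n) = of_int (- (a * n + b)) * - ((- 1) powi n)"
          using 2 by (simp only: of_int_minus of_int_1)
        then show "?f (s - n) = ?f n" using 2 by (simp only: of_int_minus of_int_1 minus_mult_minus)
      next
        fix m n assume mn: "?f m = ?f n"
        have "m = n \<or> a * (m + n) + 2 * b = 0"
          using c2[of m n] c2[of n m] mn by (metis add.commute linear)
        moreover have "m = s - n" if "a * (m + n) + 2 * b = 0"
        proof -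
          have "a * (m + n) = a * s" using that s(2) by linarith
          then show ?thesis using a by simp
        qed
        ultimately show "m = n \<or> m = s - n" by blast
      qed
    qed
  next
    case 3
    \<comment> \<open>For a collision m < n with d = n - m one gets |a n + b| (|c|^d - 1) \<le> |a|
      d; since |c|^d \<ge> d + 1, the larger index satisfies this condition.\<close>
    define B where "B = {n. \<bar>a * n + b\<bar> \<le> \<bar>a\<bar>}"
    have "B \<subseteq> {- (\<bar>a\<bar> + \<bar>b\<bar>)..\<bar>a\<bar> + \<bar>b\<bar>}"
    proof
      fix n assume "n \<in> B"
      then have "\<bar>a * n\<bar> \<le> \<bar>a\<bar> + \<bar>b\<bar>" by (simp add: B_def)
      moreover have "\<bar>n\<bar> \<le> \<bar>a * n\<bar>" using a using mult_right_mono[of 1 "\<bar>a\<bar>" "\<bar>n\<bar>"] by (simp add: abs_mult)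
      ultimately show "n \<in> {- (\<bar>a\<bar> + \<bar>b\<bar>)..\<bar>a\<bar> + \<bar>b\<bar>}" by auto
    qed
    then have fin: "finite B" by (rule finite_subset) simp
    have inB: "n \<in> B" if "?f n = ?f m" "m < n" for m n
    proof -
      define d where "d = nat (n - m)"
      have d: "int d = n - m" "d > 0" using that by (auto simp: d_def)
      have "\<bar>a * n + b\<bar> * \<bar>c\<bar> ^ d = \<bar>a * m + b\<bar>"
        using coll[OF that(1)] that(2) by (simp add: d_def abs_mult[symmetric] power_abs[symmetric])
      also have "\<dots> \<le> \<bar>a * n + b\<bar> + \<bar>a\<bar> * int d"
      proof -
        have "a * m + b = (a * n + b) - a * int d" by (simp add: d(1) algebra_simps)
        then show ?thesis using abs_triangle_ineq4[of "a * n + b" "a * int d"] by (simp add: abs_mult)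
      qed
      finally have 1: "\<bar>a * n + b\<bar> * (\<bar>c\<bar> ^ d - 1) \<le> \<bar>a\<bar> * int d" by (simp add: algebra_simps)
      have "int d + 1 \<le> 2 ^ d" using less_exp[of d] by (metis Suc_eq_plus1 Suc_leI of_nat_1 of_nat_add of_nat_le_iff of_nat_numeral of_nat_power)
      also have "(2::int) ^ d \<le> \<bar>c\<bar> ^ d" using 3 by (intro power_mono) auto
      finally have "\<bar>a * n + b\<bar> * int d \<le> \<bar>a * n + b\<bar> * (\<bar>c\<bar> ^ d - 1)" by (intro mult_left_mono) auto
      then have "\<bar>a * n + b\<bar> * int d \<le> \<bar>a\<bar> * int d" using 1 by linarith
      then show ?thesis using d(2) by (simp add: B_def mult_le_cancel_right)
    qed
    have "inj_on ?f (- B)"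
      by (rule inj_onI) (metis ComplD inB linorder_neqE)
    then show ?thesis using fin by (rule almost_injectiveI_finite[rotated])
  qed
qed

abbreviation rat_residues :: "nat set \<Rightarrow> rat \<Rightarrow> nat \<Rightarrow> int" where
  "rat_residues Q \<alpha> \<equiv> restrict (\<lambda>p. rat_mod p \<alpha>) Q"

text \<open>One constant, independent of \<open>A\<close> and \<open>Q\<close>, bounds the values
  lost by collisions and the boundary error, and tells from where on \<open>A\<close> is large
  enough.\<close>

definition equidistributed_values :: "nat set \<Rightarrow> (int \<Rightarrow> rat) \<Rightarrow> nat \<Rightarrow> bool" where
  "equidistributed_values P \<phi> K \<longleftrightarrow> (\<forall>A Q. A > K \<longrightarrow> finite Q \<longrightarrow> Q \<subseteq> P \<longrightarrow>
     A \<le> card (\<phi> ` {- int A..int A}) + K \<and>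
     equi (\<phi> ` {- int A..int A}) (rat_residues Q) (residue_vectors Q)
       ((2 * real (period Q) + 2 * real K) / real (card (\<phi> ` {- int A..int A}))))"

lemma exists_equidistributed_values:
  assumes ai: "almost_injective \<phi>"
    and P: "\<And>p. p \<in> P \<Longrightarrow> prime p \<and> equiperm p (\<lambda>n. rat_mod p (\<phi> n))"
  shows "\<exists>K. equidistributed_values P \<phi> K"
proof -
  obtain K where K: "\<And>A::nat. \<exists>N m L. N \<subseteq> {- int A..int A} \<and> inj_on \<phi> N \<and>
     \<phi> ` N = \<phi> ` {- int A..int A} \<and>
     card (N - (\<lambda>i. m + int i) ` {..<L}) + card ((\<lambda>i. m + int i) ` {..<L} - N) \<le> K \<and> A \<le> card N + K"
    using ai unfolding almost_injective_def by blast
  have "equidistributed_values P \<phi> K"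
    unfolding equidistributed_values_def
  proof (intro allI impI)
    fix A Q assume A: "A > K" and Q: "finite Q" "Q \<subseteq> P"
    obtain N m L where N: "N \<subseteq> {- int A..int A}" "inj_on \<phi> N" "\<phi> ` N = \<phi> ` {- int A..int A}"
       "card (N - (\<lambda>i. m + int i) ` {..<L}) + card ((\<lambda>i. m + int i) ` {..<L} - N) \<le> K" "A \<le> card N + K"
      using K[of A] by blast
    have fin: "finite N" using N(1) finite_subset by blast
    have ne: "N \<noteq> {}" using N(5) A by auto
    have "equi (\<phi> ` N) (rat_residues Q) (residue_vectors Q)
       ((2 * real (period Q) + 2 * real K) / real (card (\<phi> ` N)))"
      using Q P by (intro equi_image[OF _ _ fin ne N(2) N(4) refl]) auto
    then show "A \<le> card (\<phi> ` {- int A..int A}) + K \<and>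
     equi (\<phi> ` {- int A..int A}) (rat_residues Q) (residue_vectors Q)
       ((2 * real (period Q) + 2 * real K) / real (card (\<phi> ` {- int A..int A})))"
      unfolding N(3)[symmetric] using N(2,5) by (simp add: card_image)
  qed
  then show ?thesis ..
qed

section \<open>Pairs of curves\<close>

text \<open>Symmetry in y forces s = t = 0. The second difference of the cubic at 0 is 6 u^4 r,
  which gives r = 0, and the remaining coefficients are read off at x = 0 and x = 1.\<close>

lemma curve_iso_scaling:
  assumes "curve_iso (\<alpha>, \<beta>) (\<alpha>', \<beta>')"
  obtains u where "u \<noteq> 0" "\<alpha> = u ^ 4 * \<alpha>'" "\<beta> = u ^ 6 * \<beta>'"
proof -
  from assms obtain u r s t :: rat where u: "u \<noteq> 0" and eq: "\<And>x y.
      (u ^ 3 * y + s * u ^ 2 * x + t) ^ 2 - ((u ^ 2 * x + r) ^ 3 + \<alpha> * (u ^ 2 * x + r) + \<beta>)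
        = u ^ 6 * (y ^ 2 - (x ^ 3 + \<alpha>' * x + \<beta>'))"
    unfolding curve_iso_def weierstrass_def by (auto simp: add.assoc)
  have sq: "(u ^ 3 * y + s * u ^ 2 * x + t) ^ 2
      = u ^ 6 * (y ^ 2 - (x ^ 3 + \<alpha>' * x + \<beta>')) + ((u ^ 2 * x + r) ^ 3 + \<alpha> * (u ^ 2 * x + r) + \<beta>)" for x y
    using eq[where x = x and y = y] by (simp only: diff_eq_eq)
  have st: "s * u ^ 2 * x + t = 0" for x
  proof -
    have "(u ^ 3 * 1 + s * u ^ 2 * x + t) ^ 2 = (u ^ 3 * (- 1) + s * u ^ 2 * x + t) ^ 2"
      unfolding sq by simp
    moreover have "(u ^ 3 * 1 + s * u ^ 2 * x + t) ^ 2 - (u ^ 3 * (- 1) + s * u ^ 2 * x + t) ^ 2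
        = 4 * u ^ 3 * (s * u ^ 2 * x + t)" by (simp add: power2_eq_square algebra_simps)
    ultimately have "4 * u ^ 3 * (s * u ^ 2 * x + t) = 0" by simp
    then show ?thesis using u by simp
  qed
  have t: "t = 0" using st[of 0] by simp
  have s: "s = 0" using st[of 1] t u by simp
  have f: "(u ^ 2 * x + r) ^ 3 + \<alpha> * (u ^ 2 * x + r) + \<beta> = u ^ 6 * (x ^ 3 + \<alpha>' * x + \<beta>')" for x
    using eq[where x = x and y = 0] s t by (simp add: algebra_simps)
  have "6 * u ^ 4 * r = 0"
  proof -
    define h where "h x = (u ^ 2 * x + r) ^ 3 + \<alpha> * (u ^ 2 * x + r) + \<beta>" for x
    have "h 1 + h (- 1) - 2 * h 0 = 6 * u ^ 4 * r"
      by (simp add: h_def power3_eq_cube power4_eq_xxxx power2_eq_square algebra_simps)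
    moreover have "h 1 + h (- 1) - 2 * h 0 = 0"
      unfolding h_def f by (simp add: algebra_simps)
    ultimately show ?thesis by simp
  qed
  then have r: "r = 0" using u by simp
  have b: "\<beta> = u ^ 6 * \<beta>'" using f[of 0] r by simp
  have "u ^ 6 + \<alpha> * u ^ 2 = u ^ 6 + u ^ 6 * \<alpha>'"
    using f[of 1] r b by (simp add: algebra_simps power_mult[symmetric])
  then have "\<alpha> * u ^ 2 = (u ^ 4 * \<alpha>') * u ^ 2" by (simp add: power_add[symmetric] mult_ac)
  then have "\<alpha> = u ^ 4 * \<alpha>'" using u by simp
  then show thesis using that u b by blast
qed

lemma cube_inject: "x ^ 3 = y ^ 3 \<Longrightarrow> x = (y :: rat)"
proof -
  assume "x ^ 3 = y ^ 3"
  then have "(x - y) * ((2 * x + y) ^ 2 + 3 * y ^ 2) = 0"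
    by (simp add: power2_eq_square power3_eq_cube algebra_simps)
  then have "x = y \<or> (2 * x + y) ^ 2 + 3 * y ^ 2 = 0" by simp
  moreover have "x = y" if h: "(2 * x + y) ^ 2 + 3 * y ^ 2 = 0"
  proof -
    have "(2 * x + y) ^ 2 = 0" "y ^ 2 = 0"
      using h zero_le_power2[of "2 * x + y"] zero_le_power2[of y] by linarith+
    then show ?thesis by simp
  qed
  ultimately show ?thesis by blast
qed

definition full_pairs :: "rat set \<Rightarrow> rat set \<Rightarrow> (curve \<times> curve) set" where
  "full_pairs \<Phi> \<Psi> = (\<Phi> \<times> \<Psi>) \<times> (\<Phi> \<times> \<Psi>)"

definition good_pairs :: "rat set \<Rightarrow> rat set \<Rightarrow> (curve \<times> curve) set" where
  "good_pairs \<Phi> \<Psi> = {(E, E') \<in> full_pairs \<Phi> \<Psi>. is_elliptic E \<and> is_elliptic E' \<and> \<not> curve_iso E E'}"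

lemma curve_pairs_eq:
  "curve_pairs \<phi> \<psi> A B = good_pairs (\<phi> ` {- int A..int A}) (\<psi> ` {- int B..int B})"
proof -
  have "\<bar>a\<bar> \<le> int n \<longleftrightarrow> a \<in> {- int n..int n}" for a n by auto
  then show ?thesis
    unfolding curve_pairs_def good_pairs_def full_pairs_def by (simp only:) blast
qed

text \<open>In each case three of the four coefficients determine the fourth. A vanishing
  discriminant determines \<alpha> from \<beta>, as cubing is injective on the rationals. In an
  isomorphic pair with \<alpha> nonzero, the first coefficients determine u^4, hence u^2 by
  positivity, hence the last coefficient. For \<alpha> = 0 they leave u free, so those pairs are
  counted apart.\<close>

lemma card_bad_pairs:
  assumes "finite \<Phi>" "finite \<Psi>"
  shows "card (full_pairs \<Phi> \<Psi> - good_pairs \<Phi> \<Psi>)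
     \<le> 3 * (card \<Phi> * (card \<Psi>)\<^sup>2) + (card \<Phi>)\<^sup>2 * card \<Psi>"
proof -
  let ?U = "full_pairs \<Phi> \<Psi>"
  define B1 where "B1 = {((\<alpha>, \<beta>), E') \<in> ?U. \<not> is_elliptic (\<alpha>, \<beta>)}"
  define B2 where "B2 = {(E, (\<alpha>, \<beta>)) \<in> ?U. \<not> is_elliptic (\<alpha>, \<beta>)}"
  define B3 where "B3 = {((\<alpha>, \<beta>), E') \<in> ?U. \<alpha> = 0}"
  define B4 where "B4 = {((\<alpha>, \<beta>), E') \<in> ?U. \<alpha> \<noteq> 0 \<and> curve_iso (\<alpha>, \<beta>) E'}"
  have ell: "\<alpha> = \<gamma>" if "\<not> is_elliptic (\<alpha>, \<beta>)" "\<not> is_elliptic (\<gamma>, \<beta>)" for \<alpha> \<beta> \<gamma>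
    using that by (auto simp: is_elliptic_def intro!: cube_inject[of \<alpha> \<gamma>])
  have sub: "?U - good_pairs \<Phi> \<Psi> \<subseteq> B1 \<union> B2 \<union> (B3 \<union> B4)"
    by (auto simp: good_pairs_def B1_def B2_def B3_def B4_def)
  have fin: "finite ?U" using assms by (simp add: full_pairs_def)
  have finB: "finite B1" "finite B2" "finite B3" "finite B4"
    by (auto intro!: finite_subset[OF _ fin] simp: B1_def B2_def B3_def B4_def)
  have c1: "card B1 \<le> card (\<Psi> \<times> (\<Phi> \<times> \<Psi>))"
  proof (rule card_inj_on_le)
    show "inj_on (\<lambda>((\<alpha>, \<beta>), E'). (\<beta>, E')) B1" using ell by (auto simp: inj_on_def B1_def)
  qed (use assms in \<open>auto simp: B1_def full_pairs_def\<close>)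
  have c2: "card B2 \<le> card (\<Psi> \<times> (\<Phi> \<times> \<Psi>))"
  proof (rule card_inj_on_le)
    show "inj_on (\<lambda>(E, (\<alpha>, \<beta>)). (\<beta>, E)) B2" using ell by (auto simp: inj_on_def B2_def)
  qed (use assms in \<open>auto simp: B2_def full_pairs_def\<close>)
  have c3: "card B3 \<le> card (\<Psi> \<times> (\<Phi> \<times> \<Psi>))"
  proof (rule card_inj_on_le)
    show "inj_on (\<lambda>((\<alpha>, \<beta>), E'). (\<beta>, E')) B3" by (auto simp: inj_on_def B3_def)
  qed (use assms in \<open>auto simp: B3_def full_pairs_def\<close>)
  have iso: "\<beta>' = \<beta>''" if a: "\<alpha> \<noteq> 0" "curve_iso (\<alpha>, \<beta>) (\<alpha>', \<beta>')" "curve_iso (\<alpha>, \<beta>) (\<alpha>', \<beta>'')" for \<alpha> \<beta> \<alpha>' \<beta>' \<beta>''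
  proof -
    obtain u where u: "u \<noteq> 0" "\<alpha> = u ^ 4 * \<alpha>'" "\<beta> = u ^ 6 * \<beta>'" using curve_iso_scaling[OF a(2)] by blast
    obtain v where v: "v \<noteq> 0" "\<alpha> = v ^ 4 * \<alpha>'" "\<beta> = v ^ 6 * \<beta>''" using curve_iso_scaling[OF a(3)] by blast
    have "u ^ 4 = v ^ 4" using u v a(1) by auto
    then have "(u\<^sup>2)\<^sup>2 = (v\<^sup>2)\<^sup>2" by (simp add: power_mult[symmetric])
    then have "u\<^sup>2 = v\<^sup>2" by (rule power2_eq_imp_eq) auto
    then have "u ^ 6 = v ^ 6" using power_mult[of u 2 3] power_mult[of v 2 3] by simp
    then show ?thesis using u v by simp
  qed
  have c4: "card B4 \<le> card ((\<Phi> \<times> \<Psi>) \<times> \<Phi>)"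
  proof (rule card_inj_on_le)
    show "inj_on (\<lambda>(E, (\<alpha>', \<beta>')). (E, \<alpha>')) B4" using iso by (auto simp: inj_on_def B4_def)
  qed (use assms in \<open>auto simp: B4_def full_pairs_def\<close>)
  have "card (?U - good_pairs \<Phi> \<Psi>) \<le> card (B1 \<union> B2 \<union> (B3 \<union> B4))" using finB sub by (intro card_mono) auto
  also have "\<dots> \<le> card B1 + card B2 + (card B3 + card B4)"
    by (meson add_mono card_Un_le order_trans)
  also have "\<dots> \<le> 3 * (card \<Phi> * (card \<Psi>)\<^sup>2) + (card \<Phi>)\<^sup>2 * card \<Psi>"
    using c1 c2 c3 c4 by (simp add: card_cartesian_product power2_eq_square mult_ac)
  finally show ?thesis .
qed

lemma bad_ratio:
  assumes "finite \<Phi>" "finite \<Psi>" "\<Phi> \<noteq> {}" "\<Psi> \<noteq> {}"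
  shows "real (card (full_pairs \<Phi> \<Psi> - good_pairs \<Phi> \<Psi>)) / real (card (full_pairs \<Phi> \<Psi>))
     \<le> 3 / real (card \<Phi>) + 1 / real (card \<Psi>)"
proof -
  define f g where "f = real (card \<Phi>)" and "g = real (card \<Psi>)"
  have pos: "f > 0" "g > 0" using assms by (auto simp: f_def g_def card_gt_0_iff)
  have U: "real (card (full_pairs \<Phi> \<Psi>)) = f\<^sup>2 * g\<^sup>2"
    by (simp add: full_pairs_def card_cartesian_product f_def g_def power2_eq_square)
  have "real (card (full_pairs \<Phi> \<Psi> - good_pairs \<Phi> \<Psi>)) \<le> 3 * (f * g\<^sup>2) + f\<^sup>2 * g"
    using card_bad_pairs[OF assms(1,2)] unfolding f_def g_def
    by (metis (mono_tags, lifting) of_nat_add of_nat_le_iff of_nat_mult of_nat_numeral of_nat_power)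
  then have "real (card (full_pairs \<Phi> \<Psi> - good_pairs \<Phi> \<Psi>)) / (f\<^sup>2 * g\<^sup>2) \<le> (3 * (f * g\<^sup>2) + f\<^sup>2 * g) / (f\<^sup>2 * g\<^sup>2)"
    using pos by (intro divide_right_mono) auto
  also have "\<dots> = 3 / f + 1 / g" using pos by (simp add: field_simps power2_eq_square)
  finally show ?thesis unfolding U by (simp add: f_def g_def)
qed

text \<open>Up to sign the difference is the mean over \<open>U\<close> of g minus
  \<open>avg T g\<close>, to which only U - T contributes.\<close>

lemma avg_subset_diff:
  fixes g :: "'a \<Rightarrow> real"
  assumes "finite U" "T \<subseteq> U" "T \<noteq> {}" and K: "\<And>x. x \<in> U \<Longrightarrow> \<bar>g x\<bar> \<le> K"
  shows "\<bar>avg T g - avg U g\<bar> \<le> 2 * K * (real (card (U - T)) / real (card U))"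
proof -
  have finT: "finite T" using assms finite_subset by blast
  have cT: "real (card T) > 0" using finT assms by (simp add: card_gt_0_iff)
  have cU: "real (card U) > 0" using assms by (auto simp: card_gt_0_iff)
  have card: "real (card U) = real (card T) + real (card (U - T))"
    using assms finT by (simp add: card_Diff_subset card_mono of_nat_diff)
  have aT: "\<bar>avg T g\<bar> \<le> K" using norm_avg_le[OF finT assms(3), of g K] K assms(2) by auto
  have "\<bar>\<Sum>x\<in>U - T. g x - avg T g\<bar> \<le> (\<Sum>x\<in>U - T. \<bar>g x - avg T g\<bar>)" by (rule sum_abs)
  also have "\<dots> \<le> (\<Sum>x\<in>U - T. 2 * K)"
  proof (rule sum_mono)
    fix x assume "x \<in> U - T"
    then show "\<bar>g x - avg T g\<bar> \<le> 2 * K" using K[of x] aT by auto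
  qed
  also have "\<dots> = 2 * K * real (card (U - T))" by simp
  finally have b: "\<bar>\<Sum>x\<in>U - T. g x - avg T g\<bar> \<le> 2 * K * real (card (U - T))" .
  have "(\<Sum>x\<in>U. g x) = (\<Sum>x\<in>U - T. g x) + (\<Sum>x\<in>T. g x)" using assms by (intro sum.subset_diff) auto
  also have "(\<Sum>x\<in>T. g x) = real (card T) * avg T g" using cT by (simp add: avg_def)
  finally have "(\<Sum>x\<in>U. g x) - real (card U) * avg T g = (\<Sum>x\<in>U - T. g x - avg T g)"
    unfolding card by (simp add: sum_subtractf algebra_simps)
  then have "avg U g - avg T g = (\<Sum>x\<in>U - T. g x - avg T g) / real (card U)"
    using cU by (simp add: avg_def field_simps)
  then have "\<bar>avg T g - avg U g\<bar> = \<bar>\<Sum>x\<in>U - T. g x - avg T g\<bar> / real (card U)"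
    using cU by (subst abs_minus_commute) simp
  also have "\<dots> \<le> 2 * K * real (card (U - T)) / real (card U)" using b by (rule divide_right_mono) simp
  finally show ?thesis by simp
qed

section \<open>Transfer of trace products to residue vectors\<close>

definition prodtrace :: "nat \<Rightarrow> (int \<times> int) \<times> (int \<times> int) \<Rightarrow> real" where
  "prodtrace p = (\<lambda>((a, b), (a', b')). real_of_int (ftrace p a b) * real_of_int (ftrace p a' b') / real p)"

text \<open>529 = 23^2 comes from \<open>weak_hasse\<close> applied to both factors.\<close>

lemma prodtrace_bound:
  assumes p: "prime p" shows "\<bar>prodtrace p z\<bar> \<le> 529"
proof -
  obtain a b a' b' where z: "z = ((a, b), (a', b'))" by (metis surj_pair)
  have p0: "real p > 0" using prime_gt_0_nat[OF p] by simp
  have "\<bar>real_of_int (ftrace p a b)\<bar> * \<bar>real_of_int (ftrace p a' b')\<bar>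
      \<le> (23 * sqrt (real p)) * (23 * sqrt (real p))"
    using weak_hasse[OF p] by (intro mult_mono) auto
  also have "\<dots> = 529 * real p" by simp
  finally show ?thesis using p0 by (simp add: z prodtrace_def abs_mult field_simps)
qed

definition coords :: "nat \<Rightarrow> ((nat \<Rightarrow> int) \<times> (nat \<Rightarrow> int)) \<times> ((nat \<Rightarrow> int) \<times> (nat \<Rightarrow> int)) \<Rightarrow> (int \<times> int) \<times> (int \<times> int)" where
  "coords p = map_prod (map_prod (\<lambda>v. v p) (\<lambda>v. v p)) (map_prod (\<lambda>v. v p) (\<lambda>v. v p))"

text \<open>Sample space of the independent model: one residue vector for each of the four
  coefficients, nested as in \<open>full_pairs\<close> so that \<open>equi_prod\<close> applies to
  both.\<close>

definition model :: "nat set \<Rightarrow> (((nat \<Rightarrow> int) \<times> (nat \<Rightarrow> int)) \<times> ((nat \<Rightarrow> int) \<times> (nat \<Rightarrow> int))) set" where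
  "model Q = (residue_vectors Q \<times> residue_vectors Q) \<times> (residue_vectors Q \<times> residue_vectors Q)"

lemma norm_trace_mult:
  "norm_trace (\<alpha>, \<beta>) p * norm_trace (\<alpha>', \<beta>') p
     = prodtrace p ((rat_mod p \<alpha>, rat_mod p \<beta>), (rat_mod p \<alpha>', rat_mod p \<beta>'))"
  by (simp add: norm_trace_def frob_trace_eq prodtrace_def)

text \<open>The product depends only on residues at the primes in \<open>Q\<close>, which also
  covers repetitions among the \<open>g i\<close>. The averages over \<open>full_pairs\<close> and
  over \<open>model S\<close> are both compared with \<open>model Q\<close>, and passing to
  \<open>good_pairs\<close> costs the share of bad pairs.\<close>

lemma compare_product:
  fixes S :: "nat set" and \<Phi> \<Psi> :: "rat set"
  assumes S: "finite S" "\<And>p. p \<in> S \<Longrightarrow> prime p"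
    and g: "g \<in> {..<r} \<rightarrow> S" and Q: "Q = g ` {..<r}"
    and \<Phi>: "equi \<Phi> (rat_residues Q) (residue_vectors Q) \<delta>"
    and \<Psi>: "equi \<Psi> (rat_residues Q) (residue_vectors Q) \<epsilon>"
    and ne: "good_pairs \<Phi> \<Psi> \<noteq> {}"
  shows "\<bar>avg (good_pairs \<Phi> \<Psi>) (\<lambda>(E, E'). \<Prod>i<r. norm_trace E (g i) * norm_trace E' (g i))
      - avg (model S) (\<lambda>z. \<Prod>i<r. prodtrace (g i) (coords (g i) z))\<bar>
    \<le> 529 ^ r * (2 * (3 / real (card \<Phi>) + 1 / real (card \<Psi>)) + 2 * \<delta> + 2 * \<epsilon>)"
proof -
  define \<rho> where "\<rho> \<alpha> = restrict (\<lambda>p. rat_mod p \<alpha>) Q" for \<alpha>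
  define G where "G z = (\<Prod>i<r. prodtrace (g i) (coords (g i) z))" for z
  have QS: "Q \<subseteq> S" using g Q by auto
  have G: "\<bar>G z\<bar> \<le> 529 ^ r" for z
  proof -
    have "\<bar>G z\<bar> = (\<Prod>i<r. \<bar>prodtrace (g i) (coords (g i) z)\<bar>)" by (simp add: G_def abs_prod)
    also have "\<dots> \<le> (\<Prod>i<r. 529)"
      using g S(2) by (intro prod_mono conjI prodtrace_bound) auto
    finally show ?thesis by simp
  qed
  define \<rho>4 where "\<rho>4 = map_prod (map_prod \<rho> \<rho>) (map_prod \<rho> \<rho>)"
  have 1: "equi (full_pairs \<Phi> \<Psi>) \<rho>4 (model Q) (\<delta> + \<epsilon> + (\<delta> + \<epsilon>))"
    unfolding full_pairs_def model_def \<rho>4_def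
    using \<Phi> \<Psi> by (intro equi_prod) (simp_all add: \<rho>_def[abs_def])
  define \<sigma> where "\<sigma> v = restrict v Q" for v :: "nat \<Rightarrow> int"
  have r0: "equi (residue_vectors S) \<sigma> (residue_vectors Q) 0"
    unfolding \<sigma>_def[abs_def] using S QS
    by (intro equi_restrict) (auto dest: prime_gt_0_nat)
  define \<sigma>4 where "\<sigma>4 = map_prod (map_prod \<sigma> \<sigma>) (map_prod \<sigma> \<sigma>)"
  have 2: "equi (model S) \<sigma>4 (model Q) (0 + 0 + (0 + 0))"
    unfolding model_def \<sigma>4_def by (intro equi_prod r0)
  have "\<bar>avg (full_pairs \<Phi> \<Psi>) (\<lambda>z. G (\<rho>4 z)) - avg (model Q) G\<bar> \<le> 529 ^ r * (\<delta> + \<epsilon> + (\<delta> + \<epsilon>))"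
    using 1 G unfolding equi_def by blast
  moreover have "\<bar>avg (model S) (\<lambda>z. G (\<sigma>4 z)) - avg (model Q) G\<bar> \<le> 529 ^ r * (0 + 0 + (0 + 0))"
    using 2 G unfolding equi_def by blast
  moreover have "\<bar>avg (good_pairs \<Phi> \<Psi>) (\<lambda>z. G (\<rho>4 z)) - avg (full_pairs \<Phi> \<Psi>) (\<lambda>z. G (\<rho>4 z))\<bar>
      \<le> 2 * 529 ^ r * (3 / real (card \<Phi>) + 1 / real (card \<Psi>))"
  proof -
    have fin: "finite \<Phi>" "finite \<Psi>" "\<Phi> \<noteq> {}" "\<Psi> \<noteq> {}" using \<Phi> \<Psi> by (auto simp: equi_def)
    have "\<bar>avg (good_pairs \<Phi> \<Psi>) (\<lambda>z. G (\<rho>4 z)) - avg (full_pairs \<Phi> \<Psi>) (\<lambda>z. G (\<rho>4 z))\<bar>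
      \<le> 2 * 529 ^ r * (real (card (full_pairs \<Phi> \<Psi> - good_pairs \<Phi> \<Psi>)) / real (card (full_pairs \<Phi> \<Psi>)))"
      using fin ne G by (intro avg_subset_diff) (auto simp: full_pairs_def good_pairs_def)
    also have "\<dots> \<le> 2 * 529 ^ r * (3 / real (card \<Phi>) + 1 / real (card \<Psi>))"
      by (intro mult_left_mono bad_ratio fin) auto
    finally show ?thesis .
  qed
  moreover have "G (\<sigma>4 z) = (\<Prod>i<r. prodtrace (g i) (coords (g i) z))" for z
  proof -
    obtain a b a' b' where z: "z = ((a, b), (a', b'))" by (metis surj_pair)
    show ?thesis unfolding G_def z
      using Q by (intro prod.cong refl) (auto simp: coords_def \<sigma>4_def \<sigma>_def)
  qed
  moreover have "G (\<rho>4 z) = (case z of (E, E') \<Rightarrow> \<Prod>i<r. norm_trace E (g i) * norm_trace E' (g i))" for z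
  proof -
    obtain a b a' b' where z: "z = ((a, b), (a', b'))" by (metis surj_pair)
    show ?thesis unfolding G_def z prod.case norm_trace_mult
      using Q by (intro prod.cong refl) (auto simp: coords_def \<rho>4_def \<rho>_def)
  qed
  ultimately show ?thesis by (simp add: algebra_simps)
qed

lemma power_sum_PiE:
  fixes f :: "'a \<Rightarrow> real"
  assumes "finite S"
  shows "(\<Sum>p\<in>S. f p) ^ r = (\<Sum>g\<in>PiE {..<r} (\<lambda>_. S). \<Prod>i<r. f (g i))"
  using prod_sum_PiE[of "{..<r}" "\<lambda>_. S" "\<lambda>_. f"] assms by simp

text \<open>The r-th power expands into \<open>card S ^ r\<close> products over r primes, each
  covered by \<open>compare_product\<close>.\<close>

lemma compare_moment:
  fixes S :: "nat set" and \<Phi> \<Psi> :: "rat set"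
  assumes S: "finite S" "\<And>p. p \<in> S \<Longrightarrow> prime p"
    and eq: "\<And>Q. Q \<subseteq> S \<Longrightarrow> card Q \<le> r \<Longrightarrow>
       equi \<Phi> (rat_residues Q) (residue_vectors Q) \<delta> \<and>
       equi \<Psi> (rat_residues Q) (residue_vectors Q) \<epsilon>"
    and ne: "good_pairs \<Phi> \<Psi> \<noteq> {}"
  shows "\<bar>avg (good_pairs \<Phi> \<Psi>) (\<lambda>(E, E'). (\<Sum>p\<in>S. norm_trace E p * norm_trace E' p) ^ r)
      - avg (model S) (\<lambda>z. (\<Sum>p\<in>S. prodtrace p (coords p z)) ^ r)\<bar>
    \<le> real (card S) ^ r * (529 ^ r * (2 * (3 / real (card \<Phi>) + 1 / real (card \<Psi>)) + 2 * \<delta> + 2 * \<epsilon>))"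
proof -
  let ?T = "good_pairs \<Phi> \<Psi>" and ?F = "PiE {..<r} (\<lambda>_. S)"
  let ?b = "529 ^ r * (2 * (3 / real (card \<Phi>) + 1 / real (card \<Psi>)) + 2 * \<delta> + 2 * \<epsilon>)"
  let ?X = "\<lambda>g. avg ?T (\<lambda>(E, E'). \<Prod>i<r. norm_trace E (g i) * norm_trace E' (g i))"
  let ?Y = "\<lambda>g. avg (model S) (\<lambda>z. \<Prod>i<r. prodtrace (g i) (coords (g i) z))"
  have fin: "finite ?F" using S by (intro finite_PiE) auto
  have 1: "avg ?T (\<lambda>(E, E'). (\<Sum>p\<in>S. norm_trace E p * norm_trace E' p) ^ r)
      = (\<Sum>g\<in>?F. ?X g)"
    unfolding avg_sum[symmetric] by (intro avg_cong) (auto simp: power_sum_PiE[OF S(1)])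
  have 2: "avg (model S) (\<lambda>z. (\<Sum>p\<in>S. prodtrace p (coords p z)) ^ r)
      = (\<Sum>g\<in>?F. ?Y g)"
    unfolding avg_sum[symmetric] by (intro avg_cong) (simp add: power_sum_PiE[OF S(1)])
  have "\<bar>?X g
      - ?Y g\<bar> \<le> ?b" if "g \<in> ?F" for g
  proof -
    have "g ` {..<r} \<subseteq> S" using that by auto
    moreover have "card (g ` {..<r}) \<le> r" using card_image_le[of "{..<r}" g] by simp
    ultimately show ?thesis
      using eq[of "g ` {..<r}"] that by (intro compare_product[OF S _ refl _ _ ne]) auto
  qed
  then have "(\<Sum>g\<in>?F. \<bar>?X g
      - ?Y g\<bar>) \<le> real (card ?F) * ?b"
    by (intro sum_bounded_above)
  moreover have "card ?F = card S ^ r" by (simp add: card_PiE)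
  ultimately show ?thesis
    unfolding 1 2 sum_subtractf[symmetric] by (intro order_trans[OF sum_abs]) simp
qed

section \<open>The independent model\<close>

definition cell :: "nat \<Rightarrow> ((int \<times> int) \<times> (int \<times> int)) set" where
  "cell p = ({0..<int p} \<times> {0..<int p}) \<times> ({0..<int p} \<times> {0..<int p})"

lemma finite_cell: "finite (cell p)"
  by (simp add: cell_def)

lemma cell_nonempty: "prime p \<Longrightarrow> cell p \<noteq> {}"
  using prime_gt_0_nat[of p] by (auto simp: cell_def)

lemma avg_PiE:
  fixes h :: "'a \<Rightarrow> 'b \<Rightarrow> 'c::real_normed_field"
  assumes "finite S" "\<And>p. p \<in> S \<Longrightarrow> finite (R p)"
  shows "avg (PiE S R) (\<lambda>v. \<Prod>p\<in>S. h p (v p)) = (\<Prod>p\<in>S. avg (R p) (h p))"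
  using assms by (simp add: avg_def prod_sum_PiE[symmetric] card_PiE prod_dividef)

lemma avg_residue_vectors_pair:
  fixes h :: "nat \<Rightarrow> int \<times> int \<Rightarrow> 'c::real_normed_field"
  assumes S: "finite S"
  shows "avg (residue_vectors S \<times> residue_vectors S) (\<lambda>z. \<Prod>p\<in>S. h p (fst z p, snd z p))
     = (\<Prod>p\<in>S. avg ({0..<int p} \<times> {0..<int p}) (h p))"
proof -
  have "avg (residue_vectors S) (\<lambda>v. avg (residue_vectors S) (\<lambda>w. \<Prod>p\<in>S. h p (v p, w p)))
      = avg (residue_vectors S) (\<lambda>v. \<Prod>p\<in>S. avg {0..<int p} (\<lambda>b. h p (v p, b)))"
    using S by (intro avg_cong avg_PiE) auto
  also have "\<dots> = (\<Prod>p\<in>S. avg {0..<int p} (\<lambda>a. avg {0..<int p} (\<lambda>b. h p (a, b))))"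
    using S by (intro avg_PiE[of _ _ "\<lambda>p a. avg {0..<int p} (\<lambda>b. h p (a, b))"]) auto
  finally show ?thesis by (simp add: avg_Times)
qed

text \<open>Independence of different primes. Values in a general normed field serve real
  exponentials and complex characters alike.\<close>

lemma avg_model_prod:
  fixes f :: "nat \<Rightarrow> (int \<times> int) \<times> (int \<times> int) \<Rightarrow> 'c::real_normed_field"
  assumes S: "finite S"
  shows "avg (model S) (\<lambda>z. \<Prod>p\<in>S. f p (coords p z)) = (\<Prod>p\<in>S. avg (cell p) (f p))"
proof -
  let ?R = "residue_vectors S \<times> residue_vectors S"
  have "avg (model S) (\<lambda>z. \<Prod>p\<in>S. f p (coords p z))
      = avg ?R (\<lambda>v. avg ?R (\<lambda>w. \<Prod>p\<in>S. f p ((fst v p, snd v p), (fst w p, snd w p))))"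
    by (simp add: model_def avg_Times[of ?R] coords_def map_prod_def split_beta)
  also have "\<dots> = avg ?R (\<lambda>v. \<Prod>p\<in>S. avg ({0..<int p} \<times> {0..<int p}) (\<lambda>w. f p ((fst v p, snd v p), w)))"
    using S by (intro avg_cong avg_residue_vectors_pair)
  also have "\<dots> = (\<Prod>p\<in>S. avg (cell p) (f p))"
    unfolding cell_def avg_Times[of "{0..<int _} \<times> {0..<int _}"] using S by (rule avg_residue_vectors_pair)
  finally show ?thesis .
qed

lemma model_finite_nonempty:
  assumes "finite S" "\<And>p. p \<in> S \<Longrightarrow> prime p"
  shows "finite (model S)" "model S \<noteq> {}"
proof -
  have "finite (residue_vectors S)" using assms by (intro finite_PiE) auto
  moreover have "residue_vectors S \<noteq> {}"
    using assms by (auto simp: PiE_eq_empty_iff dest!: prime_gt_0_nat)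
  ultimately show "finite (model S)" "model S \<noteq> {}" by (auto simp: model_def)
qed

section \<open>Mean and variance at a single prime\<close>

lemma avg_ftrace: "prime p \<Longrightarrow> avg ({0..<int p} \<times> {0..<int p}) (\<lambda>(a, b). real_of_int (ftrace p a b)) = 0"
  using sum_trace[of p] by (simp add: avg_Times) (simp add: avg_def of_int_sum[symmetric] del: of_int_sum)

lemma avg_ftrace_squared:
  assumes "prime p" "p > 2"
  shows "avg ({0..<int p} \<times> {0..<int p}) (\<lambda>(a, b). (real_of_int (ftrace p a b))\<^sup>2) = real p - 1"
proof -
  have "(\<Sum>a\<in>{0..<int p}. \<Sum>b\<in>{0..<int p}. (real_of_int (ftrace p a b))\<^sup>2)
      = real_of_int (\<Sum>a\<in>{0..<int p}. \<Sum>b\<in>{0..<int p}. (ftrace p a b)\<^sup>2)" by simp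
  also have "\<dots> = real p * real p * (real p - 1)" unfolding sum_trace_squared[OF assms] by simp
  finally show ?thesis
    using assms(2) by (simp add: avg_def sum.cartesian_product[symmetric])
qed

lemma avg_cell_product:
  fixes f g :: "int \<times> int \<Rightarrow> real"
  shows "avg (cell p) (\<lambda>(z, z'). f z * g z') = avg ({0..<int p} \<times> {0..<int p}) f * avg ({0..<int p} \<times> {0..<int p}) g"
  unfolding cell_def by (subst avg_Times) (simp add: avg_cmult mult.commute[of _ "avg _ g"])

lemma avg_prodtrace:
  assumes "prime p" shows "avg (cell p) (prodtrace p) = 0"
proof -
  let ?f = "\<lambda>(a, b). real_of_int (ftrace p a b)"
  have "avg (cell p) (prodtrace p) = avg (cell p) (\<lambda>z. (1 / real p) * (case z of (z, z') \<Rightarrow> ?f z * ?f z'))"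
    by (rule avg_cong) (auto simp: prodtrace_def)
  also have "\<dots> = 0" unfolding avg_cmult avg_cell_product avg_ftrace[OF assms] by simp
  finally show ?thesis .
qed

text \<open>The second moment is (1 - 1/p)^2 for odd \<open>p\<close>, and 0 for p = 2, where all
  traces vanish.\<close>

lemma avg_prodtrace_squared:
  assumes p: "prime p"
  defines "v \<equiv> avg (cell p) (\<lambda>z. (prodtrace p z)\<^sup>2)"
  shows "\<bar>1 - v\<bar> \<le> 2 / real p"
proof (cases "p = 2")
  case True
  have "ftrace 2 a b = 0" for a b by (simp add: ftrace_def nu_two)
  then have "v = 0" unfolding v_def by (simp add: True prodtrace_def avg_def split_beta)
  then show ?thesis by (simp add: True)
next
  case False
  then have p2: "p > 2" using prime_ge_2_nat[OF p] by simp
  let ?f = "\<lambda>(a, b). (real_of_int (ftrace p a b))\<^sup>2"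
  have "v = avg (cell p) (\<lambda>z. (1 / (real p)\<^sup>2) * (case z of (z, z') \<Rightarrow> ?f z * ?f z'))"
    unfolding v_def by (rule avg_cong) (auto simp: prodtrace_def power_mult_distrib power_divide)
  also have "\<dots> = (real p - 1)\<^sup>2 / (real p)\<^sup>2"
    unfolding avg_cmult avg_cell_product avg_ftrace_squared[OF p p2] by (simp add: power2_eq_square)
  finally have v: "v = (1 - 1 / real p)\<^sup>2" using p2 by (simp add: power_divide[symmetric] diff_divide_distrib)
  have "1 / real p \<le> 1" using p2 by simp
  then have "v \<le> 1" unfolding v by (intro power_le_one) auto
  moreover have "1 - v \<le> 2 / real p" unfolding v by (simp add: power2_eq_square algebra_simps)
  ultimately show ?thesis by simp
qed

text \<open>Split at c = sqrt (card S): at most c elements are below, each contributing at most 1,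
  and each of the others contributes at most 2 / c. The bound holds for every such set, sparse or
  dense.\<close>

lemma sum_inverse_le:
  assumes S: "finite S" "\<And>p. p \<in> S \<Longrightarrow> p \<ge> 2"
  shows "(\<Sum>p\<in>S. 2 / real p) \<le> 3 * sqrt (real (card S))"
proof (cases "S = {}")
  case False
  define c where "c = sqrt (real (card S))"
  have c: "c > 0" "c * c = real (card S)" using False S by (auto simp: c_def card_gt_0_iff)
  define S1 where "S1 = {p \<in> S. real p \<le> c}"
  have "(\<Sum>p\<in>S. 2 / real p) = (\<Sum>p\<in>S - S1. 2 / real p) + (\<Sum>p\<in>S1. 2 / real p)"
    using S by (intro sum.subset_diff) (auto simp: S1_def)
  also have "(\<Sum>p\<in>S1. 2 / real p) \<le> c"
  proof -
    have "(\<Sum>p\<in>S1. 2 / real p) \<le> (\<Sum>p\<in>S1. 1)"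
      using S(2) by (intro sum_mono) (force simp: S1_def)
    also have "\<dots> = real (card S1)" by simp
    also have "card S1 \<le> card {1..nat \<lfloor>c\<rfloor>}"
    proof (rule card_mono)
      show "S1 \<subseteq> {1..nat \<lfloor>c\<rfloor>}"
      proof
        fix p assume "p \<in> S1"
        then have "real p \<le> c" "p \<ge> 2" using S(2) by (auto simp: S1_def)
        then show "p \<in> {1..nat \<lfloor>c\<rfloor>}" by (auto simp: le_nat_floor)
      qed
    qed simp
    then have "real (card S1) \<le> real (nat \<lfloor>c\<rfloor>)" by simp
    also have "\<dots> \<le> c" using c by linarith
    finally show ?thesis .
  qed
  also have "(\<Sum>p\<in>S - S1. 2 / real p) \<le> (\<Sum>p\<in>S - S1. 2 / c)"
    using c by (intro sum_mono divide_left_mono) (auto simp: S1_def)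
  also have "\<dots> = real (card (S - S1)) * (2 / c)" by simp
  also have "\<dots> \<le> real (card S) * (2 / c)"
    using c S by (intro mult_right_mono) (auto intro!: card_mono)
  also have "\<dots> = 2 * c" using c by (simp add: field_simps)
  finally show ?thesis by (simp add: c_def)
qed simp

section \<open>Characteristic function and exponential moments of the model\<close>

lemma exp_minus_approx:
  fixes y :: real assumes "y \<ge> 0" shows "\<bar>1 - y - exp (- y)\<bar> \<le> y\<^sup>2"
proof -
  have "exp (- y) \<ge> 1 - y" using exp_ge_add_one_self[of "- y"] by simp
  moreover have "exp (- y) \<le> 1 / (1 + y)"
    unfolding exp_minus inverse_eq_divide using assms by (intro divide_left_mono) auto
  moreover have "1 / (1 + y) \<le> 1 - y + y\<^sup>2"
  proof -
    have "1 \<le> (1 - y + y\<^sup>2) * (1 + y)" using assms by (simp add: power2_eq_square algebra_simps)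
    then show ?thesis using assms by (simp add: divide_le_eq)
  qed
  ultimately show ?thesis by linarith
qed

lemma avg_of_real: "avg S (\<lambda>s. complex_of_real (f s)) = complex_of_real (avg S f)"
  by (simp add: avg_def)

text \<open>Second order Taylor expansion: the linear term has mean 0, and the cubic remainder is
  bounded through \<open>prodtrace_bound\<close>.\<close>

lemma cell_char_bound:
  assumes p: "prime p"
  defines "v \<equiv> avg (cell p) (\<lambda>z. (prodtrace p z)\<^sup>2)"
  shows "cmod (avg (cell p) (\<lambda>z. iexp (s * prodtrace p z)) - complex_of_real (1 - s\<^sup>2 * v / 2)) \<le> \<bar>s\<bar> ^ 3 * 529 ^ 3"
proof -
  let ?X = "prodtrace p" and ?C = "cell p"
  let ?P = "\<lambda>z. \<Sum>k\<le>2. (\<i> * complex_of_real (s * ?X z)) ^ k / fact k"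
  have P: "?P z
      = complex_of_real 1 + (\<i> * complex_of_real s) * complex_of_real (?X z) + complex_of_real (- s\<^sup>2 / 2) * complex_of_real ((?X z)\<^sup>2)" for z
    by (simp add: numeral_2_eq_2 power2_eq_square algebra_simps)
  have "avg ?C ?P = complex_of_real (1 - s\<^sup>2 * v / 2)"
    unfolding P avg_add avg_cmult avg_of_real avg_prodtrace[OF p] avg_const[OF finite_cell cell_nonempty[OF p]]
    by (simp add: v_def avg_of_real)
  then have "avg ?C (\<lambda>z. iexp (s * ?X z)) - complex_of_real (1 - s\<^sup>2 * v / 2)
     = avg ?C (\<lambda>z. iexp (s * ?X z) - ?P z)"
    by (simp only: avg_diff)
  also have "cmod \<dots> \<le> \<bar>s\<bar> ^ 3 * 529 ^ 3"
  proof (rule norm_avg_le[OF finite_cell cell_nonempty[OF p]])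
    fix z
    have "cmod (iexp (s * ?X z) - ?P z) \<le> \<bar>s * ?X z\<bar> ^ Suc 2 / fact (Suc 2)"
      by (rule iexp_approx1)
    also have "\<dots> \<le> \<bar>s * ?X z\<bar> ^ 3" by (simp add: fact_numeral divide_le_eq)
    also have "\<dots> = \<bar>s\<bar> ^ 3 * \<bar>?X z\<bar> ^ 3" by (simp add: abs_mult power_mult_distrib)
    also have "\<dots> \<le> \<bar>s\<bar> ^ 3 * 529 ^ 3"
      using prodtrace_bound[OF p] by (intro mult_left_mono power_mono) auto
    finally show "cmod (iexp (s * ?X z) - ?P z) \<le> \<bar>s\<bar> ^ 3 * 529 ^ 3" .
  qed
  finally show ?thesis .
qed

definition model_sum where
  "model_sum S z = (\<Sum>p\<in>S. prodtrace p (coords p z)) / sqrt (real (card S))"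

text \<open>All factors have modulus at most 1, so the two products differ by at most the sum of the
  differences of the factors. The cubic terms, the defects of the variances from 1 and the error of
  1 - y against exp (-y) each add up to O(1 / sqrt (card S)).\<close>

lemma char_model:
  assumes S: "finite S" "\<And>p. p \<in> S \<Longrightarrow> prime p" "S \<noteq> {}"
  shows "cmod (avg (model S) (\<lambda>z. iexp (t * model_sum S z)) - exp (- (t\<^sup>2) / 2))
     \<le> (\<bar>t\<bar> ^ 3 * 529 ^ 3 + 3 * t\<^sup>2 / 2 + t ^ 4 / 4) / sqrt (real (card S))"
proof -
  define n where "n = real (card S)"
  have n: "n \<ge> 1" using S by (simp add: n_def Suc_le_eq card_gt_0_iff)
  define s where "s = t / sqrt n"
  have s2: "s\<^sup>2 = t\<^sup>2 / n" using n by (simp add: s_def power_divide)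
  define \<phi> where "\<phi> p = avg (cell p) (\<lambda>z. iexp (s * prodtrace p z))" for p
  define v where "v p = avg (cell p) (\<lambda>z. (prodtrace p z)\<^sup>2)" for p
  define w where "w = complex_of_real (exp (- (t\<^sup>2 / (2 * n))))"
  have "avg (model S) (\<lambda>z. iexp (t * model_sum S z)) = avg (model S) (\<lambda>z. \<Prod>p\<in>S. iexp (s * prodtrace p (coords p z)))"
  proof (rule avg_cong)
    fix z
    have "t * model_sum S z = (\<Sum>p\<in>S. s * prodtrace p (coords p z))"
      by (simp add: model_sum_def s_def n_def sum_distrib_left sum_divide_distrib)
    then have "iexp (t * model_sum S z) = exp (\<Sum>p\<in>S. \<i> * complex_of_real (s * prodtrace p (coords p z)))"
      by (simp add: sum_distrib_left)
    then show "iexp (t * model_sum S z) = (\<Prod>p\<in>S. iexp (s * prodtrace p (coords p z)))"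
      by (simp add: exp_sum S(1))
  qed
  also have "\<dots> = (\<Prod>p\<in>S. \<phi> p)" unfolding \<phi>_def by (rule avg_model_prod[OF S(1)])
  finally have 1: "avg (model S) (\<lambda>z. iexp (t * model_sum S z)) = (\<Prod>p\<in>S. \<phi> p)" .
  have 2: "complex_of_real (exp (- (t\<^sup>2) / 2)) = (\<Prod>p\<in>S. w)"
  proof -
    have "(\<Prod>p\<in>S. w) = complex_of_real (exp (- (t\<^sup>2 / (2 * n))) ^ card S)" by (simp add: w_def)
    also have "exp (- (t\<^sup>2 / (2 * n))) ^ card S = exp (real (card S) * (- (t\<^sup>2 / (2 * n))))"
      by (rule exp_of_nat_mult[symmetric])
    also have "real (card S) * (- (t\<^sup>2 / (2 * n))) = - (t\<^sup>2) / 2" using n by (simp add: n_def field_simps)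
    finally show ?thesis by simp
  qed
  have each: "cmod (\<phi> p - w) \<le> \<bar>s\<bar> ^ 3 * 529 ^ 3 + t\<^sup>2 / (2 * n) * (2 / real p) + (t\<^sup>2 / (2 * n))\<^sup>2" if "p \<in> S" for p
  proof -
    have p: "prime p" using S that by auto
    have a: "cmod (\<phi> p - complex_of_real (1 - s\<^sup>2 * v p / 2)) \<le> \<bar>s\<bar> ^ 3 * 529 ^ 3"
      unfolding \<phi>_def v_def by (rule cell_char_bound[OF p])
    have "\<bar>(1 - s\<^sup>2 * v p / 2) - exp (- (t\<^sup>2 / (2 * n)))\<bar>
        \<le> \<bar>t\<^sup>2 / (2 * n) * (1 - v p)\<bar> + \<bar>1 - t\<^sup>2 / (2 * n) - exp (- (t\<^sup>2 / (2 * n)))\<bar>"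
    proof -
      have "(1 - s\<^sup>2 * v p / 2) - exp (- (t\<^sup>2 / (2 * n)))
         = t\<^sup>2 / (2 * n) * (1 - v p) + (1 - t\<^sup>2 / (2 * n) - exp (- (t\<^sup>2 / (2 * n))))"
        by (simp add: s2 algebra_simps diff_divide_distrib)
      then show ?thesis by (metis abs_triangle_ineq)
    qed
    also have "\<dots> \<le> t\<^sup>2 / (2 * n) * (2 / real p) + (t\<^sup>2 / (2 * n))\<^sup>2"
    proof (rule add_mono)
      show "\<bar>t\<^sup>2 / (2 * n) * (1 - v p)\<bar> \<le> t\<^sup>2 / (2 * n) * (2 / real p)"
        unfolding abs_mult using avg_prodtrace_squared[OF p] n
        by (intro mult_mono) (auto simp: v_def)
      show "\<bar>1 - t\<^sup>2 / (2 * n) - exp (- (t\<^sup>2 / (2 * n)))\<bar> \<le> (t\<^sup>2 / (2 * n))\<^sup>2"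
        using n by (intro exp_minus_approx) auto
    qed
    finally have "cmod (complex_of_real (1 - s\<^sup>2 * v p / 2) - w) \<le> t\<^sup>2 / (2 * n) * (2 / real p) + (t\<^sup>2 / (2 * n))\<^sup>2"
      unfolding w_def of_real_diff[symmetric] norm_of_real .
    then show ?thesis using a norm_triangle_ineq[of "\<phi> p - complex_of_real (1 - s\<^sup>2 * v p / 2)" "complex_of_real (1 - s\<^sup>2 * v p / 2) - w"]
      by simp
  qed
  have "cmod ((\<Prod>p\<in>S. \<phi> p) - (\<Prod>p\<in>S. w)) \<le> (\<Sum>p\<in>S. cmod (\<phi> p - w))"
  proof (rule norm_prod_diff)
    show "cmod (\<phi> p) \<le> 1" if "p \<in> S" for p
      unfolding \<phi>_def using S(2)[OF that] by (intro norm_avg_le finite_cell cell_nonempty) auto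
    show "cmod w \<le> 1" unfolding w_def norm_of_real using n by simp
  qed
  also have "\<dots> \<le> (\<Sum>p\<in>S. \<bar>s\<bar> ^ 3 * 529 ^ 3 + t\<^sup>2 / (2 * n) * (2 / real p) + (t\<^sup>2 / (2 * n))\<^sup>2)"
    by (intro sum_mono each)
  also have "\<dots> = n * (\<bar>s\<bar> ^ 3 * 529 ^ 3) + t\<^sup>2 / (2 * n) * (\<Sum>p\<in>S. 2 / real p) + n * (t\<^sup>2 / (2 * n))\<^sup>2"
    by (simp add: sum.distrib sum_distrib_left n_def)
  also have "\<dots> \<le> n * (\<bar>s\<bar> ^ 3 * 529 ^ 3) + t\<^sup>2 / (2 * n) * (3 * sqrt n) + n * (t\<^sup>2 / (2 * n))\<^sup>2"
  proof -
    have "(\<Sum>p\<in>S. 2 / real p) \<le> 3 * sqrt n"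
      unfolding n_def using S prime_ge_2_nat by (intro sum_inverse_le) auto
    then have "t\<^sup>2 / (2 * n) * (\<Sum>p\<in>S. 2 / real p) \<le> t\<^sup>2 / (2 * n) * (3 * sqrt n)"
      using n by (intro mult_left_mono) auto
    then show ?thesis by simp
  qed
  also have "n * (\<bar>s\<bar> ^ 3 * 529 ^ 3) = \<bar>t\<bar> ^ 3 * 529 ^ 3 / sqrt n"
  proof -
    have "\<bar>s\<bar> ^ 3 = \<bar>t\<bar> ^ 3 / (sqrt n * n)"
      using n by (simp add: s_def power_divide abs_divide power3_eq_cube)
    then show ?thesis using n by (simp add: field_simps)
  qed
  also have "t\<^sup>2 / (2 * n) * (3 * sqrt n) = (3 * t\<^sup>2 / 2) / sqrt n"
  proof -
    have "sqrt n / n = 1 / sqrt n" using n by (simp add: field_simps)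
    have "t\<^sup>2 / (2 * n) * (3 * sqrt n) = 3 * t\<^sup>2 / 2 * (sqrt n / n)" by simp
    then show ?thesis unfolding \<open>sqrt n / n = 1 / sqrt n\<close> by simp
  qed
  also have "n * (t\<^sup>2 / (2 * n))\<^sup>2 \<le> (t ^ 4 / 4) / sqrt n"
  proof -
    have "n * (t\<^sup>2 / (2 * n))\<^sup>2 = (t ^ 4 / 4) / n"
      using n by (simp add: power2_eq_square power4_eq_xxxx field_simps)
    also have "\<dots> \<le> (t ^ 4 / 4) / sqrt n"
      using n by (intro divide_left_mono) (auto simp: real_le_lsqrt self_le_power)
    finally show ?thesis .
  qed
  finally show ?thesis unfolding 1 2 by (simp add: n_def add_divide_distrib)
qed

text \<open>By mean 0 each factor is at most 1 + c / n \<le> exp (c / n), and the n factors together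
  give a bound independent of \<open>S\<close>.\<close>

lemma model_exp_bound:
  assumes S: "finite S" "\<And>p. p \<in> S \<Longrightarrow> prime p" "S \<noteq> {}"
  shows "avg (model S) (\<lambda>z. exp (t * model_sum S z)) \<le> exp (t\<^sup>2 * 529\<^sup>2 * exp (\<bar>t\<bar> * 529))"
proof -
  define n where "n = real (card S)"
  have n: "n \<ge> 1" using S by (simp add: n_def Suc_le_eq card_gt_0_iff)
  define s where "s = t / sqrt n"
  have s2: "s\<^sup>2 = t\<^sup>2 / n" using n by (simp add: s_def power_divide)
  have st: "\<bar>s\<bar> \<le> \<bar>t\<bar>" using n by (simp add: s_def abs_divide divide_le_eq mult_le_cancel_left1)
  define c where "c = t\<^sup>2 * 529\<^sup>2 * exp (\<bar>t\<bar> * 529)"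
  have "avg (model S) (\<lambda>z. exp (t * model_sum S z)) = avg (model S) (\<lambda>z. \<Prod>p\<in>S. exp (s * prodtrace p (coords p z)))"
  proof (rule avg_cong)
    fix z
    have "t * model_sum S z = (\<Sum>p\<in>S. s * prodtrace p (coords p z))"
      by (simp add: model_sum_def s_def n_def sum_distrib_left sum_divide_distrib)
    then show "exp (t * model_sum S z) = (\<Prod>p\<in>S. exp (s * prodtrace p (coords p z)))"
      by (simp add: exp_sum S(1))
  qed
  also have "\<dots> = (\<Prod>p\<in>S. avg (cell p) (\<lambda>z. exp (s * prodtrace p z)))" by (rule avg_model_prod[OF S(1)])
  also have "\<dots> \<le> (\<Prod>p\<in>S. exp (c / n))"
  proof (rule prod_mono, intro conjI)
    fix p assume "p \<in> S"
    then have p: "prime p" using S by auto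
    show "0 \<le> avg (cell p) (\<lambda>z. exp (s * prodtrace p z))" by (simp add: avg_def sum_nonneg)
    have "avg (cell p) (\<lambda>z. exp (s * prodtrace p z)) \<le> avg (cell p) (\<lambda>z. 1 + s * prodtrace p z + c / n)"
    proof (rule avg_mono)
      fix z
      let ?u = "s * prodtrace p z"
      obtain \<xi> where \<xi>: "\<bar>\<xi>\<bar> \<le> \<bar>?u\<bar>" "exp ?u = (\<Sum>m<2. ?u ^ m / fact m) + exp \<xi> / fact 2 * ?u ^ 2"
        using Maclaurin_exp_le[of ?u 2] by blast
      have b: "\<bar>prodtrace p z\<bar> \<le> 529" by (rule prodtrace_bound[OF p])
      have "\<bar>?u\<bar> \<le> \<bar>t\<bar> * 529" unfolding abs_mult using st b by (intro mult_mono) auto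
      then have "exp \<xi> \<le> exp (\<bar>t\<bar> * 529)" using \<xi>(1) by auto
      moreover have "?u ^ 2 \<le> t\<^sup>2 / n * 529\<^sup>2"
      proof -
        have "(prodtrace p z)\<^sup>2 \<le> 529\<^sup>2" using b by (subst abs_le_square_iff[symmetric]) simp
        then show ?thesis unfolding power_mult_distrib s2 using n by (intro mult_left_mono) auto
      qed
      ultimately have "exp \<xi> * ?u ^ 2 \<le> exp (\<bar>t\<bar> * 529) * (t\<^sup>2 / n * 529\<^sup>2)" by (intro mult_mono) auto
      also have "\<dots> = c / n" by (simp add: c_def)
      finally have "exp \<xi> / fact 2 * ?u ^ 2 \<le> c / n"
      proof -
        have "exp \<xi> / fact 2 * ?u ^ 2 = exp \<xi> * ?u ^ 2 / 2" by simp
        moreover have "0 \<le> exp \<xi> * ?u ^ 2" by simp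
        moreover assume "exp \<xi> * ?u ^ 2 \<le> c / n"
        ultimately show ?thesis by linarith
      qed
      then show "exp ?u \<le> 1 + ?u + c / n" unfolding \<xi>(2) by (simp add: numeral_2_eq_2)
    qed
    also have "\<dots> = 1 + c / n"
      unfolding avg_add avg_cmult avg_prodtrace[OF p] avg_const[OF finite_cell cell_nonempty[OF p]] by simp
    also have "\<dots> \<le> exp (c / n)" by (rule exp_ge_add_one_self)
    finally show "avg (cell p) (\<lambda>z. exp (s * prodtrace p z)) \<le> exp (c / n)" .
  qed
  also have "\<dots> = exp (real (card S) * (c / n))" by (simp only: prod_constant exp_of_nat_mult)
  also have "real (card S) * (c / n) = c" using n by (simp add: n_def)
  finally show ?thesis by (simp add: c_def)
qed

lemma power_le_exp:
  fixes u :: real shows "u ^ (2 * k) \<le> fact (2 * k) * (exp u + exp (- u))"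
proof -
  have pos: "y ^ m \<le> fact m * exp y" if "y \<ge> 0" for y :: real and m
  proof -
    obtain \<xi> where "exp y = (\<Sum>i<Suc m. y ^ i / fact i) + exp \<xi> / fact (Suc m) * y ^ Suc m"
      using Maclaurin_exp_le[of y "Suc m"] by blast
    moreover have "exp \<xi> / fact (Suc m) * y ^ Suc m \<ge> 0" using that by simp
    moreover have "y ^ m / fact m \<le> (\<Sum>i<Suc m. y ^ i / fact i)"
      using that by (simp add: sum_nonneg)
    ultimately have "y ^ m / fact m \<le> exp y" by linarith
    then show ?thesis by (simp add: divide_le_eq mult.commute)
  qed
  have "u ^ (2 * k) = \<bar>u\<bar> ^ (2 * k)" by (simp add: power_even_abs)
  also have "\<dots> \<le> fact (2 * k) * exp \<bar>u\<bar>" by (rule pos) simp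
  also have "\<dots> \<le> fact (2 * k) * (exp u + exp (- u))"
    by (intro mult_left_mono) (auto simp: abs_if)
  finally show ?thesis .
qed

text \<open>\<open>t\<close> is free: taken large enough, its power in the denominator outweighs the
  powers in the Taylor expansion of a characteristic function.\<close>

lemma model_moment_bound:
  assumes S: "finite S" "\<And>p. p \<in> S \<Longrightarrow> prime p" "S \<noteq> {}" and t: "t > 0"
  shows "avg (model S) (\<lambda>z. model_sum S z ^ (2 * k))
     \<le> fact (2 * k) * (2 * exp (t\<^sup>2 * 529\<^sup>2 * exp (t * 529))) / t ^ (2 * k)"
proof -
  have "t ^ (2 * k) * avg (model S) (\<lambda>z. model_sum S z ^ (2 * k))
      = avg (model S) (\<lambda>z. (t * model_sum S z) ^ (2 * k))"
    by (simp add: avg_cmult[symmetric] power_mult_distrib)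
  also have "\<dots> \<le> avg (model S) (\<lambda>z. fact (2 * k) * (exp (t * model_sum S z) + exp ((- t) * model_sum S z)))"
    using power_le_exp by (intro avg_mono) (metis mult_minus_left)
  also have "\<dots> = fact (2 * k) * (avg (model S) (\<lambda>z. exp (t * model_sum S z)) + avg (model S) (\<lambda>z. exp ((- t) * model_sum S z)))"
    unfolding avg_cmult avg_add ..
  also have "\<dots> \<le> fact (2 * k) * (exp (t\<^sup>2 * 529\<^sup>2 * exp (t * 529)) + exp (t\<^sup>2 * 529\<^sup>2 * exp (t * 529)))"
    using model_exp_bound[OF S, of t] model_exp_bound[OF S, of "- t"] t
    by (intro mult_left_mono add_mono) auto
  finally show ?thesis using t by (simp add: field_simps)
qed

section \<open>The method of moments\<close>

lemma eventually_less_of_tendsto_0: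
  fixes f :: "'a \<Rightarrow> real"
  shows "(f \<longlongrightarrow> 0) F \<Longrightarrow> 0 < e \<Longrightarrow> \<forall>\<^sub>F x in F. \<bar>f x\<bar> < e"
  using tendstoD[of f 0 F e] by (simp add: dist_real_def)

text \<open>The value for an empty or infinite \<open>T\<close> is a dummy that keeps it a probability measure.\<close>

definition empirical :: "'a set \<Rightarrow> ('a \<Rightarrow> real) \<Rightarrow> real measure" where
  "empirical T f = (if finite T \<and> T \<noteq> {} then distr (measure_pmf (pmf_of_set T)) borel f else return borel 0)"

lemma real_distribution_empirical: "real_distribution (empirical T f)"
proof (cases "finite T \<and> T \<noteq> {}")
  case True
  then show ?thesis unfolding empirical_def
    by (auto intro!: prob_space.real_distribution_distr measure_pmf.prob_space_axioms)
next
  case False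
  have "prob_space (return borel (0::real))" by (rule prob_space_return) simp
  with False show ?thesis unfolding empirical_def real_distribution_def real_distribution_axioms_def by auto
qed

lemma integral_empirical:
  fixes g :: "real \<Rightarrow> 'b::{real_normed_field,banach,second_countable_topology}"
  assumes T: "finite T" "T \<noteq> {}" and g: "g \<in> borel_measurable borel"
  shows "integral\<^sup>L (empirical T f) g = avg T (\<lambda>z. g (f z))"
proof -
  have "integral\<^sup>L (empirical T f) g = integral\<^sup>L (measure_pmf (pmf_of_set T)) (\<lambda>z. g (f z))"
    using T g by (simp add: empirical_def integral_distr)
  also have "\<dots> = (\<Sum>z\<in>T. pmf (pmf_of_set T) z *\<^sub>R g (f z))"
    using T by (subst integral_measure_pmf[of T]) (auto simp: set_pmf_of_set)
  also have "\<dots> = avg T (\<lambda>z. g (f z))"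
    using T by (simp add: avg_def scaleR_conv_of_real sum_distrib_left divide_inverse mult.commute)
  finally show ?thesis .
qed

lemma std_normal_integral:
  fixes H :: "real \<Rightarrow> real"
  assumes "H \<in> borel_measurable borel"
  shows "integral\<^sup>L std_normal_distribution H = 1 / sqrt (2 * pi) * (\<integral>t. H t * exp (- (t ^ 2) / 2) \<partial>lborel)"
proof -
  have "integral\<^sup>L std_normal_distribution H = (\<integral>t. std_normal_density t * H t \<partial>lborel)"
    using assms by (subst integral_density) (auto simp: normal_density_nonneg)
  also have "\<dots> = (\<integral>t. (1 / sqrt (2 * pi)) * (H t * exp (- (t ^ 2) / 2)) \<partial>lborel)"
    by (simp add: std_normal_density_def mult_ac)
  also have "\<dots> = 1 / sqrt (2 * pi) * (\<integral>t. H t * exp (- (t ^ 2) / 2) \<partial>lborel)" by simp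
  finally show ?thesis .
qed

text \<open>In \<open>bound\<close>, \<theta> is arbitrary and \<open>C \<theta>\<close> does not
  depend on k; this growth condition lets moments determine the limit law. It is imposed on
  \<open>M\<close> only and carried over to \<open>T\<close> by \<open>moments\<close>, one order at
  a time.\<close>

locale moment_comparison =
  fixes T :: "real \<Rightarrow> 'a set" and S :: "real \<Rightarrow> 'a \<Rightarrow> real"
    and M :: "real \<Rightarrow> 'b set" and Y :: "real \<Rightarrow> 'b \<Rightarrow> real" and C :: "real \<Rightarrow> real"
  assumes T: "\<forall>\<^sub>F x in at_top. finite (T x) \<and> T x \<noteq> {}"
    and M: "\<forall>\<^sub>F x in at_top. finite (M x) \<and> M x \<noteq> {}"
    and moments: "\<And>r. ((\<lambda>x. avg (T x) (\<lambda>z. S x z ^ r) - avg (M x) (\<lambda>z. Y x z ^ r)) \<longlongrightarrow> 0) at_top"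
    and bound: "\<And>k \<theta>. \<theta> > 0 \<Longrightarrow> \<forall>\<^sub>F x in at_top. avg (M x) (\<lambda>z. Y x z ^ (2 * k)) \<le> fact (2 * k) * C \<theta> / \<theta> ^ (2 * k)"
    and charM: "\<And>t. ((\<lambda>x. avg (M x) (\<lambda>z. iexp (t * Y x z))) \<longlongrightarrow> complex_of_real (exp (- (t\<^sup>2) / 2))) at_top"
begin

lemma bounded_even_moment: "\<exists>B. \<forall>\<^sub>F x in at_top. avg (T x) (\<lambda>z. S x z ^ (2 * k)) \<le> B"
proof (intro exI)
  have "\<forall>\<^sub>F x in at_top. \<bar>avg (T x) (\<lambda>z. S x z ^ (2 * k)) - avg (M x) (\<lambda>z. Y x z ^ (2 * k))\<bar> < 1"
    by (rule eventually_less_of_tendsto_0[OF moments]) simp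
  then show "\<forall>\<^sub>F x in at_top. avg (T x) (\<lambda>z. S x z ^ (2 * k)) \<le> fact (2 * k) * C 1 / 1 ^ (2 * k) + 1"
    using bound[OF zero_less_one, of k] by eventually_elim auto
qed

lemma iexp_avg_approx:
  fixes W :: "'c set"
  assumes "finite W" "W \<noteq> {}" "k > 0"
  shows "cmod (avg W (\<lambda>z. iexp (t * f z)) - (\<Sum>j<2 * k. (\<i> * complex_of_real t) ^ j / fact j * complex_of_real (avg W (\<lambda>z. f z ^ j))))
     \<le> t ^ (2 * k) / fact (2 * k) * avg W (\<lambda>z. f z ^ (2 * k))"
proof -
  let ?P = "\<lambda>z. \<Sum>j<2 * k. (\<i> * complex_of_real (t * f z)) ^ j / fact j"
  let ?c = "\<lambda>j. (\<i> * complex_of_real t) ^ j / fact j"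
  let ?M = "\<Sum>j<2 * k. ?c j * complex_of_real (avg W (\<lambda>z. f z ^ j))"
  have Suc: "{..<2 * k} = {..2 * k - 1}" "Suc (2 * k - 1) = 2 * k" using assms(3) by auto
  have "?M
      = avg W ?P"
    unfolding avg_sum
  proof (rule sum.cong[OF refl])
    fix j
    have "avg W (\<lambda>z. (\<i> * complex_of_real (t * f z)) ^ j / fact j)
        = avg W (\<lambda>z. ?c j * complex_of_real (f z ^ j))"
      by (rule avg_cong) (simp add: power_mult_distrib)
    also have "\<dots> = ?c j * avg W (\<lambda>z. complex_of_real (f z ^ j))"
      by (rule avg_cmult)
    also have "avg W (\<lambda>z. complex_of_real (f z ^ j)) = complex_of_real (avg W (\<lambda>z. f z ^ j))"
      by (simp add: avg_def)
    finally show "?c j * complex_of_real (avg W (\<lambda>z. f z ^ j))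
        = avg W (\<lambda>z. (\<i> * complex_of_real (t * f z)) ^ j / fact j)" by simp
  qed
  then have "avg W (\<lambda>z. iexp (t * f z)) - ?M
     = avg W (\<lambda>z. iexp (t * f z) - ?P z)"
    by (simp only: avg_diff)
  also have "cmod \<dots> \<le> avg W (\<lambda>z. cmod (iexp (t * f z) - ?P z))"
    by (rule norm_avg)
  also have "\<dots> \<le> avg W (\<lambda>z. t ^ (2 * k) / fact (2 * k) * f z ^ (2 * k))"
  proof (rule avg_mono)
    fix z
    have "cmod (iexp (t * f z) - ?P z) \<le> \<bar>t * f z\<bar> ^ (2 * k) / fact (2 * k)"
      using iexp_approx1[of "t * f z" "2 * k - 1"] unfolding Suc .
    then show "cmod (iexp (t * f z) - ?P z) \<le> t ^ (2 * k) / fact (2 * k) * f z ^ (2 * k)"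
      by (simp add: power_even_abs power_mult_distrib)
  qed
  finally show ?thesis unfolding avg_cmult .
qed

text \<open>Both characteristic functions are expanded to the same order. For fixed k the Taylor
  polynomials approach each other by \<open>moments\<close>, and the remainders are small once k is
  large.\<close>

lemma charT: "((\<lambda>x. avg (T x) (\<lambda>z. iexp (t * S x z))) \<longlongrightarrow> complex_of_real (exp (- (t\<^sup>2) / 2))) at_top"
proof -
  have "((\<lambda>x. avg (T x) (\<lambda>z. iexp (t * S x z)) - avg (M x) (\<lambda>z. iexp (t * Y x z))) \<longlongrightarrow> 0) at_top"
  proof (rule tendstoI)
    fix e :: real assume e: "e > 0"
    \<comment> \<open>This makes |t| / \<theta> less than 1/2, so the remainder decays geometrically
      in k.\<close>
    define \<theta> where "\<theta> = 2 * \<bar>t\<bar> + 1"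
    have \<theta>: "\<theta> > 0" by (simp add: \<theta>_def)
    define D where "D = \<bar>C \<theta>\<bar> + 1"
    obtain k0 where k0: "(1 / 2) ^ k0 < e / (4 * D)"
      using real_arch_pow_inv[of "e / (4 * D)" "1 / 2"] e by (auto simp: D_def add_pos_nonneg abs_ge_zero)
    define k where "k = Suc k0"
    have k: "k > 0" by (simp add: k_def)
    have D0: "D > 0" by (simp add: D_def add_pos_nonneg)
    have rat: "t ^ (2 * k) / \<theta> ^ (2 * k) \<le> (1 / 2) ^ k0"
    proof -
      have "t ^ (2 * k) / \<theta> ^ (2 * k) = (\<bar>t\<bar> / \<theta>) ^ (2 * k)" by (simp add: power_divide power_even_abs)
      also have "\<dots> \<le> (1 / 2) ^ (2 * k)" using \<theta> by (intro power_mono) (auto simp: \<theta>_def field_simps)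
      also have "\<dots> \<le> (1 / 2) ^ k0" by (intro power_decreasing) (auto simp: k_def)
      finally show ?thesis .
    qed
    let ?f = "\<lambda>x j. avg (T x) (\<lambda>z. S x z ^ j)" and ?g = "\<lambda>x j. avg (M x) (\<lambda>z. Y x z ^ j)"
    let ?c = "\<lambda>j. (\<i> * complex_of_real t) ^ j / fact j"
    define q where "q = t ^ (2 * k) / fact (2 * k)"
    have q0: "q \<ge> 0" by (simp add: q_def)
    have tail: "q * (fact (2 * k) * C \<theta> / \<theta> ^ (2 * k)) \<le> e / 4"
    proof -
      have "q * (fact (2 * k) * C \<theta> / \<theta> ^ (2 * k)) = C \<theta> * (t ^ (2 * k) / \<theta> ^ (2 * k))" by (simp add: q_def)
      also have "\<dots> \<le> D * (t ^ (2 * k) / \<theta> ^ (2 * k))" using \<theta> by (intro mult_right_mono) (auto simp: D_def)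
      also have "\<dots> \<le> D * (1 / 2) ^ k0" using D0 rat by (intro mult_left_mono) auto
      also have "\<dots> \<le> D * (e / (4 * D))" using D0 k0 by (intro mult_left_mono) auto
      also have "\<dots> = e / 4" using D0 by simp
      finally show ?thesis .
    qed
    have lim: "((\<lambda>x. \<Sum>j<2 * k. cmod (?c j) * \<bar>?f x j - ?g x j\<bar>) \<longlongrightarrow> 0) at_top"
    proof -
      have "((\<lambda>x. \<Sum>j<2 * k. cmod (?c j) * \<bar>?f x j - ?g x j\<bar>) \<longlongrightarrow> (\<Sum>j<2 * k. cmod (?c j) * 0)) at_top"
        by (intro tendsto_sum tendsto_mult tendsto_const tendsto_rabs_zero moments)
      then show ?thesis by simp
    qed
    have ev1: "\<forall>\<^sub>F x in at_top. \<bar>\<Sum>j<2 * k. cmod (?c j) * \<bar>?f x j - ?g x j\<bar>\<bar> < e / 4"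
      using e by (intro eventually_less_of_tendsto_0[OF lim]) simp
    have "((\<lambda>x. q * (?f x (2 * k) - ?g x (2 * k))) \<longlongrightarrow> q * 0) at_top"
      by (intro tendsto_mult tendsto_const moments)
    then have "((\<lambda>x. q * (?f x (2 * k) - ?g x (2 * k))) \<longlongrightarrow> 0) at_top" by simp
    then have ev2: "\<forall>\<^sub>F x in at_top. \<bar>q * (?f x (2 * k) - ?g x (2 * k))\<bar> < e / 4"
      using e by (intro eventually_less_of_tendsto_0) simp_all
    show "\<forall>\<^sub>F x in at_top. dist (avg (T x) (\<lambda>z. iexp (t * S x z)) - avg (M x) (\<lambda>z. iexp (t * Y x z))) 0 < e"
      using ev1 ev2 T M bound[OF \<theta>, of k]
    proof eventually_elim
      case (elim x)
      let ?A = "avg (T x) (\<lambda>z. iexp (t * S x z))" and ?B = "avg (M x) (\<lambda>z. iexp (t * Y x z))"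
      let ?PA = "\<Sum>j<2 * k. ?c j * complex_of_real (?f x j)" and ?PB = "\<Sum>j<2 * k. ?c j * complex_of_real (?g x j)"
      have a: "cmod (?A - ?PA) \<le> q * ?f x (2 * k)"
        unfolding q_def using elim k by (intro iexp_avg_approx) auto
      have b: "cmod (?B - ?PB) \<le> q * ?g x (2 * k)"
        unfolding q_def using elim k by (intro iexp_avg_approx) auto
      have "?PA - ?PB = (\<Sum>j<2 * k. ?c j * complex_of_real (?f x j - ?g x j))"
        by (simp add: sum_subtractf[symmetric] right_diff_distrib)
      then have "cmod (?PA - ?PB) \<le> (\<Sum>j<2 * k. cmod (?c j * complex_of_real (?f x j - ?g x j)))"
        by (simp only: norm_sum)
      also have "\<dots> = (\<Sum>j<2 * k. cmod (?c j) * \<bar>?f x j - ?g x j\<bar>)"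
        by (simp only: norm_mult norm_of_real)
      finally have c: "cmod (?PA - ?PB) < e / 4" using elim by linarith
      have g: "q * ?g x (2 * k) \<le> e / 4"
        using mult_left_mono[OF elim(5) q0] tail by linarith
      have f: "q * ?f x (2 * k) < e / 2" using elim(2) g unfolding right_diff_distrib by linarith
      have tri: "cmod (u - w) \<le> cmod (u - u') + cmod (u' - w') + cmod (w - w')" for u u' w w'
        using norm_triangle_ineq4[of "(u - u') + (u' - w')" "w - w'"] norm_triangle_ineq[of "u - u'" "u' - w'"] by simp
      have "cmod (?A - ?B) \<le> cmod (?A - ?PA) + cmod (?PA - ?PB) + cmod (?B - ?PB)" by (rule tri)
      then show ?case using a b c f g by (simp add: dist_norm)
    qed
  qed
  from tendsto_add[OF this charM[of t]] show ?thesis by simp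
qed

text \<open>The continuity theorem concerns sequences of measures, so the limit is tested along
  arbitrary sequences tending to infinity.\<close>

lemma bounded_continuous_limit:
  fixes h :: "real \<Rightarrow> real"
  assumes h: "continuous_on UNIV h" "\<And>t. \<bar>h t\<bar> \<le> B"
  shows "((\<lambda>x. avg (T x) (\<lambda>z. h (S x z))) \<longlongrightarrow> integral\<^sup>L std_normal_distribution h) at_top"
proof (rule tendsto_at_topI_sequentially)
  fix X :: "nat \<Rightarrow> real" assume X: "filterlim X at_top sequentially"
  have ev: "\<forall>\<^sub>F n in sequentially. finite (T (X n)) \<and> T (X n) \<noteq> {}"
    by (rule eventually_compose_filterlim[OF T X])
  have mh: "h \<in> borel_measurable borel" using h(1) by (rule borel_measurable_continuous_onI)
  interpret N: real_distribution std_normal_distribution by (rule real_dist_normal_dist)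
  have "weak_conv_m (\<lambda>n. empirical (T (X n)) (S (X n))) std_normal_distribution"
  proof (rule levy_continuity)
    fix t
    have lim: "(\<lambda>n. avg (T (X n)) (\<lambda>z. iexp (t * S (X n) z))) \<longlonglongrightarrow> complex_of_real (exp (- (t\<^sup>2) / 2))"
      by (rule filterlim_compose[OF charT X])
    have "\<forall>\<^sub>F n in sequentially. avg (T (X n)) (\<lambda>z. iexp (t * S (X n) z)) = char (empirical (T (X n)) (S (X n))) t"
      using ev
    proof eventually_elim
      case (elim n)
      then show ?case unfolding char_def by (subst integral_empirical) auto
    qed
    from Lim_transform_eventually[OF lim this]
    show "(\<lambda>n. char (empirical (T (X n)) (S (X n))) t) \<longlonglongrightarrow> char std_normal_distribution t"
      by (simp add: char_std_normal_distribution)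
  qed (auto intro: real_distribution_empirical real_dist_normal_dist)
  then have lim: "(\<lambda>n. integral\<^sup>L (empirical (T (X n)) (S (X n))) h) \<longlonglongrightarrow> integral\<^sup>L std_normal_distribution h"
    using h by (intro weak_conv_imp_integral_bdd_continuous_conv[where B = B] real_distribution_empirical real_dist_normal_dist)
      (auto simp: continuous_on_eq_continuous_at)
  have "\<forall>\<^sub>F n in sequentially. integral\<^sup>L (empirical (T (X n)) (S (X n))) h = avg (T (X n)) (\<lambda>z. h (S (X n) z))"
    using ev by eventually_elim (auto intro: integral_empirical mh)
  from Lim_transform_eventually[OF lim this]
  show "(\<lambda>n. avg (T (X n)) (\<lambda>z. h (S (X n) z))) \<longlonglongrightarrow> integral\<^sup>L std_normal_distribution h" .
qed

text \<open>A continuous cutoff reduces to bounded functions. Beyond \<open>R\<close> the function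
  is dominated by a higher moment divided by \<open>R\<close>, and that moment is bounded for the
  curves and for the normal distribution.\<close>

lemma polynomial_growth_limit:
  fixes H :: "real \<Rightarrow> real"
  assumes H: "continuous_on UNIV H" and growth: "\<And>t. \<bar>H t\<bar> \<le> B * (1 + \<bar>t\<bar>) ^ m"
  shows "((\<lambda>x. avg (T x) (\<lambda>z. H (S x z))) \<longlongrightarrow> integral\<^sup>L std_normal_distribution H) at_top"
proof -
  let ?N = std_normal_distribution
  interpret N: real_distribution ?N by (rule real_dist_normal_dist)
  \<comment> \<open>2 k = m + (m + 2): the additional power m + 2 of 1 + |t| supplies the factor 1 /
    R in the tail, and the order is even.\<close>
  define k where "k = Suc m"
  define B' where "B' = \<bar>B\<bar> * 2 ^ (2 * k)"
  have B'0: "B' \<ge> 0" by (simp add: B'_def)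
  have dom: "\<bar>B\<bar> * (1 + \<bar>t\<bar>) ^ (2 * k) \<le> B' * (1 + t ^ (2 * k))" for t :: real
  proof -
    have "(1 + \<bar>t\<bar>) ^ (2 * k) \<le> (2 * max 1 \<bar>t\<bar>) ^ (2 * k)" by (intro power_mono) auto
    also have "\<dots> = 2 ^ (2 * k) * max 1 \<bar>t\<bar> ^ (2 * k)" by (simp add: power_mult_distrib)
    also have "\<dots> \<le> 2 ^ (2 * k) * (1 + t ^ (2 * k))"
      by (intro mult_left_mono) (auto simp: max_def power_even_abs zero_le_even_power)
    finally show ?thesis unfolding B'_def mult.assoc by (intro mult_left_mono) auto
  qed
  have growth': "\<bar>H t\<bar> \<le> \<bar>B\<bar> * (1 + \<bar>t\<bar>) ^ m" for t
    using growth by (rule order_trans) (intro mult_right_mono, auto)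
  obtain BT where BT: "\<forall>\<^sub>F x in at_top. avg (T x) (\<lambda>z. S x z ^ (2 * k)) \<le> BT" using bounded_even_moment by blast
  define BN where "BN = integral\<^sup>L ?N (\<lambda>t. t ^ (2 * k))"
  define L where "L = B' * (1 + \<bar>BT\<bar>) + B' * (1 + \<bar>BN\<bar>) + 1"
  have L0: "L > 0" unfolding L_def using B'0 by (intro add_nonneg_pos add_nonneg_nonneg mult_nonneg_nonneg) auto
  have mH: "H \<in> borel_measurable borel" using H by (rule borel_measurable_continuous_onI)
  have intp: "integrable ?N (\<lambda>t. B' * (1 + t ^ (2 * k)))"
    by (intro Bochner_Integration.integrable_mult_right Bochner_Integration.integrable_add
          integrable_std_normal_distribution_moment) simp
  define cut where "cut R t = max 0 (min 1 (R + 1 - \<bar>t\<bar>))" for R t :: real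
  have cut01: "0 \<le> cut R t" "cut R t \<le> 1" for R t by (auto simp: cut_def)
  have tail: "\<bar>H t * (1 - cut R t)\<bar> \<le> B' * (1 + t ^ (2 * k)) / R" if R: "R > 0" for R t
  proof (cases "\<bar>t\<bar> \<le> R")
    case True
    then have "cut R t = 1" by (simp add: cut_def)
    then show ?thesis using R B'0 by (simp add: zero_le_even_power)
  next
    case False
    have "\<bar>H t * (1 - cut R t)\<bar> \<le> \<bar>H t\<bar> * 1" unfolding abs_mult using cut01[of R t] by (intro mult_left_mono) auto
    also have "\<bar>H t\<bar> * 1 \<le> \<bar>B\<bar> * (1 + \<bar>t\<bar>) ^ m"
      using growth'[of t] by simp
    also have "\<dots> \<le> \<bar>B\<bar> * (1 + \<bar>t\<bar>) ^ m * ((1 + \<bar>t\<bar>) ^ Suc (Suc m) / R)"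
    proof -
      have "R \<le> (1 + \<bar>t\<bar>) ^ 1" using False by simp
      also have "\<dots> \<le> (1 + \<bar>t\<bar>) ^ Suc (Suc m)" by (rule power_increasing) auto
      finally have "1 \<le> (1 + \<bar>t\<bar>) ^ Suc (Suc m) / R" using R by (simp add: le_divide_eq)
      moreover have "0 \<le> \<bar>B\<bar> * (1 + \<bar>t\<bar>) ^ m" by simp
      ultimately have "\<bar>B\<bar> * (1 + \<bar>t\<bar>) ^ m * 1 \<le> \<bar>B\<bar> * (1 + \<bar>t\<bar>) ^ m * ((1 + \<bar>t\<bar>) ^ Suc (Suc m) / R)"
        by (rule mult_left_mono)
      then show ?thesis by (simp only: mult_1_right)
    qed
    also have "\<dots> = \<bar>B\<bar> * (1 + \<bar>t\<bar>) ^ (2 * k) / R"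
      by (simp add: k_def power_add mult_2)
    also have "\<dots> \<le> B' * (1 + t ^ (2 * k)) / R" using R dom by (intro divide_right_mono) auto
    finally show ?thesis .
  qed
  have contc: "continuous_on UNIV (\<lambda>t. H t * cut R t)" for R
    unfolding cut_def by (intro continuous_intros H)
  have bddc: "\<exists>Bc. \<forall>t. \<bar>H t * cut R t\<bar> \<le> Bc" if R: "R > 0" for R
  proof -
    have "\<bar>H t * cut R t\<bar> \<le> \<bar>B\<bar> * (2 + R) ^ m" for t
    proof (cases "\<bar>t\<bar> \<le> R + 1")
      case True
      have "\<bar>H t * cut R t\<bar> \<le> \<bar>H t\<bar> * 1" unfolding abs_mult using cut01[of R t] by (intro mult_left_mono) auto
      also have "\<bar>H t\<bar> * 1 \<le> \<bar>B\<bar> * (1 + \<bar>t\<bar>) ^ m"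
        using growth'[of t] by simp
      also have "\<dots> \<le> \<bar>B\<bar> * (2 + R) ^ m" using True by (intro mult_left_mono power_mono) auto
      finally show ?thesis .
    next
      case False
      then have "cut R t = 0" by (simp add: cut_def)
      then show ?thesis using R by simp
    qed
    then show ?thesis by blast
  qed
  have mcut: "(\<lambda>t. H t * cut R t) \<in> borel_measurable borel" for R
    using contc by (rule borel_measurable_continuous_onI)
  have intH: "integrable ?N H"
  proof (rule Bochner_Integration.integrable_bound[OF intp])
    have "\<bar>H t\<bar> \<le> B' * (1 + t ^ (2 * k))" for t
    proof -
      have "\<bar>H t\<bar> \<le> \<bar>B\<bar> * (1 + \<bar>t\<bar>) ^ m"
        by (rule growth')
      also have "\<dots> \<le> \<bar>B\<bar> * (1 + \<bar>t\<bar>) ^ (2 * k)" by (intro mult_left_mono power_increasing) (auto simp: k_def)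
      finally show ?thesis using dom[of t] by linarith
    qed
    then show "AE t in ?N. norm (H t) \<le> norm (B' * (1 + t ^ (2 * k)))" by (intro AE_I2) (metis abs_ge_self order_trans real_norm_def)
  qed (use mH in simp)
  show ?thesis
  proof (rule tendstoI)
    fix e :: real assume e: "e > 0"
    \<comment> \<open>With this choice the two tails together stay below L / R = e / 2.\<close>
    define R where "R = 2 * L / e"
    have R: "R > 0" using L0 e by (simp add: R_def)
    have LR: "L / R = e / 2" using L0 e by (simp add: R_def)
    obtain Bc where Bc: "\<And>t. \<bar>H t * cut R t\<bar> \<le> Bc" using bddc[OF R] by blast
    have intc: "integrable ?N (\<lambda>t. H t * cut R t)"
      using Bc mcut by (intro N.integrable_const_bound[where B = Bc]) auto
    have NI: "\<bar>integral\<^sup>L ?N H - integral\<^sup>L ?N (\<lambda>t. H t * cut R t)\<bar> \<le> B' * (1 + \<bar>BN\<bar>) / R"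
    proof -
      have "integral\<^sup>L ?N H - integral\<^sup>L ?N (\<lambda>t. H t * cut R t) = integral\<^sup>L ?N (\<lambda>t. H t * (1 - cut R t))"
        using intH intc by (simp add: right_diff_distrib)
      also have "\<bar>\<dots>\<bar> \<le> integral\<^sup>L ?N (\<lambda>t. \<bar>H t * (1 - cut R t)\<bar>)" by (rule integral_abs_bound)
      also have "\<dots> \<le> integral\<^sup>L ?N (\<lambda>t. B' * (1 + t ^ (2 * k)) / R)"
      proof (rule integral_mono)
        show "integrable ?N (\<lambda>t. \<bar>H t * (1 - cut R t)\<bar>)"
          using intH intc by (simp add: right_diff_distrib)
        show "integrable ?N (\<lambda>t. B' * (1 + t ^ (2 * k)) / R)" using intp by simp
        show "\<bar>H t * (1 - cut R t)\<bar> \<le> B' * (1 + t ^ (2 * k)) / R" for t using tail[OF R] .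
      qed
      also have "\<dots> = B' * (1 + BN) / R"
        using N.prob_space by (simp add: BN_def integrable_std_normal_distribution_moment)
      also have "\<dots> \<le> B' * (1 + \<bar>BN\<bar>) / R" using R B'0 by (intro divide_right_mono mult_left_mono) auto
      finally show ?thesis .
    qed
    have gap: "B' * (1 + \<bar>BT\<bar>) / R + B' * (1 + \<bar>BN\<bar>) / R < e / 2"
    proof -
      have "(B' * (1 + \<bar>BT\<bar>) + B' * (1 + \<bar>BN\<bar>)) / R < L / R" using R by (intro divide_strict_right_mono) (auto simp: L_def)
      then show ?thesis using LR by (simp add: add_divide_distrib)
    qed
    have "\<forall>\<^sub>F x in at_top. dist (avg (T x) (\<lambda>z. H (S x z) * cut R (S x z))) (integral\<^sup>L ?N (\<lambda>t. H t * cut R t)) < e / 2"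
      using bounded_continuous_limit[OF contc Bc] e by (intro tendstoD) auto
    then show "\<forall>\<^sub>F x in at_top. dist (avg (T x) (\<lambda>z. H (S x z))) (integral\<^sup>L ?N H) < e"
      using BT T
    proof eventually_elim
      case (elim x)
      have "\<bar>avg (T x) (\<lambda>z. H (S x z)) - avg (T x) (\<lambda>z. H (S x z) * cut R (S x z))\<bar> \<le> B' * (1 + \<bar>BT\<bar>) / R"
      proof -
        have "avg (T x) (\<lambda>z. H (S x z)) - avg (T x) (\<lambda>z. H (S x z) * cut R (S x z)) = avg (T x) (\<lambda>z. H (S x z) * (1 - cut R (S x z)))"
          by (simp add: avg_diff right_diff_distrib)
        also have "\<bar>\<dots>\<bar> \<le> avg (T x) (\<lambda>z. \<bar>H (S x z) * (1 - cut R (S x z))\<bar>)"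
          using norm_avg[of "T x" "\<lambda>z. H (S x z) * (1 - cut R (S x z))"] by simp
        also have "\<dots> \<le> avg (T x) (\<lambda>z. B' / R * (1 + S x z ^ (2 * k)))"
          using tail[OF R] by (intro avg_mono) simp
        also have "\<dots> = B' / R * (1 + avg (T x) (\<lambda>z. S x z ^ (2 * k)))"
          unfolding avg_cmult avg_add using elim by (simp add: avg_const)
        also have "\<dots> \<le> B' / R * (1 + \<bar>BT\<bar>)" using elim R B'0 by (intro mult_left_mono) auto
        finally show ?thesis by simp
      qed
      then show ?case using elim(1) NI gap unfolding dist_real_def by linarith
    qed
  qed
qed

end

section \<open>The limit theorem\<close>

lemma equi_weaken:
  assumes "equi X \<rho> R \<delta>" "\<delta> \<le> \<epsilon>" shows "equi X \<rho> R \<epsilon>"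
  unfolding equi_def
proof (intro conjI allI impI)
  fix G :: "_ \<Rightarrow> real" and K assume G: "\<forall>v\<in>R. \<bar>G v\<bar> \<le> K"
  have "R \<noteq> {}" using assms by (simp add: equi_def)
  then have "K \<ge> 0" using G by (meson abs_ge_zero ex_in_conv order_trans)
  then have "K * \<delta> \<le> K * \<epsilon>" using assms(2) by (rule mult_left_mono[rotated])
  moreover have "\<bar>avg X (\<lambda>x. G (\<rho> x)) - avg R G\<bar> \<le> K * \<delta>" using assms(1) G by (simp add: equi_def)
  ultimately show "\<bar>avg X (\<lambda>x. G (\<rho> x)) - avg R G\<bar> \<le> K * \<epsilon>" by linarith
qed (use assms in \<open>auto simp: equi_def\<close>)

lemma eventually_power_le:
  fixes A :: "real \<Rightarrow> nat"
  assumes "\<forall>x. A x > 0" "filterlim (\<lambda>x. ln (real (A x)) / ln x) at_top at_top"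
  shows "\<forall>\<^sub>F x in at_top. x ^ N \<le> real (A x)"
proof -
  have "\<forall>\<^sub>F x in at_top. real N \<le> ln (real (A x)) / ln x"
    using assms(2) by (simp add: filterlim_at_top)
  then show ?thesis using eventually_gt_at_top[of 1]
  proof eventually_elim
    case (elim x)
    have "ln x > 0" using elim by simp
    then have "real N * ln x \<le> ln (real (A x))" using elim by (simp add: le_divide_eq)
    then have "ln (x ^ N) \<le> ln (real (A x))" using elim by (simp add: ln_realpow)
    then show ?case using elim assms(1) by (simp add: ln_le_cancel_iff)
  qed
qed

lemma finite_primes_upto_in: "finite (primes_upto_in P x)"
  by (rule finite_subset[of _ "{..nat \<lfloor>x\<rfloor>}"]) (auto simp: primes_upto_in_def le_nat_floor)

lemma card_primes_upto_in_le:
  assumes "\<forall>p\<in>P. prime p" "x \<ge> 0" shows "real (card (primes_upto_in P x)) \<le> x"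
proof -
  have "card (primes_upto_in P x) \<le> card {1..nat \<lfloor>x\<rfloor>}"
  proof (rule card_mono)
    show "primes_upto_in P x \<subseteq> {1..nat \<lfloor>x\<rfloor>}"
      using assms(1) prime_ge_1_nat by (auto simp: primes_upto_in_def le_nat_floor)
  qed simp
  then have "real (card (primes_upto_in P x)) \<le> real (nat \<lfloor>x\<rfloor>)" by simp
  also have "\<dots> \<le> x" using assms(2) by linarith
  finally show ?thesis .
qed

lemma card_primes_upto_in_at_top:
  assumes "infinite P"
  shows "filterlim (\<lambda>x. real (card (primes_upto_in P x))) at_top at_top"
  unfolding filterlim_at_top
proof
  fix Z :: real
  obtain F where F: "finite F" "card F = nat \<lceil>Z\<rceil>" "F \<subseteq> P"
    using infinite_arbitrarily_large[OF assms] by blast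
  show "\<forall>\<^sub>F x in at_top. Z \<le> real (card (primes_upto_in P x))"
    using eventually_ge_at_top[of "real (Max (insert 0 F))"]
  proof eventually_elim
    case (elim x)
    have "F \<subseteq> primes_upto_in P x"
    proof
      fix p assume p: "p \<in> F"
      then have "p \<le> Max (insert 0 F)" using F by (intro Max_ge) auto
      then have "real p \<le> x" using elim by linarith
      then show "p \<in> primes_upto_in P x" using p F by (auto simp: primes_upto_in_def)
    qed
    then have "card F \<le> card (primes_upto_in P x)" by (intro card_mono finite_primes_upto_in)
    then show ?case using F(2) by linarith
  qed
qed

lemma prod_period_le:
  assumes "finite Q" "card Q \<le> r" "\<And>p. p \<in> Q \<Longrightarrow> real p \<le> x" "x \<ge> 1"
  shows "real (period Q) \<le> x ^ (2 * r)"
proof -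
  have "real (period Q) = (\<Prod>p\<in>Q. real p * real (p - 1))" by simp
  also have "\<dots> \<le> (\<Prod>p\<in>Q. x\<^sup>2)"
  proof (intro prod_mono conjI)
    fix p assume "p \<in> Q"
    then have "real p \<le> x" "real (p - 1) \<le> x" using assms(3)[of p] by auto
    then show "real p * real (p - 1) \<le> x\<^sup>2" unfolding power2_eq_square using assms by (intro mult_mono) auto
  qed auto
  also have "\<dots> = x ^ (2 * card Q)" by (simp add: power_mult)
  also have "\<dots> \<le> x ^ (2 * r)" using assms by (intro power_increasing) auto
  finally show ?thesis .
qed

text \<open>For the r-th moment there are at most x^r products, and equidistribution modulo r primes
  costs at most a constant times x^(2 r + 1) divided by the number of values. Since \<open>A\<close>
  and \<open>B\<close> eventually exceed x^(3 r + 2), the total error is O(1 / x).\<close>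

lemma curve_pairs_moment_comparison:
  fixes \<phi> \<psi> :: "int \<Rightarrow> rat" and A B :: "real \<Rightarrow> nat"
  assumes P: "infinite P" "\<forall>p\<in>P. prime p"
    and \<phi>: "almost_injective \<phi>" "\<And>p. p \<in> P \<Longrightarrow> equiperm p (\<lambda>n. rat_mod p (\<phi> n))"
    and \<psi>: "almost_injective \<psi>" "\<And>p. p \<in> P \<Longrightarrow> equiperm p (\<lambda>n. rat_mod p (\<psi> n))"
    and A: "\<forall>x. A x > 0" "filterlim (\<lambda>x. ln (real (A x)) / ln x) at_top at_top"
    and B: "\<forall>x. B x > 0" "filterlim (\<lambda>x. ln (real (B x)) / ln x) at_top at_top"
  shows "moment_comparison (\<lambda>x. curve_pairs \<phi> \<psi> (A x) (B x))
     (\<lambda>x (E, E'). (\<Sum>p\<in>primes_upto_in P x. norm_trace E p * norm_trace E' p) / sqrt (real (card (primes_upto_in P x))))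
     (\<lambda>x. model (primes_upto_in P x)) (\<lambda>x. model_sum (primes_upto_in P x))
     (\<lambda>\<theta>. 2 * exp (\<theta>\<^sup>2 * 529\<^sup>2 * exp (\<theta> * 529)))"
proof -
  let ?S = "primes_upto_in P"
  define \<Phi> where "\<Phi> x = \<phi> ` {- int (A x)..int (A x)}" for x
  define \<Psi> where "\<Psi> x = \<psi> ` {- int (B x)..int (B x)}" for x
  have T: "curve_pairs \<phi> \<psi> (A x) (B x) = good_pairs (\<Phi> x) (\<Psi> x)" for x
    by (simp add: curve_pairs_eq \<Phi>_def \<Psi>_def)
  have fin: "finite (\<Phi> x)" "finite (\<Psi> x)" "\<Phi> x \<noteq> {}" "\<Psi> x \<noteq> {}" for x
    by (auto simp: \<Phi>_def \<Psi>_def)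
  have finT: "finite (good_pairs (\<Phi> x) (\<Psi> x))" for x
    by (rule finite_subset[of _ "full_pairs (\<Phi> x) (\<Psi> x)"]) (auto simp: good_pairs_def full_pairs_def fin)
  obtain K1 where "equidistributed_values P \<phi> K1"
    using exists_equidistributed_values[of \<phi> P] \<phi> P(2) by blast
  note K1 = this[unfolded equidistributed_values_def, rule_format]
  obtain K2 where "equidistributed_values P \<psi> K2"
    using exists_equidistributed_values[of \<psi> P] \<psi> P(2) by blast
  note K2 = this[unfolded equidistributed_values_def, rule_format]
  \<comment> \<open>At most K values are lost by collisions, and K is at most half of x^N.\<close>
  have large: "real n' \<ge> x ^ N / 2"
    if "x ^ N \<le> real n" "n \<le> n' + K" "x \<ge> 2 * real K + 2" "N \<ge> 1" for x :: real and n n' K N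
  proof -
    have "x ^ 1 \<le> x ^ N" using that by (intro power_increasing) auto
    moreover have "real n \<le> real n' + real K" using that(2) by (metis of_nat_add of_nat_le_iff)
    ultimately show ?thesis using that by (simp add: field_simps)
  qed
  have ev: "\<forall>\<^sub>F x in at_top. x \<ge> 10 \<and> x ^ N / 2 \<le> real (card (\<Phi> x)) \<and> x ^ N / 2 \<le> real (card (\<Psi> x))
      \<and> real K1 \<le> x \<and> real K2 \<le> x \<and> A x > K1 \<and> B x > K2 \<and> ?S x \<noteq> {} \<and> good_pairs (\<Phi> x) (\<Psi> x) \<noteq> {}"
    if N: "N \<ge> 1" for N
  proof -
    have "\<forall>\<^sub>F x in at_top. 1 \<le> real (card (?S x))"
      using card_primes_upto_in_at_top[OF P(1)] unfolding filterlim_at_top by (rule spec)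
    then show ?thesis
      using eventually_power_le[OF A, of N] eventually_power_le[OF B, of N]
        eventually_ge_at_top[of 10] eventually_ge_at_top[of "2 * real K1 + 2"] eventually_ge_at_top[of "2 * real K2 + 2"]
    proof eventually_elim
      case (elim x)
      have x1: "x \<le> x ^ N" using power_increasing[OF N, of x] elim by simp
      have "real K1 < real (A x)" "real K2 < real (B x)" using elim x1 by (linarith, linarith)
      then have a: "A x > K1" "B x > K2" by auto
      have "A x \<le> card (\<Phi> x) + K1" using K1[OF a(1), of "{}"] by (simp add: \<Phi>_def)
      then have cp: "x ^ N / 2 \<le> real (card (\<Phi> x))" using large[OF elim(2)] elim N by blast
      have "B x \<le> card (\<Psi> x) + K2" using K2[OF a(2), of "{}"] by (simp add: \<Psi>_def)
      then have cq: "x ^ N / 2 \<le> real (card (\<Psi> x))" using large[OF elim(3)] elim N by blast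
      \<comment> \<open>The bad share is then at most 3/5 + 1/5 < 1, so good pairs exist.\<close>
      have c5: "real (card (\<Phi> x)) \<ge> 5" "real (card (\<Psi> x)) \<ge> 5" using cp cq x1 elim by (linarith, linarith)
      have "good_pairs (\<Phi> x) (\<Psi> x) \<noteq> {}"
      proof
        assume e: "good_pairs (\<Phi> x) (\<Psi> x) = {}"
        have "full_pairs (\<Phi> x) (\<Psi> x) \<noteq> {}" "finite (full_pairs (\<Phi> x) (\<Psi> x))" using fin by (auto simp: full_pairs_def)
        then have "1 \<le> 3 / real (card (\<Phi> x)) + 1 / real (card (\<Psi> x))"
          using bad_ratio[of "\<Phi> x" "\<Psi> x"] fin e by simp
        moreover have "3 / real (card (\<Phi> x)) \<le> 3 / 5" using c5 by (intro divide_left_mono) auto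
        moreover have "1 / real (card (\<Psi> x)) \<le> 1 / 5" using c5 by (intro divide_left_mono) auto
        ultimately show False by linarith
      qed
      moreover have "?S x \<noteq> {}" using elim(1) by auto
      ultimately show ?case using elim a cp cq by auto
    qed
  qed
  show ?thesis
  proof
    show "\<forall>\<^sub>F x in at_top. finite (curve_pairs \<phi> \<psi> (A x) (B x)) \<and> curve_pairs \<phi> \<psi> (A x) (B x) \<noteq> {}"
      using ev[of 1, simplified] unfolding T by eventually_elim (use finT in auto)
    show "\<forall>\<^sub>F x in at_top. finite (model (?S x)) \<and> model (?S x) \<noteq> {}"
      using model_finite_nonempty[OF finite_primes_upto_in[of P]] P(2)
      by (intro always_eventually allI) (auto simp: primes_upto_in_def)
    have prm: "prime p" if "p \<in> ?S x" for p x using that P(2) by (auto simp: primes_upto_in_def)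
    show "\<forall>\<^sub>F x in at_top. avg (model (?S x)) (\<lambda>z. model_sum (?S x) z ^ (2 * k))
        \<le> fact (2 * k) * (2 * exp (\<theta>\<^sup>2 * 529\<^sup>2 * exp (\<theta> * 529))) / \<theta> ^ (2 * k)" if "\<theta> > 0" for k \<theta>
      using ev[of 1, simplified]
    proof eventually_elim
      case (elim x)
      then show ?case using that prm by (intro model_moment_bound finite_primes_upto_in) blast+
    qed
    show "((\<lambda>x. avg (model (?S x)) (\<lambda>z. iexp (t * model_sum (?S x) z))) \<longlongrightarrow> complex_of_real (exp (- (t\<^sup>2) / 2))) at_top" for t
    proof -
      let ?c = "\<bar>t\<bar> ^ 3 * 529 ^ 3 + 3 * t\<^sup>2 / 2 + t ^ 4 / 4"
      have "((\<lambda>x. avg (model (?S x)) (\<lambda>z. iexp (t * model_sum (?S x) z)) - complex_of_real (exp (- (t\<^sup>2) / 2))) \<longlongrightarrow> 0) at_top"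
      proof (rule Lim_null_comparison)
        show "\<forall>\<^sub>F x in at_top. norm (avg (model (?S x)) (\<lambda>z. iexp (t * model_sum (?S x) z)) - complex_of_real (exp (- (t\<^sup>2) / 2)))
            \<le> ?c / sqrt (real (card (?S x)))"
          using ev[of 1, simplified]
        proof eventually_elim
          case (elim x)
          then show ?case using prm by (intro char_model finite_primes_upto_in) blast+
        qed
        have "filterlim (\<lambda>x. sqrt (real (card (?S x)))) at_top at_top"
          by (rule filterlim_compose[OF sqrt_at_top card_primes_upto_in_at_top[OF P(1)]])
        then show "((\<lambda>x. ?c / sqrt (real (card (?S x)))) \<longlongrightarrow> 0) at_top"
          by (intro tendsto_divide_0[OF tendsto_const] filterlim_at_top_imp_at_infinity)
      qed
      then show ?thesis by (simp add: LIM_zero_iff)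
    qed
    fix r :: nat
    let ?f = "\<lambda>x (E, E'). (\<Sum>p\<in>?S x. norm_trace E p * norm_trace E' p) / sqrt (real (card (?S x)))"
    let ?N = "3 * r + 2"
    have N1: "1 \<le> ?N" by simp
    show "((\<lambda>x. avg (curve_pairs \<phi> \<psi> (A x) (B x)) (\<lambda>z. ?f x z ^ r) - avg (model (?S x)) (\<lambda>z. model_sum (?S x) z ^ r)) \<longlongrightarrow> 0) at_top"
    proof (rule Lim_null_comparison)
      show "((\<lambda>x::real. (529 ^ r * 48) / x) \<longlongrightarrow> 0) at_top"
        by (intro tendsto_divide_0[OF tendsto_const] filterlim_at_top_imp_at_infinity filterlim_ident)
      show "\<forall>\<^sub>F x in at_top. norm (avg (curve_pairs \<phi> \<psi> (A x) (B x)) (\<lambda>z. ?f x z ^ r) - avg (model (?S x)) (\<lambda>z. model_sum (?S x) z ^ r))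
          \<le> (529 ^ r * 48) / x"
        using ev[OF N1]
      proof eventually_elim
        case (elim x)
        define n where "n = real (card (?S x))"
        have n1: "n \<ge> 1" using elim finite_primes_upto_in[of P x] by (simp add: n_def Suc_le_eq card_gt_0_iff)
        have nx: "n \<le> x" unfolding n_def using elim P(2) by (intro card_primes_upto_in_le) auto
        have x1: "x \<ge> 1" using elim by simp
        \<comment> \<open>The numerators are at most 4 x^(2 r + 1) and the number of values is at
          least half of x^(3 r + 2), hence the 8. The error below adds up to at most 6 \<delta>,
          hence the 48.\<close>
        define \<delta> where "\<delta> = 8 * x ^ (2 * r + 1) / x ^ ?N"
        have xN: "x ^ ?N > 0" using x1 by simp
        have delta: "(2 * W + 2 * K) / c \<le> \<delta>" if "W \<le> x ^ (2 * r)" "K \<le> x" "x ^ ?N / 2 \<le> c" for W K c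
        proof -
          have "W \<le> x ^ (2 * r + 1)"
            using that(1) power_increasing[of "2 * r" "2 * r + 1" x] x1 by linarith
          moreover have "K \<le> x ^ (2 * r + 1)"
            using that(2) power_increasing[of 1 "2 * r + 1" x] x1 unfolding power_one_right by linarith
          moreover have c0: "c > 0" using that(3) xN by linarith
          ultimately have "(2 * W + 2 * K) / c \<le> (4 * x ^ (2 * r + 1)) / c"
            by (intro divide_right_mono) auto
          also have "\<dots> \<le> (4 * x ^ (2 * r + 1)) / (x ^ ?N / 2)"
            using x1 by (intro divide_left_mono that(3) mult_pos_pos c0) auto
          finally show ?thesis by (simp add: \<delta>_def)
        qed
        have cmp: "\<bar>avg (good_pairs (\<Phi> x) (\<Psi> x)) (\<lambda>(E, E'). (\<Sum>p\<in>?S x. norm_trace E p * norm_trace E' p) ^ r)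
            - avg (model (?S x)) (\<lambda>z. (\<Sum>p\<in>?S x. prodtrace p (coords p z)) ^ r)\<bar>
          \<le> real (card (?S x)) ^ r * (529 ^ r * (2 * (3 / real (card (\<Phi> x)) + 1 / real (card (\<Psi> x))) + 2 * \<delta> + 2 * \<delta>))"
        proof (rule compare_moment[OF finite_primes_upto_in prm])
          fix Q assume Q: "Q \<subseteq> ?S x" "card Q \<le> r"
          have finQ: "finite Q" using Q(1) finite_primes_upto_in finite_subset by blast
          have QP: "Q \<subseteq> P" using Q(1) by (auto simp: primes_upto_in_def)
          have W: "real (period Q) \<le> x ^ (2 * r)"
            using Q finQ x1 by (intro prod_period_le) (auto simp: primes_upto_in_def)
          show "equi (\<Phi> x) (rat_residues Q) (residue_vectors Q) \<delta> \<and>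
                equi (\<Psi> x) (rat_residues Q) (residue_vectors Q) \<delta>"
          proof
            show "equi (\<Phi> x) (rat_residues Q) (residue_vectors Q) \<delta>"
            proof (rule equi_weaken)
              show "equi (\<Phi> x) (rat_residues Q) (residue_vectors Q)
                 ((2 * real (period Q) + 2 * real K1) / real (card (\<Phi> x)))"
                unfolding \<Phi>_def using K1[of "A x" Q] elim finQ QP by blast
            qed (use elim W in \<open>intro delta, auto\<close>)
            show "equi (\<Psi> x) (rat_residues Q) (residue_vectors Q) \<delta>"
            proof (rule equi_weaken)
              show "equi (\<Psi> x) (rat_residues Q) (residue_vectors Q)
                 ((2 * real (period Q) + 2 * real K2) / real (card (\<Psi> x)))"
                unfolding \<Psi>_def using K2[of "B x" Q] elim finQ QP by blast
            qed (use elim W in \<open>intro delta, auto\<close>)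
          qed
        qed (use elim in auto)
        also have "\<dots> \<le> x ^ r * (529 ^ r * (48 * x ^ (2 * r + 1) / x ^ ?N))"
        proof (intro mult_mono power_mono mult_left_mono)
          have c0: "0 < real (card (\<Phi> x))" "0 < real (card (\<Psi> x))" "0 < x ^ ?N / 2"
            using fin xN by (simp_all only: of_nat_0_less_iff card_gt_0_iff) auto
          have "3 / real (card (\<Phi> x)) \<le> 3 / (x ^ ?N / 2)" using elim c0 by (intro divide_left_mono mult_pos_pos) linarith+
          moreover have "1 / real (card (\<Psi> x)) \<le> 1 / (x ^ ?N / 2)" using elim c0 by (intro divide_left_mono mult_pos_pos) linarith+
          ultimately have "3 / real (card (\<Phi> x)) + 1 / real (card (\<Psi> x)) \<le> 3 / (x ^ ?N / 2) + 1 / (x ^ ?N / 2)"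
            by (rule add_mono)
          also have "\<dots> = 8 / x ^ ?N" by (simp add: add_divide_distrib[symmetric])
          also have "\<dots> \<le> 8 * x ^ (2 * r + 1) / x ^ ?N"
            using xN x1 by (intro divide_right_mono) (auto simp del: power_Suc)
          finally have le: "3 / real (card (\<Phi> x)) + 1 / real (card (\<Psi> x)) \<le> \<delta>" unfolding \<delta>_def .
          have eq48: "48 * x ^ (2 * r + 1) / x ^ ?N = 6 * \<delta>" by (simp add: \<delta>_def)
          show "2 * (3 / real (card (\<Phi> x)) + 1 / real (card (\<Psi> x))) + 2 * \<delta> + 2 * \<delta> \<le> 48 * x ^ (2 * r + 1) / x ^ ?N"
            unfolding eq48 using mult_left_mono[OF le, of 2] by linarith
        qed (use nx x1 xN in \<open>auto simp: n_def \<delta>_def\<close>)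
        also have "\<dots> = (529 ^ r * 48) / x"
        proof -
          have "x ^ ?N = x ^ r * x ^ (2 * r + 1) * x"
            by (simp add: power_add[symmetric] power_Suc2[symmetric] del: power_Suc power_Suc2)
          then show ?thesis using x1 by simp
        qed
        finally have main: "\<bar>avg (good_pairs (\<Phi> x) (\<Psi> x)) (\<lambda>(E, E'). (\<Sum>p\<in>?S x. norm_trace E p * norm_trace E' p) ^ r)
            - avg (model (?S x)) (\<lambda>z. (\<Sum>p\<in>?S x. prodtrace p (coords p z)) ^ r)\<bar> \<le> (529 ^ r * 48) / x" .
        \<comment> \<open>The normalisation contributes a factor of at most 1 and so does not
          increase the error.\<close>
        define s where "s = 1 / sqrt n ^ r"
        have s: "0 \<le> s" "s \<le> 1" using n1 by (auto simp: s_def divide_le_eq one_le_power)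
        have e1: "avg (curve_pairs \<phi> \<psi> (A x) (B x)) (\<lambda>z. ?f x z ^ r)
            = s * avg (good_pairs (\<Phi> x) (\<Psi> x)) (\<lambda>(E, E'). (\<Sum>p\<in>?S x. norm_trace E p * norm_trace E' p) ^ r)"
          unfolding T avg_cmult[symmetric] by (rule avg_cong) (auto simp: s_def n_def power_divide)
        have e2: "avg (model (?S x)) (\<lambda>z. model_sum (?S x) z ^ r)
            = s * avg (model (?S x)) (\<lambda>z. (\<Sum>p\<in>?S x. prodtrace p (coords p z)) ^ r)"
          unfolding avg_cmult[symmetric] by (rule avg_cong) (auto simp: s_def n_def power_divide model_sum_def)
        show ?case unfolding e1 e2 right_diff_distrib[symmetric] real_norm_def abs_mult
          using mult_mono[OF s(2) main] s by simp
      qed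
    qed
  qed
qed

text \<open>Growth of \<open>H\<close> is bounded by a polynomial because its tails are controlled
  through moments; continuity alone does not even make the Gaussian integral converge.\<close>

theorem theorem1p6:
  fixes H :: "real \<Rightarrow> real" and P :: "nat set" and \<phi> \<psi> :: "int \<Rightarrow> rat"
    and A B :: "real \<Rightarrow> nat"
  assumes "continuous_on UNIV H"
    and "\<exists>C. \<exists>m::nat. \<forall>t. \<bar>H t\<bar> \<le> C * (1 + \<bar>t\<bar>) ^ m"
    and "infinite P" and "\<forall>p\<in>P. prime p"
    and "(\<exists>f g :: int poly.
            permutation_poly_for P f \<and> permutation_poly_for P g \<and>
            (\<forall>n. \<phi> n = of_int (poly f n)) \<and> (\<forall>n. \<psi> n = of_int (poly g n)))
       \<or> (\<exists>a b c d e k :: int.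
            a \<noteq> 0 \<and> c \<noteq> 0 \<and> d \<noteq> 0 \<and> k \<noteq> 0 \<and>
            (\<forall>n. \<phi> n = of_int (a * n + b) * of_int c powi n) \<and>
            (\<forall>n. \<psi> n = of_int (d * n + e) * of_int k powi n) \<and>
            (\<forall>p\<in>P. \<not> int p dvd a * b * c * d * e * k))"
    and "\<forall>x. A x > 0" and "\<forall>x. B x > 0"
    and "filterlim (\<lambda>x. ln (real (A x)) / ln x) at_top at_top"
    and "filterlim (\<lambda>x. ln (real (B x)) / ln x) at_top at_top"
  shows "((\<lambda>x. 1 / real (card (curve_pairs \<phi> \<psi> (A x) (B x))) *
            (\<Sum>(E, E') \<in> curve_pairs \<phi> \<psi> (A x) (B x).
               H ((\<Sum>p \<in> primes_upto_in P x. norm_trace E p * norm_trace E' p)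
                   / sqrt (real (card (primes_upto_in P x))))))
          \<longlongrightarrow> 1 / sqrt (2 * pi) * (\<integral>t. H t * exp (- (t ^ 2) / 2) \<partial>lborel)) at_top"
proof -
  \<comment> \<open>Both alternatives enter the rest of the argument only through these two
    properties of each coefficient family.\<close>
  have fam: "almost_injective \<phi> \<and> almost_injective \<psi> \<and>
      (\<forall>p\<in>P. equiperm p (\<lambda>n. rat_mod p (\<phi> n)) \<and> equiperm p (\<lambda>n. rat_mod p (\<psi> n)))"
    using assms(5)
  proof (elim disjE exE conjE)
    fix f g :: "int poly"
    assume fg: "permutation_poly_for P f" "permutation_poly_for P g"
      "\<forall>n. \<phi> n = of_int (poly f n)" "\<forall>n. \<psi> n = of_int (poly g n)"
    have eq: "\<phi> = (\<lambda>n. of_int (poly f n))" "\<psi> = (\<lambda>n. of_int (poly g n))" using fg(3,4) by auto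
    show ?thesis unfolding eq
      using fg(1,2) assms(3,4) unfolding permutation_poly_for_def
      by (intro conjI ballI almost_injective_poly[of P] equiperm_poly) auto
  next
    fix a b c d e k :: int
    assume ac: "a \<noteq> 0" "c \<noteq> 0" "d \<noteq> 0" "k \<noteq> 0"
      and f: "\<forall>n. \<phi> n = of_int (a * n + b) * of_int c powi n" "\<forall>n. \<psi> n = of_int (d * n + e) * of_int k powi n"
      and nd: "\<forall>p\<in>P. \<not> int p dvd a * b * c * d * e * k"
    have eq: "\<phi> = (\<lambda>n. of_int (a * n + b) * of_int c powi n)" "\<psi> = (\<lambda>n. of_int (d * n + e) * of_int k powi n)"
      using f by auto
    have nd': "\<not> int p dvd a" "\<not> int p dvd c" "\<not> int p dvd d" "\<not> int p dvd k" if "p \<in> P" for p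
      using nd that by (auto intro: dvd_mult dvd_mult2)
    show ?thesis unfolding eq
      using ac nd' assms(4)
      by (intro conjI ballI almost_injective_linear_exp equiperm_linear_exp) auto
  qed
  then interpret moment_comparison "\<lambda>x. curve_pairs \<phi> \<psi> (A x) (B x)"
     "\<lambda>x (E, E'). (\<Sum>p\<in>primes_upto_in P x. norm_trace E p * norm_trace E' p) / sqrt (real (card (primes_upto_in P x)))"
     "\<lambda>x. model (primes_upto_in P x)" "\<lambda>x. model_sum (primes_upto_in P x)"
     "\<lambda>\<theta>. 2 * exp (\<theta>\<^sup>2 * 529\<^sup>2 * exp (\<theta> * 529))"
    using assms by (intro curve_pairs_moment_comparison) auto
  obtain C m where "\<And>t. \<bar>H t\<bar> \<le> C * (1 + \<bar>t\<bar>) ^ m" using assms(2) by blast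
  from polynomial_growth_limit[OF assms(1) this]
  have "((\<lambda>x. avg (curve_pairs \<phi> \<psi> (A x) (B x)) (\<lambda>(E, E'). H ((\<Sum>p\<in>primes_upto_in P x. norm_trace E p * norm_trace E' p)
      / sqrt (real (card (primes_upto_in P x)))))) \<longlongrightarrow> integral\<^sup>L std_normal_distribution H) at_top"
    by (simp add: case_prod_unfold)
  then show ?thesis
    unfolding std_normal_integral[OF borel_measurable_continuous_onI[OF assms(1)]]
    by (simp add: avg_def)
qed

end
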